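(* Let $(M, ds^2_{\rm K})$ be a smooth Riemannian manifold, $V: M \to \mathbb{R}$ a smooth function, $E \in \mathbb{R}$, $f = 2(E-V)$, and let $ds^2_{\rm JM} = f\, ds^2_{\rm K}$ be the Jacobi--Maupertuis (JM) metric on the Hill region $\mathcal{H} = \{q \in M : f(q) \ge 0\}$. Let $q_0$ be a regular point of the Hill boundary $\partial\mathcal{H} = \{f = 0\}$, i.e. $f(q_0)=0$ and $df(q_0) \neq 0$. Then any JM geodesic which comes sufficiently close to $q_0$ contains a pair of conjugate points close to $q_0$ which are conjugate along a short arc of the geodesic close to $q_0$. Precisely: for every neighborhood $U$ of $q_0$ in $\mathcal{H}$ and every $\eta > 0$ there is a neighborhood $U' \subset U$ of $q_0$ in $\mathcal{H}$ such that every JM geodesic that meets $U'$ contains two points $q_1, q_2 \in U$ that are conjugate along a sub-arc of the geodesic which is contained in $U$ and has JM length less than $\eta$. In particular, every such geodesic fails to minimize JM length.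
   Context: Newton's equations on $M$ are $\nabla_{\dot\gamma}\dot\gamma = -\nabla V(\gamma)$, where $\nabla$ is the Levi-Civita connection (respectively the gradient) of $ds^2_{\rm K}$. The energy $\frac12\langle\dot\gamma,\dot\gamma\rangle + V(\gamma)$ is constant along solutions. A solution of energy $E$ satisfies $\|\dot\gamma\|^2 = f(\gamma)$, so it lies in $\mathcal{H}$, and it touches $\partial\mathcal{H}$ exactly at the instants when $\dot\gamma=0$. A JM geodesic means a curve in $\mathcal{H}$ which, up to reparameterization, is a maximal solution of Newton's equations with energy $E$. In the interior $\{f>0\}$ these are exactly the geodesics of the Riemannian metric $ds^2_{\rm JM}$. A solution that reaches $\partial \mathcal H$ at time $t_0$ (a "brake orbit", with "brake point" $\gamma(t_0)$) satisfies $\gamma(t_0+t)=\gamma(t_0-t)$, and is included among the JM geodesics. Conjugate points: for $q$ with $f(q)>0$, consider the map $\Gamma_q(v,t) = \gamma_{v}(t)$, where $v$ ranges over the sphere $\{v\in T_qM : \|v\|^2_{\rm K} = f(q)\}$, $t>0$, and $\gamma_v$ is the solution of Newton's equations with $\gamma_v(0)=q$, $\dot\gamma_v(0)=v$. A point $c = \Gamma_q(v,t)$ is conjugate to $q$ along the arc $\gamma_v([0,t])$ if $(v,t)$ is a critical point of $\Gamma_q$. (Away from $\partial\mathcal{H}$ this is the usual Riemannian notion for $ds^2_{\rm JM}$. This definition also covers the case $c\in\partial\mathcal{H}$.) A geodesic fails to minimize JM length if it contains a compact sub-arc whose JM length is strictly greater than the infimum of the JM lengths of curves in $\mathcal{H}$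 joining the endpoints of that sub-arc. *)

theory Defs
  imports "HOL-Analysis.Analysis"
begin

section \<open>Smooth Riemannian manifolds\<close>

fun k_smooth_on :: "nat \<Rightarrow> 'a::euclidean_space set \<Rightarrow> ('a \<Rightarrow> 'b::real_normed_vector) \<Rightarrow> bool" where
  "k_smooth_on 0 S F \<longleftrightarrow> continuous_on S F"
| "k_smooth_on (Suc k) S F \<longleftrightarrow>
     (\<forall>x\<in>S. F differentiable (at x)) \<and> (\<forall>u. k_smooth_on k S (\<lambda>x. frechet_derivative F (at x) u))"

definition smooth_on :: "'a::euclidean_space set \<Rightarrow> ('a \<Rightarrow> 'b::real_normed_vector) \<Rightarrow> bool" where
  "smooth_on S F \<longleftrightarrow> (\<forall>k. k_smooth_on k S F)"

text \<open>
  A manifold is a Hausdorff, second countable type \<open>'m\<close> with a smooth atlas; the model space is an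
  arbitrary Euclidean space \<open>'a\<close>. A chart is a pair of its domain and its coordinate map, of which
  only the values on the domain matter.
\<close>

type_synonym ('m, 'a) chart = "'m set \<times> ('m \<Rightarrow> 'a)"

abbreviation cdom :: "('m, 'a) chart \<Rightarrow> 'm set" where "cdom \<equiv> fst"

abbreviation coord :: "('m, 'a) chart \<Rightarrow> 'm \<Rightarrow> 'a" where "coord \<equiv> snd"

abbreviation cimage :: "('m, 'a) chart \<Rightarrow> 'a set" where "cimage c \<equiv> coord c ` cdom c"

definition cinv :: "('m, 'a) chart \<Rightarrow> 'a \<Rightarrow> 'm" where
  "cinv c = inv_into (cdom c) (coord c)"

definition is_chart :: "('m::topological_space, 'a::euclidean_space) chart \<Rightarrow> bool" where
  "is_chart c \<longleftrightarrow> open (cdom c) \<and> open (cimage c) \<and>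
     homeomorphism (cdom c) (cimage c) (coord c) (cinv c)"

definition smooth_atlas ::
  "('m::{t2_space, second_countable_topology}, 'a::euclidean_space) chart set \<Rightarrow> bool" where
  "smooth_atlas A \<longleftrightarrow>
     (\<forall>c\<in>A. is_chart c) \<and> (\<Union>c\<in>A. cdom c) = UNIV \<and>
     (\<forall>c\<in>A. \<forall>d\<in>A. smooth_on (coord c ` (cdom c \<inter> cdom d)) (coord d \<circ> cinv c))"

definition smooth_scalar ::
  "('m, 'a::euclidean_space) chart set \<Rightarrow> ('m \<Rightarrow> real) \<Rightarrow> bool" where
  "smooth_scalar A h \<longleftrightarrow> (\<forall>c\<in>A. smooth_on (cimage c) (h \<circ> cinv c))"

definition differential :: "('m, 'a::euclidean_space) chart \<Rightarrow> ('m \<Rightarrow> real) \<Rightarrow> 'm \<Rightarrow> 'a \<Rightarrow> real" where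
  "differential c h q = frechet_derivative (h \<circ> cinv c) (at (coord c q))"

text \<open>
  A covariant 2-tensor field is given by its expressions in the charts: \<open>g c x u w\<close> is the
  value, at the point with \<open>c\<close>-coordinates \<open>x\<close>, on the tangent vectors with
  \<open>c\<close>-components \<open>u\<close> and \<open>w\<close>.
\<close>

type_synonym ('m, 'a) tensor2 = "('m, 'a) chart \<Rightarrow> 'a \<Rightarrow> 'a \<Rightarrow> 'a \<Rightarrow> real"

definition riemannian_metric ::
  "('m, 'a::euclidean_space) chart set \<Rightarrow> ('m, 'a) tensor2 \<Rightarrow> bool" where
  "riemannian_metric A g \<longleftrightarrow>
     (\<forall>c\<in>A. \<forall>x\<in>cimage c.
        (\<forall>u w. g c x u w = g c x w u) \<and> (\<forall>u. linear (g c x u)) \<and> (\<forall>u. u \<noteq> 0 \<longrightarrow> g c x u u > 0)) \<and>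
     (\<forall>c\<in>A. \<forall>u w. smooth_on (cimage c) (\<lambda>x. g c x u w)) \<and>
     (\<forall>c\<in>A. \<forall>d\<in>A. \<forall>x\<in>coord c ` (cdom c \<inter> cdom d). \<forall>u w.
        g c x u w = g d (coord d (cinv c x))
          (frechet_derivative (coord d \<circ> cinv c) (at x) u)
          (frechet_derivative (coord d \<circ> cinv c) (at x) w))"

definition riemannian_manifold ::
  "('m::{t2_space, second_countable_topology}, 'a::euclidean_space) chart set
    \<Rightarrow> ('m, 'a) tensor2 \<Rightarrow> bool" where
  "riemannian_manifold A g \<longleftrightarrow> smooth_atlas A \<and> riemannian_metric A g"

definition gradient ::
  "('m, 'a::euclidean_space) tensor2 \<Rightarrow> ('m, 'a) chart \<Rightarrow> ('m \<Rightarrow> real) \<Rightarrow> 'm \<Rightarrow> 'a" where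
  "gradient g c h q = (THE z. \<forall>y. g c (coord c q) z y = differential c h q y)"

text \<open>
  The Levi-Civita connection in a chart, \<open>\<nabla>\<^sub>U W = D\<^sub>U W + christoffel(U, W)\<close>: the Christoffel
  map is given by the Koszul formula for constant coordinate fields, whose brackets vanish.
\<close>

definition christoffel ::
  "('m, 'a::euclidean_space) tensor2 \<Rightarrow> ('m, 'a) chart \<Rightarrow> 'a \<Rightarrow> 'a \<Rightarrow> 'a \<Rightarrow> 'a" where
  "christoffel g c x u w = (THE z. \<forall>y. 2 * g c x z y =
       frechet_derivative (\<lambda>x'. g c x' w y) (at x) u
     + frechet_derivative (\<lambda>x'. g c x' u y) (at x) w
     - frechet_derivative (\<lambda>x'. g c x' u w) (at x) y)"


section \<open>Curves, speed and Newton's equations\<close>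

definition velocity ::
  "('m, 'a::euclidean_space) chart \<Rightarrow> (real \<Rightarrow> 'm) \<Rightarrow> real \<Rightarrow> 'a" where
  "velocity c \<gamma> t = vector_derivative (coord c \<circ> \<gamma>) (at t)"

definition covariant_accel ::
  "('m, 'a::euclidean_space) tensor2 \<Rightarrow> ('m, 'a) chart \<Rightarrow> (real \<Rightarrow> 'm) \<Rightarrow> real \<Rightarrow> 'a" where
  "covariant_accel g c \<gamma> t = vector_derivative (velocity c \<gamma>) (at t)
     + christoffel g c (coord c (\<gamma> t)) (velocity c \<gamma> t) (velocity c \<gamma> t)"

text \<open>The next value does not depend on the chart around \<open>\<gamma> t\<close>, by the transformation law of
  the tensor field.\<close>

definition speed_sq ::
  "('m, 'a::euclidean_space) chart set \<Rightarrow> ('m, 'a) tensor2 \<Rightarrow> (real \<Rightarrow> 'm) \<Rightarrow> real \<Rightarrow> real" where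
  "speed_sq A g \<gamma> t = (let c = (SOME c. c \<in> A \<and> \<gamma> t \<in> cdom c)
     in g c (coord c (\<gamma> t)) (velocity c \<gamma> t) (velocity c \<gamma> t))"

definition curve_length ::
  "('m, 'a::euclidean_space) chart set \<Rightarrow> ('m, 'a) tensor2 \<Rightarrow> (real \<Rightarrow> 'm) \<Rightarrow> real \<Rightarrow> real \<Rightarrow> ennreal" where
  "curve_length A g \<gamma> a b = (\<integral>\<^sup>+t\<in>{a..b}. ennreal (sqrt (speed_sq A g \<gamma> t)) \<partial>lborel)"

definition C1_arc ::
  "('m, 'a::euclidean_space) chart set \<Rightarrow> (real \<Rightarrow> 'm) \<Rightarrow> real \<Rightarrow> real \<Rightarrow> bool" where
  "C1_arc A \<delta> a b \<longleftrightarrow> (\<forall>c\<in>A. \<exists>D. continuous_on {t\<in>{a..b}. \<delta> t \<in> cdom c} D \<and>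
     (\<forall>t\<in>{a..b}. \<delta> t \<in> cdom c \<longrightarrow>
        ((coord c \<circ> \<delta>) has_vector_derivative D t) (at t within {a..b})))"

definition piecewise_C1_curve ::
  "('m::topological_space, 'a::euclidean_space) chart set \<Rightarrow> (real \<Rightarrow> 'm) \<Rightarrow> bool" where
  "piecewise_C1_curve A \<delta> \<longleftrightarrow> continuous_on {0..1} \<delta> \<and>
     (\<exists>n p. p (0::nat) = 0 \<and> p n = 1 \<and> (\<forall>i<n. p i < p (Suc i) \<and> C1_arc A \<delta> (p i) (p (Suc i))))"

definition newton_solution ::
  "('m::topological_space, 'a::euclidean_space) chart set \<Rightarrow> ('m, 'a) tensor2 \<Rightarrow> ('m \<Rightarrow> real)
    \<Rightarrow> real set \<Rightarrow> (real \<Rightarrow> 'm) \<Rightarrow> bool" where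
  "newton_solution A g V I \<gamma> \<longleftrightarrow>
     I \<noteq> {} \<and> open I \<and> is_interval I \<and> continuous_on I \<gamma> \<and>
     (\<forall>t\<in>I. \<forall>c\<in>A. \<gamma> t \<in> cdom c \<longrightarrow>
        (coord c \<circ> \<gamma>) differentiable (at t) \<and> velocity c \<gamma> differentiable (at t) \<and>
        covariant_accel g c \<gamma> t = - gradient g c V (\<gamma> t))"

definition maximal_newton_solution ::
  "('m::topological_space, 'a::euclidean_space) chart set \<Rightarrow> ('m, 'a) tensor2 \<Rightarrow> ('m \<Rightarrow> real)
    \<Rightarrow> real set \<Rightarrow> (real \<Rightarrow> 'm) \<Rightarrow> bool" where
  "maximal_newton_solution A g V I \<gamma> \<longleftrightarrow> newton_solution A g V I \<gamma> \<and>
     (\<forall>J \<delta>. newton_solution A g V J \<delta> \<and> I \<subseteq> J \<and> (\<forall>t\<in>I. \<delta> t = \<gamma> t) \<longrightarrow> J = I)"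


section \<open>The Jacobi-Maupertuis metric\<close>

definition jm_factor :: "('m \<Rightarrow> real) \<Rightarrow> real \<Rightarrow> 'm \<Rightarrow> real" where
  "jm_factor V E q = 2 * (E - V q)"

definition hill_region :: "('m \<Rightarrow> real) \<Rightarrow> real \<Rightarrow> 'm set" where
  "hill_region V E = {q. jm_factor V E q \<ge> 0}"

definition jm_metric ::
  "('m, 'a::euclidean_space) tensor2 \<Rightarrow> ('m \<Rightarrow> real) \<Rightarrow> real \<Rightarrow> ('m, 'a) tensor2" where
  "jm_metric g V E c x u w = jm_factor V E (cinv c x) * g c x u w"

abbreviation jm_length ::
  "('m, 'a::euclidean_space) chart set \<Rightarrow> ('m, 'a) tensor2 \<Rightarrow> ('m \<Rightarrow> real) \<Rightarrow> real
    \<Rightarrow> (real \<Rightarrow> 'm) \<Rightarrow> real \<Rightarrow> real \<Rightarrow> ennreal" where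
  "jm_length A g V E \<equiv> curve_length A (jm_metric g V E)"

definition jm_dist ::
  "('m::topological_space, 'a::euclidean_space) chart set \<Rightarrow> ('m, 'a) tensor2 \<Rightarrow> ('m \<Rightarrow> real)
    \<Rightarrow> real \<Rightarrow> 'm \<Rightarrow> 'm \<Rightarrow> ennreal" where
  "jm_dist A g V E p q =
     (INF \<delta>\<in>{\<delta>. piecewise_C1_curve A \<delta> \<and> \<delta> ` {0..1} \<subseteq> hill_region V E \<and> \<delta> 0 = p \<and> \<delta> 1 = q}.
        jm_length A g V E \<delta> 0 1)"

text \<open>
  A JM geodesic is a curve up to reparameterization; it is represented by its parameterization as
  a maximal solution of Newton's equations of energy \<open>E\<close>.
\<close>

definition jm_geodesic ::
  "('m::topological_space, 'a::euclidean_space) chart set \<Rightarrow> ('m, 'a) tensor2 \<Rightarrow> ('m \<Rightarrow> real)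
    \<Rightarrow> real \<Rightarrow> real set \<Rightarrow> (real \<Rightarrow> 'm) \<Rightarrow> bool" where
  "jm_geodesic A g V E I \<gamma> \<longleftrightarrow> maximal_newton_solution A g V I \<gamma> \<and>
     (\<forall>t\<in>I. speed_sq A g \<gamma> t / 2 + V (\<gamma> t) = E)"

definition fails_to_minimize ::
  "('m::topological_space, 'a::euclidean_space) chart set \<Rightarrow> ('m, 'a) tensor2 \<Rightarrow> ('m \<Rightarrow> real)
    \<Rightarrow> real \<Rightarrow> real set \<Rightarrow> (real \<Rightarrow> 'm) \<Rightarrow> bool" where
  "fails_to_minimize A g V E I \<gamma> \<longleftrightarrow>
     (\<exists>a\<in>I. \<exists>b\<in>I. a < b \<and> jm_dist A g V E (\<gamma> a) (\<gamma> b) < jm_length A g V E \<gamma> a b)"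


section \<open>Conjugate points\<close>

text \<open>
  \<open>reaches A g V c q v t p\<close>: the solution of Newton's equations that starts at \<open>q\<close> with the velocity
  whose \<open>c\<close>-components are \<open>v\<close> exists up to time \<open>t\<close> and is then at \<open>p\<close>.
\<close>

definition reaches ::
  "('m::topological_space, 'a::euclidean_space) chart set \<Rightarrow> ('m, 'a) tensor2 \<Rightarrow> ('m \<Rightarrow> real)
    \<Rightarrow> ('m, 'a) chart \<Rightarrow> 'm \<Rightarrow> 'a \<Rightarrow> real \<Rightarrow> 'm \<Rightarrow> bool" where
  "reaches A g V c q v t p \<longleftrightarrow> (\<exists>J \<delta>. newton_solution A g V J \<delta> \<and> 0 \<in> J \<and> t \<in> J \<and>
     \<delta> 0 = q \<and> velocity c \<delta> 0 = v \<and> \<delta> t = p)"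

definition end_map ::
  "('m::topological_space, 'a::euclidean_space) chart set \<Rightarrow> ('m, 'a) tensor2 \<Rightarrow> ('m \<Rightarrow> real)
    \<Rightarrow> ('m, 'a) chart \<Rightarrow> 'm \<Rightarrow> 'a \<times> real \<Rightarrow> 'm" where
  "end_map A g V c q = (\<lambda>(v, t). THE p. reaches A g V c q v t p)"

definition energy_sphere ::
  "('m, 'a::euclidean_space) tensor2 \<Rightarrow> ('m \<Rightarrow> real) \<Rightarrow> real \<Rightarrow> ('m, 'a) chart \<Rightarrow> 'm \<Rightarrow> 'a set" where
  "energy_sphere g V E c q = {v. g c (coord c q) v v = jm_factor V E q}"

definition end_map_domain ::
  "('m::topological_space, 'a::euclidean_space) chart set \<Rightarrow> ('m, 'a) tensor2 \<Rightarrow> ('m \<Rightarrow> real)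
    \<Rightarrow> real \<Rightarrow> ('m, 'a) chart \<Rightarrow> 'm \<Rightarrow> ('a \<times> real) set" where
  "end_map_domain A g V E c q =
     {(v, t). v \<in> energy_sphere g V E c q \<and> t > 0 \<and> (\<exists>p. reaches A g V c q v t p)}"

text \<open>
  The map \<open>end_map\<close>, restricted to the product of the energy sphere and the positive time axis and
  read in the charts \<open>c\<close> at \<open>q\<close> and \<open>d\<close> at the end point, is critical at \<open>(v, t)\<close> if its
  differential on the tangent space of that product is not onto. The tangent space of the
  sphere at \<open>v\<close> is the orthogonal complement of \<open>v\<close>. A derivative \<open>D\<close> within the domain is
  determined only on this tangent space, and only its restriction to it is used.
\<close>

definition end_map_critical ::
  "('m::topological_space, 'a::euclidean_space) chart set \<Rightarrow> ('m, 'a) tensor2 \<Rightarrow> ('m \<Rightarrow> real)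
    \<Rightarrow> real \<Rightarrow> ('m, 'a) chart \<Rightarrow> ('m, 'a) chart \<Rightarrow> 'm \<Rightarrow> 'a \<Rightarrow> real \<Rightarrow> bool" where
  "end_map_critical A g V E c d q v t \<longleftrightarrow>
     (v, t) \<in> end_map_domain A g V E c q \<and>
     (\<exists>D. ((coord d \<circ> end_map A g V c q) has_derivative D)
              (at (v, t) within end_map_domain A g V E c q) \<and>
          D ` ({w. g c (coord c q) v w = 0} \<times> UNIV) \<noteq> UNIV)"

text \<open>By the chain rule, criticality does not depend on the charts \<open>c\<close> and \<open>d\<close> around the end points
  of the arc.\<close>

definition conjugate_along ::
  "('m::topological_space, 'a::euclidean_space) chart set \<Rightarrow> ('m, 'a) tensor2 \<Rightarrow> ('m \<Rightarrow> real)
    \<Rightarrow> real \<Rightarrow> (real \<Rightarrow> 'm) \<Rightarrow> real \<Rightarrow> real \<Rightarrow> bool" where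
  "conjugate_along A g V E \<gamma> t1 t2 \<longleftrightarrow> jm_factor V E (\<gamma> t1) > 0 \<and> t1 < t2 \<and>
     (\<exists>c\<in>A. \<exists>d\<in>A. \<gamma> t1 \<in> cdom c \<and> \<gamma> t2 \<in> cdom d \<and>
        end_map_critical A g V E c d (\<gamma> t1) (velocity c \<gamma> t1) (t2 - t1))"

definition hill_nhd ::
  "('m::topological_space \<Rightarrow> real) \<Rightarrow> real \<Rightarrow> 'm \<Rightarrow> 'm set \<Rightarrow> bool" where
  "hill_nhd V E q U \<longleftrightarrow> U \<subseteq> hill_region V E \<and> (\<exists>W. open W \<and> q \<in> W \<and> W \<inter> hill_region V E \<subseteq> U)"

definition regular_hill_boundary_point ::
  "('m, 'a::euclidean_space) chart set \<Rightarrow> ('m \<Rightarrow> real) \<Rightarrow> real \<Rightarrow> 'm \<Rightarrow> bool" where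
  "regular_hill_boundary_point A V E q \<longleftrightarrow> jm_factor V E q = 0 \<and>
     (\<exists>c\<in>A. q \<in> cdom c \<and> (\<exists>u. differential c (jm_factor V E) q u \<noteq> 0))"

end

(*
  A geodesic that comes close to a regular point q0 of the Hill boundary is there, in a chart, a small
  perturbation of the parabola x0 + u t + a t^2 / 2, where a = - grad V (q0) and the velocity u at a
  moment t0 with f near 0 is small, because |u|^2 = f. Fix a short time \<tau> and let u be much
  smaller than a \<tau>.

  Conjugate points: start at time t0 - \<tau> with velocity v, which is close to - a \<tau>. After time s the
  derivative of the flow in the initial velocity is a map W that is close to s times the identity, so
  the final velocity, close to a (s - \<tau>), is W w for a unique w. The inner product of v and w is
  positive at s = \<tau> / 2 and negative at s = 3 \<tau> / 2. At a zero w is tangent to the energy sphere,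
  hence the differential of the end point map has the range of W on a hyperplane only.

  Minimization: the positions at t0 - \<tau> and t0 + \<tau> differ by o(\<tau>^2), and f = O(\<tau>^2) there, so a
  straight chart segment joins them with JM length o(\<tau>^3), while the arc has length of order \<tau>^3.
*)
theory Submission
  imports Defs
begin

section \<open>Ordinary differential equations on short intervals\<close>

text \<open>The arc is started at t0 - \<tau> because f must be positive at its first point, while
  at t0 the geodesic may be at rest on the Hill boundary. For a brake orbit the brake instant is one
  of the zeros sought, with w = 0; in dimension one every zero is of this kind, since the energy
  sphere has zero tangent space. A general geodesic has no such distinguished instant, and the
  intermediate value theorem supplies one; it asks only for continuity of w in s. The flow and its
  derivative in the starting point are built here from a fixed point argument and the variational
  equation. The manifold adds two obstacles: Newton's equations are imposed in every chart, so a
  chart solution has to be carried through the transition maps, and a solution is not known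
  beforehand to stay in the chart in which it is compared with the flow. All estimates must be
  uniform over the geodesics that enter the neighborhood; they involve a geodesic only through its
  state at one moment, and energy turns closeness of position to q0 into smallness of
  velocity.\<close>

lemma vector_derivative_bound:
  fixes w :: "real \<Rightarrow> 'b::real_normed_vector"
  assumes "convex S" "\<And>t. t \<in> S \<Longrightarrow> (w has_vector_derivative w' t) (at t within S)"
    and "\<And>t. t \<in> S \<Longrightarrow> norm (w' t) \<le> B" "x \<in> S" "y \<in> S"
  shows "norm (w x - w y) \<le> B * \<bar>x - y\<bar>"
proof -
  have "onorm (\<lambda>h. h *\<^sub>R w' t) \<le> B" if "t \<in> S" for t
  proof -
    have "0 \<le> B" using assms(3)[OF that] norm_ge_zero order_trans by blast
    then show ?thesis
      using assms(3)[OF that] by (intro onorm_bound) (auto simp: mult.commute[of B] intro: mult_left_mono)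
  qed
  then show ?thesis
    using differentiable_bound[of S w "\<lambda>t h. h *\<^sub>R w' t" B x y] assms
    by (auto simp: has_vector_derivative_def real_norm_def)
qed

text \<open>A substitute for Gronwall's inequality. At a maximum of \<open>norm (w t)\<close> the
  mean value inequality bounds that maximum by the norm at \<open>t0\<close>, the contribution of
  \<open>e\<close>, and at most half of the maximum itself; the half is absorbed into the left side.
  The price, \<open>L * (b - a) \<le> 1/2\<close>, is harmless since only short times
  matter.\<close>

lemma short_time_estimate:
  fixes w :: "real \<Rightarrow> 'b::real_normed_vector"
  assumes der: "\<And>t. t \<in> {a..b} \<Longrightarrow> (w has_vector_derivative w' t) (at t within {a..b})"
    and bd: "\<And>t. t \<in> {a..b} \<Longrightarrow> norm (w' t) \<le> L * norm (w t) + e"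
    and L: "0 \<le> L" "L * (b - a) \<le> 1/2" and "0 \<le> e" and t0: "t0 \<in> {a..b}" and t: "t \<in> {a..b}"
  shows "norm (w t) \<le> 2 * norm (w t0) + 2 * e * (b - a)"
proof -
  have "continuous_on {a..b} w"
    using der by (meson continuous_on_eq_continuous_within has_vector_derivative_continuous)
  then have "continuous_on {a..b} (\<lambda>t. norm (w t))" by (rule continuous_on_norm)
  then obtain s where s: "s \<in> {a..b}" "\<And>t. t \<in> {a..b} \<Longrightarrow> norm (w t) \<le> norm (w s)"
    using continuous_attains_sup[of "{a..b}" "\<lambda>t. norm (w t)"] t by auto
  have "norm (w' t) \<le> L * norm (w s) + e" if "t \<in> {a..b}" for t
    using bd[OF that] mult_left_mono[OF s(2)[OF that] L(1)] by linarith
  then have "norm (w s - w t0) \<le> (L * norm (w s) + e) * \<bar>s - t0\<bar>"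
    using der s t0 by (intro vector_derivative_bound[of "{a..b}"]) auto
  also have "\<dots> \<le> (L * norm (w s) + e) * (b - a)"
    using s t0 L \<open>0 \<le> e\<close> by (intro mult_left_mono) auto
  also have "\<dots> = (L * (b - a)) * norm (w s) + e * (b - a)" by (simp add: algebra_simps)
  also have "\<dots> \<le> 1/2 * norm (w s) + e * (b - a)"
    using L by (intro add_right_mono mult_right_mono) auto
  finally have "norm (w s) \<le> 2 * norm (w t0) + 2 * e * (b - a)"
    using norm_triangle_ineq2[of "w s" "w t0"] by linarith
  then show ?thesis using s(2)[OF t] by linarith
qed

text \<open>Banach's fixed point theorem for the integral operator. Continuity is required only
  after insertion of a continuous curve, so the lemma covers both an autonomous field and the
  variational equation, whose coefficients depend on time.\<close>

lemma picard:
  fixes f :: "real \<Rightarrow> 'b::banach \<Rightarrow> 'b"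
  assumes cont: "\<And>z. continuous_on {a..b} z \<Longrightarrow> continuous_on {a..b} (\<lambda>t. f t (z t))"
    and lip: "\<And>t y z. t \<in> {a..b} \<Longrightarrow> norm (f t y - f t z) \<le> L * norm (y - z)"
    and L: "0 \<le> L" "L * (b - a) \<le> 1/2" and t0: "t0 \<in> {a..b}"
  obtains z where "z t0 = z0"
    "\<And>t. t \<in> {a..b} \<Longrightarrow> (z has_vector_derivative f t (z t)) (at t within {a..b})"
proof -
  define J where "J u t = integral {a..t} (\<lambda>s. f s (u s))" for u t
  define Q where "Q u t = z0 + J u t - J u t0" for u t
  have dJ: "(J u has_vector_derivative f t (u t)) (at t within {a..b})"
    if "continuous_on {a..b} u" "t \<in> {a..b}" for u t
    unfolding J_def using integral_has_vector_derivative[OF cont[OF that(1)] that(2)] .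
  have dQ: "(Q u has_vector_derivative f t (u t)) (at t within {a..b})"
    if "continuous_on {a..b} u" "t \<in> {a..b}" for u t
    unfolding Q_def using dJ[OF that] by (auto intro!: derivative_eq_intros)
  have cQ: "continuous_on {a..b} (Q u)" if "continuous_on {a..b} u" for u
    using dQ[OF that] by (meson continuous_on_eq_continuous_within has_vector_derivative_continuous)
  \<comment> \<open>Extension by constants outside \<open>{a..b}\<close> (via \<open>clamp\<close>)
    lets the operator act on the bounded continuous functions on the line, a complete space.\<close>
  have "\<exists>h :: real \<Rightarrow>\<^sub>C 'b. \<forall>t. h t = Q u (clamp a b t)" for u :: "real \<Rightarrow>\<^sub>C 'b"
  proof -
    have "continuous_on (cbox a b) (Q u)" using cQ[of u] by (simp add: continuous_on_apply_bcontfun)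
    then show ?thesis by (rule continuous_on_cbox_bcontfunE) blast
  qed
  then obtain P :: "(real \<Rightarrow>\<^sub>C 'b) \<Rightarrow> (real \<Rightarrow>\<^sub>C 'b)" where
    P: "\<And>u t. P u t = Q u (clamp a b t)" by metis
  have "dist (P u) (P v) \<le> 1/2 * dist u v" for u v
  proof (rule dist_bound)
    fix t
    define s where "s = clamp a b t"
    have s: "s \<in> {a..b}" using t0 clamp_in_interval[of a b t] unfolding s_def by auto
    have cuv: "continuous_on {a..b} u" "continuous_on {a..b} v"
      by (simp_all add: continuous_on_apply_bcontfun)
    have "norm ((J u s - J v s) - (J u t0 - J v t0)) \<le> (L * dist u v) * \<bar>s - t0\<bar>"
    proof (rule vector_derivative_bound[of "{a..b}" "\<lambda>s. J u s - J v s" "\<lambda>s. f s (u s) - f s (v s)"])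
      show "((\<lambda>s. J u s - J v s) has_vector_derivative f s (u s) - f s (v s)) (at s within {a..b})"
        if "s \<in> {a..b}" for s
        using dJ[OF cuv(1) that] dJ[OF cuv(2) that] by (rule has_vector_derivative_diff)
      show "norm (f s (u s) - f s (v s)) \<le> L * dist u v" if "s \<in> {a..b}" for s
        using lip[OF that, of "u s" "v s"] mult_left_mono[OF dist_bounded[of u s v] L(1)]
        by (simp add: dist_norm)
    qed (use s t0 in auto)
    also have "\<dots> \<le> (L * dist u v) * (b - a)"
      using s t0 L by (intro mult_left_mono) auto
    also have "\<dots> = (L * (b - a)) * dist u v" by simp
    also have "\<dots> \<le> 1/2 * dist u v" using L by (intro mult_right_mono) auto
    finally show "dist (P u t) (P v t) \<le> 1/2 * dist u v"
      unfolding P s_def[symmetric] Q_def dist_norm by (simp add: algebra_simps)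
  qed
  then obtain u where u: "P u = u"
    using banach_fix_type[of "1/2" P] by auto
  have uQ: "u t = Q u t" if "t \<in> {a..b}" for t
    using P[of u t] that u by auto
  have cu: "continuous_on {a..b} u" by (simp add: continuous_on_apply_bcontfun)
  show ?thesis
  proof (rule that[of u])
    show "u t0 = z0" using uQ[OF t0] by (simp add: Q_def)
    show "(u has_vector_derivative f t (u t)) (at t within {a..b})" if "t \<in> {a..b}" for t
      using has_vector_derivative_transform[OF that uQ dQ[OF cu that]] .
  qed
qed

section \<open>Local flow of a continuously differentiable field and its derivative in the starting
  point\<close>

text \<open>\<open>LT\<close> makes the integral operator a contraction on the whole of
  \<open>{-T..T}\<close>, and \<open>MT\<close> keeps a solution that starts within
  \<open>r/2\<close> of \<open>p\<close> inside the ball of radius \<open>r\<close>. Thus one time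
  \<open>T\<close> serves all starting points in the half ball.\<close>

locale C1_field =
  fixes F :: "'b::euclidean_space \<Rightarrow> 'b" and F' :: "'b \<Rightarrow> 'b \<Rightarrow>\<^sub>L 'b"
    and p :: 'b and r M L T :: real
  assumes r: "r > 0" and T: "T > 0" and L: "L \<ge> 0"
    and deriv: "\<And>z. z \<in> cball p r \<Longrightarrow> (F has_derivative F' z) (at z)"
    and cont: "continuous_on (cball p r) F'"
    and M: "\<And>z. z \<in> cball p r \<Longrightarrow> norm (F z) \<le> M"
    and bound: "\<And>z. z \<in> cball p r \<Longrightarrow> norm (F' z) \<le> L"
    and LT: "L * (2 * T) \<le> 1/2" and MT: "M * T < r/2"
begin

definition solves :: "real set \<Rightarrow> (real \<Rightarrow> 'b) \<Rightarrow> bool" where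
  "solves J Z \<longleftrightarrow> (\<forall>t\<in>J. (Z has_vector_derivative F (Z t)) (at t within J) \<and> Z t \<in> cball p r)"

lemma M_nonneg: "M \<ge> 0"
  using order_trans[OF norm_ge_zero M[of p]] r by simp

lemma lipschitz: "norm (F y - F z) \<le> L * norm (y - z)" if "y \<in> cball p r" "z \<in> cball p r"
  by (rule differentiable_bound[of "cball p r" F "\<lambda>z. F' z"])
    (use that bound deriv in \<open>auto intro: has_derivative_at_withinI simp: norm_blinfun.rep_eq[symmetric]\<close>)

lemma solves_close:
  assumes "solves {a..b} Y" "solves {a..b} Z" "t0 \<in> {a..b}" "t \<in> {a..b}" "b - a \<le> 2 * T"
  shows "norm (Y t - Z t) \<le> 2 * norm (Y t0 - Z t0)"
proof -
  have "L * (b - a) \<le> L * (2 * T)" using assms(5) L by (rule mult_left_mono)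
  then have "norm (Y t - Z t) \<le> 2 * norm (Y t0 - Z t0) + 2 * 0 * (b - a)"
    using assms LT L
    by (intro short_time_estimate[of a b _ "\<lambda>t. F (Y t) - F (Z t)" L 0 t0 t])
      (auto simp: solves_def intro!: has_vector_derivative_diff lipschitz[simplified])
  then show ?thesis by simp
qed

lemma solves_unique:
  assumes "solves {a..b} Y" "solves {a..b} Z" "t0 \<in> {a..b}" "t \<in> {a..b}" "b - a \<le> 2 * T" "Y t0 = Z t0"
  shows "Y t = Z t"
  using solves_close[OF assms(1-5)] assms(6) by simp

text \<open>The field is composed with the nearest point projection \<open>c\<close> onto the ball,
  which is 1-Lipschitz; the composite is globally Lipschitz and \<open>picard\<close> applies. By
  \<open>MT\<close> the solution travels less than \<open>r/2\<close>, so it stays where the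
  projection is the identity and solves the original equation.\<close>

lemma solves_exists:
  assumes z: "z \<in> cball p (r/2)"
  shows "\<exists>Z. solves {-T..T} Z \<and> Z 0 = z \<and> (\<forall>t\<in>{-T..T}. Z t \<in> ball p r)"
proof -
  define c where "c = closest_point (cball p r)"
  have c: "c z \<in> cball p r" for z unfolding c_def using r by (intro closest_point_in_set) auto
  have c1: "norm (c y - c z) \<le> norm (y - z)" for y z
    using closest_point_lipschitz[of "cball p r" y z] r by (auto simp: c_def dist_norm)
  have cc: "continuous_on X c" for X
    unfolding c_def using r by (intro continuous_on_closest_point) auto
  have cF: "continuous_on (cball p r) F"
    using deriv by (meson continuous_at_imp_continuous_on has_derivative_continuous)
  have "\<exists>Z. Z 0 = z \<and> (\<forall>t\<in>{-T..T}. (Z has_vector_derivative F (c (Z t))) (at t within {-T..T}))"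
  proof (rule picard[of "-T" T "\<lambda>t z. F (c z)" L 0 z])
    show "continuous_on {- T..T} (\<lambda>t. F (c (Z t)))" if "continuous_on {-T..T} Z" for Z
    proof -
      have "continuous_on {-T..T} (\<lambda>t. c (Z t))"
        using continuous_on_compose2[OF cc that subset_refl] by simp
      then show ?thesis by (rule continuous_on_compose2[OF cF]) (use c in auto)
    qed
    show "norm (F (c y) - F (c z)) \<le> L * norm (y - z)" for y z
      using lipschitz[OF c c, of y z] mult_left_mono[OF c1 L, of y z] by linarith
  qed (use L LT T in auto)
  then obtain Z where Z0: "Z 0 = z"
    and dZ: "\<And>t. t \<in> {-T..T} \<Longrightarrow> (Z has_vector_derivative F (c (Z t))) (at t within {-T..T})"
    by blast
  have Zin: "Z t \<in> ball p r" if t: "t \<in> {-T..T}" for t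
  proof -
    have "norm (Z t - Z 0) \<le> M * \<bar>t - 0\<bar>"
      using dZ t T by (intro vector_derivative_bound[of "{-T..T}"]) (auto intro: M c)
    also have "\<dots> \<le> M * T" using t M_nonneg by (intro mult_left_mono) auto
    finally have "dist (Z 0) (Z t) < r/2" using MT by (simp add: dist_norm norm_minus_commute)
    then show ?thesis using z Z0 dist_triangle[of p "Z t" "Z 0"] by auto
  qed
  have "c (Z t) = Z t" if "t \<in> {-T..T}" for t
    unfolding c_def using Zin[OF that] by (intro closest_point_self) auto
  then have "solves {-T..T} Z" unfolding solves_def using dZ Zin by fastforce
  then show ?thesis using Z0 Zin by blast
qed

definition flow :: "'b \<Rightarrow> real \<Rightarrow> 'b" where
  "flow z = (SOME Z. solves {-T..T} Z \<and> Z 0 = z \<and> (\<forall>t\<in>{-T..T}. Z t \<in> ball p r))"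

lemma flow: "z \<in> cball p (r/2) \<Longrightarrow> solves {-T..T} (flow z)" "z \<in> cball p (r/2) \<Longrightarrow> flow z 0 = z"
  "z \<in> cball p (r/2) \<Longrightarrow> t \<in> {-T..T} \<Longrightarrow> flow z t \<in> ball p r"
  using someI_ex[OF solves_exists] unfolding flow_def by blast+

lemma flow_in_cball: "z \<in> cball p (r/2) \<Longrightarrow> t \<in> {-T..T} \<Longrightarrow> flow z t \<in> cball p r"
  using flow(1) by (auto simp: solves_def)

lemma flow_start_near:
  assumes "z \<in> cball p (r/2)" "t \<in> {-T..T}"
  shows "norm (flow z t - z) \<le> M * \<bar>t\<bar>"
proof -
  have "norm (flow z t - flow z 0) \<le> M * \<bar>t - 0\<bar>"
    using flow(1)[OF assms(1)] assms(2) T M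
    by (intro vector_derivative_bound[of "{-T..T}"]) (auto simp: solves_def)
  then show ?thesis using flow(2)[OF assms(1)] by simp
qed

lemma flow_deriv: "z \<in> cball p (r/2) \<Longrightarrow> t \<in> {-T..T} \<Longrightarrow>
    (flow z has_vector_derivative F (flow z t)) (at t within {-T..T})"
  using flow(1) by (auto simp: solves_def)

lemma flow_deriv_at: "z \<in> cball p (r/2) \<Longrightarrow> t \<in> {-T<..<T} \<Longrightarrow>
    (flow z has_vector_derivative F (flow z t)) (at t)"
  using flow_deriv[of z t] by (auto simp: at_within_Icc_at)

lemma flow_close: "y \<in> cball p (r/2) \<Longrightarrow> z \<in> cball p (r/2) \<Longrightarrow> t \<in> {-T..T} \<Longrightarrow>
    norm (flow y t - flow z t) \<le> 2 * norm (y - z)"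
  using solves_close[OF flow(1) flow(1), of y z 0 t] flow(2) T by auto

text \<open>Uniform continuity of \<open>F'\<close> on the compact ball makes the linearization
  error uniform in the base point, which will run along a trajectory.\<close>

lemma uniform_linearization:
  assumes "e > 0"
  obtains d where "d > 0" "\<And>y z. y \<in> cball p r \<Longrightarrow> z \<in> cball p r \<Longrightarrow> norm (y - z) < d \<Longrightarrow>
    norm (F y - F z - F' z (y - z)) \<le> e * norm (y - z)"
proof -
  have "uniformly_continuous_on (cball p r) F'"
    using cont by (intro compact_uniformly_continuous) auto
  then obtain d where d: "d > 0"
    "\<And>y z. y \<in> cball p r \<Longrightarrow> z \<in> cball p r \<Longrightarrow> dist z y < d \<Longrightarrow> dist (F' z) (F' y) < e"
    using assms unfolding uniformly_continuous_on_def by metis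
  have "norm (F y - F z - F' z (y - z)) \<le> e * norm (y - z)"
    if y: "y \<in> cball p r" and z: "z \<in> cball p r" and yz: "norm (y - z) < d" for y z
  proof -
    let ?S = "cball p r \<inter> ball z d"
    have "norm (F y - F z - F' z (y - z)) \<le> norm (y - z) * e"
    proof (rule differentiable_bound_linearization[of z y ?S F "\<lambda>z. F' z" z])
      have "convex ?S" by (intro convex_Int) auto
      moreover have "z \<in> ?S" "y \<in> ?S" using that d by (auto simp: dist_norm norm_minus_commute)
      ultimately show "z + t *\<^sub>R (y - z) \<in> ?S" if "t \<in> {0..1}" for t
        using that convexD_alt[of ?S z y t] by (simp add: algebra_simps)
      show "(F has_derivative F' x) (at x within ?S)" if "x \<in> ?S" for x
        using that deriv by (auto intro: has_derivative_at_withinI)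
      show "onorm (blinfun_apply (F' x) - blinfun_apply (F' z)) \<le> e" if "x \<in> ?S" for x
      proof -
        have "dist (F' x) (F' z) < e" using d(2)[of z x] that z by (auto simp: dist_commute)
        moreover have "blinfun_apply (F' x) - blinfun_apply (F' z) = blinfun_apply (F' x - F' z)"
          by (auto simp: blinfun.diff_left)
        ultimately show ?thesis by (simp add: dist_norm norm_blinfun.rep_eq)
      qed
    qed (use z d in auto)
    then show ?thesis by (simp add: mult.commute)
  qed
  then show ?thesis using d(1) that by blast
qed

text \<open>\<open>W\<close> is the fundamental solution of the variational equation along
  \<open>flow z\<close>, the derivative of the flow in its starting point. The remainder of the
  linearization solves the same linear equation up to the error of
  \<open>uniform_linearization\<close> and vanishes at time 0, so \<open>short_time_estimate\<close>
  makes it small, uniformly in time.\<close>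

lemma flow_linearization:
  assumes z: "z \<in> cball p (r/2)"
  obtains W :: "real \<Rightarrow> 'b \<Rightarrow>\<^sub>L 'b" where
    "W 0 = id_blinfun"
    "\<And>h t. t \<in> {-T..T} \<Longrightarrow>
      ((\<lambda>t. W t h) has_vector_derivative F' (flow z t) (W t h)) (at t within {-T..T})"
    "\<And>h t. t \<in> {-T..T} \<Longrightarrow> norm (W t h) \<le> 2 * norm h"
    "continuous_on {-T..T} W"
    "\<And>e. e > 0 \<Longrightarrow> \<exists>d>0. \<forall>y\<in>cball p (r/2). norm (y - z) < d \<longrightarrow>
      (\<forall>t\<in>{-T..T}. norm (flow y t - flow z t - W t (y - z)) \<le> e * norm (y - z))"
proof -
  let ?I = "{-T..T}"
  have T0: "0 \<in> ?I" using T by simp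
  have cfl: "continuous_on ?I (flow z)"
    using flow_deriv[OF z] by (meson continuous_on_eq_continuous_within has_vector_derivative_continuous)
  have cF': "continuous_on ?I (\<lambda>t. F' (flow z t))"
    by (rule continuous_on_compose2[OF cont cfl]) (use flow_in_cball[OF z] in auto)
  have bd: "norm (F' (flow z t) u) \<le> L * norm u" if "t \<in> ?I" for t u
    using norm_blinfun[of "F' (flow z t)" u]
      mult_right_mono[OF bound[OF flow_in_cball[OF z that]] norm_ge_zero[of u]] by linarith
  have "\<exists>w. w 0 = h \<and> (\<forall>t\<in>?I. (w has_vector_derivative F' (flow z t) (w t)) (at t within ?I))" for h
  proof (rule picard[of "-T" T "\<lambda>t u. F' (flow z t) u" L 0 h])
    show "continuous_on ?I (\<lambda>t. F' (flow z t) (u t))" if "continuous_on ?I u" for u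
      using cF' that by (intro continuous_intros)
    show "norm (F' (flow z t) u - F' (flow z t) v) \<le> L * norm (u - v)" if "t \<in> ?I" for t u v
      using bd[OF that] by (simp flip: blinfun.diff_right)
  qed (use L LT T in auto)
  then obtain w where w0: "\<And>h. w h 0 = h"
    and dw: "\<And>h t. t \<in> ?I \<Longrightarrow> (w h has_vector_derivative F' (flow z t) (w h t)) (at t within ?I)"
    by metis
  have small: "norm (u t) \<le> 2 * norm (u 0)"
    if "\<And>t. t \<in> ?I \<Longrightarrow> (u has_vector_derivative F' (flow z t) (u t)) (at t within ?I)"
      "t \<in> ?I" for u t
    using short_time_estimate[of "-T" T u "\<lambda>t. F' (flow z t) (u t)" L 0 0 t] that bd L LT T by auto
  \<comment> \<open>Linearity by uniqueness: the difference of the two sides solves the same linear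
    equation and vanishes at time 0.\<close>
  have lin: "linear (\<lambda>h. w h t)" if t: "t \<in> ?I" for t
  proof (rule linearI)
    fix x y
    have "((\<lambda>t. w (x + y) t - (w x t + w y t)) has_vector_derivative
        F' (flow z t) (w (x + y) t - (w x t + w y t))) (at t within ?I)" if "t \<in> ?I" for t
      unfolding blinfun.diff_right blinfun.add_right using dw[OF that]
      by (intro has_vector_derivative_diff has_vector_derivative_add)
    from small[OF this t] show "w (x + y) t = w x t + w y t" by (simp add: w0)
  next
    fix c x
    have "((\<lambda>t. w (c *\<^sub>R x) t - c *\<^sub>R w x t) has_vector_derivative
        F' (flow z t) (w (c *\<^sub>R x) t - c *\<^sub>R w x t)) (at t within ?I)" if "t \<in> ?I" for t
      unfolding blinfun.diff_right blinfun.scaleR_right using dw[OF that]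
      by (intro has_vector_derivative_diff)
        (auto intro!: bounded_linear.has_vector_derivative[OF bounded_linear_scaleR_right])
    from small[OF this t] show "w (c *\<^sub>R x) t = c *\<^sub>R w x t" by (simp add: w0)
  qed
  define W where "W t = Blinfun (\<lambda>h. w h t)" for t
  have W: "W t h = w h t" if "t \<in> ?I" for t h
    unfolding W_def using lin[OF that] by (simp add: linear_conv_bounded_linear bounded_linear_Blinfun_apply)
  have dW: "((\<lambda>t. W t h) has_vector_derivative F' (flow z t) (W t h)) (at t within ?I)"
    if "t \<in> ?I" for h t
    using has_vector_derivative_transform[OF that W dw[OF that]] by (simp add: W[OF that])
  have nW: "norm (W t h) \<le> 2 * norm h" if "t \<in> ?I" for t h
    using small[OF dw that] W[OF that] w0 by simp
  have lW: "\<exists>d>0. \<forall>y\<in>cball p (r/2). norm (y - z) < d \<longrightarrow>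
      (\<forall>t\<in>?I. norm (flow y t - flow z t - W t (y - z)) \<le> e * norm (y - z))" if e: "e > 0" for e
  proof -
    \<comment> \<open>The estimate below yields
      \<open>2 * (e' * (2 * norm (y - z))) * (2 * T)\<close>, which equals
      \<open>e * norm (y - z)\<close> for this \<open>e'\<close>.\<close>
    define e' where "e' = e / (8 * T)"
    have e': "e' > 0" using e T by (simp add: e'_def)
    obtain d where d: "d > 0" "\<And>y z. y \<in> cball p r \<Longrightarrow> z \<in> cball p r \<Longrightarrow> norm (y - z) < d \<Longrightarrow>
        norm (F y - F z - F' z (y - z)) \<le> e' * norm (y - z)"
      using uniform_linearization[OF e'] by metis
    have "norm (flow y t - flow z t - W t (y - z)) \<le> e * norm (y - z)"
      if y: "y \<in> cball p (r/2)" "norm (y - z) < d/2" and t: "t \<in> ?I" for y t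
    proof -
      let ?R = "\<lambda>t. flow y t - flow z t - W t (y - z)"
      let ?R' = "\<lambda>t. F (flow y t) - F (flow z t) - F' (flow z t) (W t (y - z))"
      have "norm (?R t) \<le> 2 * norm (?R 0) + 2 * (e' * (2 * norm (y - z))) * (T - (-T))"
      proof (rule short_time_estimate[of "-T" T ?R ?R' L])
        show "(?R has_vector_derivative ?R' t) (at t within ?I)" if "t \<in> ?I" for t
          using flow_deriv[OF y(1) that] flow_deriv[OF z that] dW[OF that]
          by (intro has_vector_derivative_diff)
        show "norm (?R' t) \<le> L * norm (?R t) + e' * (2 * norm (y - z))" if t: "t \<in> ?I" for t
        proof -
          have c: "norm (flow y t - flow z t) \<le> 2 * norm (y - z)" using flow_close[OF y(1) z t] .
          have "norm (F (flow y t) - F (flow z t) - F' (flow z t) (flow y t - flow z t))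
              \<le> e' * norm (flow y t - flow z t)"
            using c y(2) by (intro d(2) flow_in_cball y z t) auto
          also have "\<dots> \<le> e' * (2 * norm (y - z))" using c e' by (intro mult_left_mono) auto
          finally have 1: "norm (F (flow y t) - F (flow z t) - F' (flow z t) (flow y t - flow z t))
              \<le> e' * (2 * norm (y - z))" .
          have "?R' t = (F (flow y t) - F (flow z t) - F' (flow z t) (flow y t - flow z t))
              + F' (flow z t) (?R t)"
            by (simp add: blinfun.diff_right)
          then show ?thesis
            using 1 bd[OF t, of "?R t"] norm_triangle_ineq
            by (smt (verit, ccfv_SIG))
        qed
      qed (use L LT T T0 e' t in auto)
      moreover have "?R 0 = 0" using w0 W[OF T0] flow(2) y z by simp
      ultimately show ?thesis using T by (simp add: e'_def)
    qed
    then show ?thesis using d(1) by (intro exI[of _ "d/2"]) auto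
  qed
  show ?thesis
  proof (rule that[of W])
    show "W 0 = id_blinfun" using W[OF T0] w0 by (intro blinfun_eqI) simp
    show "continuous_on ?I W"
    proof (rule continuous_on_blinfun_componentwise)
      show "continuous_on ?I (\<lambda>t. W t i)" for i
        using dW by (meson continuous_on_eq_continuous_within has_vector_derivative_continuous)
    qed
  qed (use dW nW lW in auto)
qed

end

section \<open>Continuously differentiable maps\<close>

text \<open>Regularity is tracked at level \<open>Suc 0\<close> only: a continuously differentiable
  Newton field is enough for a flow that is differentiable in its starting point.\<close>

lemma k_smooth_1I:
  assumes "\<And>x. x \<in> S \<Longrightarrow> (f has_derivative f' x) (at x)" "\<And>u. continuous_on S (\<lambda>x. f' x u)"
  shows "k_smooth_on (Suc 0) S f"
proof -
  have "frechet_derivative f (at x) u = f' x u" if "x \<in> S" for x u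
    using frechet_derivative_at[OF assms(1)[OF that]] by simp
  then show ?thesis
    using assms by (auto simp: differentiable_def cong: continuous_on_cong)
qed

lemma k_smooth_1D:
  assumes "k_smooth_on (Suc 0) S f"
  shows "\<And>x. x \<in> S \<Longrightarrow> (f has_derivative frechet_derivative f (at x)) (at x)"
    "\<And>u. continuous_on S (\<lambda>x. frechet_derivative f (at x) u)"
  using assms by (auto simp: frechet_derivative_works[symmetric])

lemma k_smooth_1_continuous_on: "k_smooth_on (Suc 0) S f \<Longrightarrow> continuous_on S f"
  by (rule continuous_at_imp_continuous_on) (auto intro: has_derivative_continuous[OF k_smooth_1D(1)])

lemma k_smooth_1_sum:
  assumes "\<And>i. i \<in> I \<Longrightarrow> k_smooth_on (Suc 0) S (f i)"
  shows "k_smooth_on (Suc 0) S (\<lambda>x. \<Sum>i\<in>I. f i x)"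
  using k_smooth_1D[OF assms]
  by (intro k_smooth_1I[of _ _ "\<lambda>x u. \<Sum>i\<in>I. frechet_derivative (f i) (at x) u"])
    (auto intro!: derivative_intros continuous_intros)

lemma k_smooth_1_add:
  assumes "k_smooth_on (Suc 0) S f" "k_smooth_on (Suc 0) S g"
  shows "k_smooth_on (Suc 0) S (\<lambda>x. f x + g x)"
  using k_smooth_1D[OF assms(1)] k_smooth_1D[OF assms(2)]
  by (intro k_smooth_1I[of _ _ "\<lambda>x u. frechet_derivative f (at x) u + frechet_derivative g (at x) u"])
    (auto intro!: derivative_intros continuous_intros)

lemma k_smooth_1_mult:
  fixes f g :: "'p::euclidean_space \<Rightarrow> real"
  assumes "k_smooth_on (Suc 0) S f" "k_smooth_on (Suc 0) S g"
  shows "k_smooth_on (Suc 0) S (\<lambda>x. f x * g x)"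
  using k_smooth_1D[OF assms(1)] k_smooth_1D[OF assms(2)]
    k_smooth_1_continuous_on[OF assms(1)] k_smooth_1_continuous_on[OF assms(2)]
  by (intro k_smooth_1I[of _ _ "\<lambda>x u. f x * frechet_derivative g (at x) u
        + frechet_derivative f (at x) u * g x"])
    (auto intro!: derivative_intros continuous_intros)

lemma k_smooth_1_bounded_linear:
  assumes "bounded_linear l" shows "k_smooth_on (Suc 0) S l"
  using assms by (intro k_smooth_1I[of _ _ "\<lambda>_. l"] bounded_linear_imp_has_derivative) auto

lemma k_smooth_1_const: "k_smooth_on (Suc 0) S (\<lambda>_. c)"
  by (intro k_smooth_1I[of _ _ "\<lambda>_ _. 0"]) auto

lemma k_smooth_1_compose_linear:
  assumes "k_smooth_on (Suc 0) S f" "bounded_linear l"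
  shows "k_smooth_on (Suc 0) S (\<lambda>x. l (f x))"
  by (intro k_smooth_1I[of _ _ "\<lambda>x u. l (frechet_derivative f (at x) u)"]
      bounded_linear.has_derivative[OF assms(2)] bounded_linear.continuous_on[OF assms(2)]
      k_smooth_1D[OF assms(1)])

lemma k_smooth_1_fst:
  assumes "k_smooth_on (Suc 0) S f"
  shows "k_smooth_on (Suc 0) (S \<times> UNIV) (\<lambda>x. f (fst x))"
proof (rule k_smooth_1I[of _ _ "\<lambda>x u. frechet_derivative f (at (fst x)) (fst u)"])
  show "((\<lambda>x. f (fst x)) has_derivative (\<lambda>u. frechet_derivative f (at (fst x)) (fst u))) (at x)"
    if "x \<in> S \<times> UNIV" for x
    using has_derivative_compose[OF has_derivative_fst[OF has_derivative_ident] k_smooth_1D(1)[OF assms], of x UNIV]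
      that by auto
  show "continuous_on (S \<times> UNIV) (\<lambda>x. frechet_derivative f (at (fst x)) (fst u))" for u
    by (rule continuous_on_compose2[OF k_smooth_1D(2)[OF assms] continuous_on_fst[OF continuous_on_id]]) auto
qed

section \<open>Regularity of solutions of linear equations with varying coefficients\<close>

text \<open>The product of \<open>O(norm (x - p))\<close> and \<open>o(1)\<close>. The factor
  \<open>f\<close> is merely continuous at \<open>p\<close>: the lemma will be applied to a factor
  whose differentiability is still to be shown.\<close>

lemma has_derivative_zero_product:
  fixes g :: "'p::real_normed_vector \<Rightarrow> 'b::real_normed_vector \<Rightarrow>\<^sub>L 'c::real_normed_vector"
  assumes g: "(g has_derivative g') (at p)" "g p = 0" and f: "isCont f p" "f p = 0"
  shows "((\<lambda>x. g x (f x)) has_derivative (\<lambda>_. 0)) (at p)"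
proof -
  from g(1) have bl: "bounded_linear g'" by (rule has_derivative_bounded_linear)
  obtain K where K: "K > 0" "\<And>x. norm (g' x) \<le> norm x * K"
    using bounded_linear.pos_bounded[OF bl] by blast
  have g1: "\<forall>\<^sub>F x in at p. norm (g x - g p - g' (x - p)) \<le> 1 * norm (x - p)"
    using g(1) unfolding has_derivative_within_alt2 using zero_less_one by blast
  show ?thesis
    unfolding has_derivative_within_alt2
  proof (intro conjI allI impI)
    fix e :: real assume e: "e > 0"
    have "(f \<longlongrightarrow> 0) (at p)" using f by (simp add: isCont_def)
    then have "\<forall>\<^sub>F x in at p. dist (f x) 0 < e / (K + 1)"
      using e K by (intro tendstoD) auto
    with g1 show "\<forall>\<^sub>F x in at p. norm (g x (f x) - g p (f p) - 0) \<le> e * norm (x - p)"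
    proof eventually_elim
      case (elim x)
      have "norm (g x) \<le> (K + 1) * norm (x - p)"
        using elim(1) K(2)[of "x - p"] norm_triangle_ineq[of "g x - g' (x - p)" "g' (x - p)"] g(2)
        by (simp add: algebra_simps)
      then have "norm (g x (f x)) \<le> ((K + 1) * norm (x - p)) * (e / (K + 1))"
        using norm_blinfun[of "g x" "f x"] elim(2) K e
        by (smt (verit) dist_0_norm dist_commute mult_mono norm_ge_zero)
      then show ?case using K g by (simp add: mult.commute)
    qed
  qed simp
qed

text \<open>The injective map \<open>G q\<close> is bounded below by some \<open>m\<close>, and near
  \<open>q\<close> the perturbation \<open>G p - G q\<close> costs at most \<open>m/2\<close> of it.
  What remains of the difference of the equations at \<open>p\<close> and \<open>q\<close> tends to
  0.\<close>

lemma solve_continuous_on: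
  fixes G :: "'p::metric_space \<Rightarrow> 'a::euclidean_space \<Rightarrow>\<^sub>L 'a"
  assumes G: "continuous_on S G" and h: "continuous_on S h"
    and eq: "\<And>p. p \<in> S \<Longrightarrow> G p (F p) = h p" and inj: "\<And>p. p \<in> S \<Longrightarrow> inj (blinfun_apply (G p))"
  shows "continuous_on S F"
  unfolding continuous_on_def
proof
  fix q assume q: "q \<in> S"
  obtain m where m: "m > 0" "\<And>z. m * norm z \<le> norm (G q z)"
    using linear_inj_bounded_below_pos[of "blinfun_apply (G q)"] inj[OF q]
    by (metis blinfun.bounded_linear_right bounded_linear.linear)
  let ?b = "\<lambda>p. (2/m) * (norm (h p - h q) + norm (G p - G q) * norm (F q))"
  have hl: "((\<lambda>p. h p - h q) \<longlongrightarrow> 0) (at q within S)" and Gl: "((\<lambda>p. G p - G q) \<longlongrightarrow> 0) (at q within S)"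
    using G h q by (auto simp: continuous_on_def LIM_zero_iff)
  have "(?b \<longlongrightarrow> (2/m) * (0 + 0 * norm (F q))) (at q within S)"
    by (intro tendsto_intros tendsto_norm_zero hl Gl)
  then have b: "(?b \<longlongrightarrow> 0) (at q within S)" by simp
  have "\<forall>\<^sub>F p in at q within S. dist (G p - G q) 0 < m/2"
    using tendstoD[OF Gl, of "m/2"] m by simp
  moreover have "\<forall>\<^sub>F p in at q within S. p \<in> S"
    by (simp add: eventually_at_topological, rule exI[of _ UNIV], simp)
  ultimately have "\<forall>\<^sub>F p in at q within S. norm (F p - F q) \<le> ?b p"
  proof eventually_elim
    case (elim p)
    have "G q (F p - F q) = (h p - h q) - (G p - G q) (F p - F q) - (G p - G q) (F q)"
      using eq[OF q] eq[OF elim(2)] by (simp add: blinfun.bilinear_simps)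
    then have "norm (G q (F p - F q)) \<le> norm (h p - h q) + norm ((G p - G q) (F p - F q)) + norm ((G p - G q) (F q))"
      by (smt (verit) norm_triangle_ineq4)
    moreover have "norm ((G p - G q) (F p - F q)) \<le> m/2 * norm (F p - F q)"
      using norm_blinfun[of "G p - G q" "F p - F q"] elim(1)
      by (smt (verit) dist_0_norm dist_commute mult_right_mono norm_ge_zero)
    moreover have "norm ((G p - G q) (F q)) \<le> norm (G p - G q) * norm (F q)"
      by (rule norm_blinfun)
    ultimately have "m/2 * norm (F p - F q) \<le> norm (h p - h q) + norm (G p - G q) * norm (F q)"
      using m(2)[of "F p - F q"] by linarith
    then have "(2/m) * (m/2 * norm (F p - F q)) \<le> ?b p"
      using m(1) by (intro mult_left_mono) auto
    then show ?case using m(1) by simp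
  qed
  then have "((\<lambda>p. F p - F q) \<longlongrightarrow> 0) (at q within S)"
    using b by (rule Lim_null_comparison)
  then show "(F \<longlongrightarrow> F q) (at q within S)" by (simp add: LIM_zero_iff)
qed

text \<open>Subtracting the equations at \<open>p\<close> and \<open>q\<close> expresses
  \<open>G q (F p - F q)\<close> through differentiable terms and
  \<open>(G p - G q) (F p - F q)\<close>, which has derivative 0 by
  \<open>has_derivative_zero_product\<close>, as \<open>F\<close> is already known to be continuous.
  The derivative so found solves an equation with the same \<open>G\<close>, so its continuity is
  again \<open>solve_continuous_on\<close>.\<close>

lemma solve_k_smooth_1:
  fixes G :: "'p::euclidean_space \<Rightarrow> 'a::euclidean_space \<Rightarrow>\<^sub>L 'a"
  assumes S: "open S" and G: "k_smooth_on (Suc 0) S G" and h: "k_smooth_on (Suc 0) S h"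
    and eq: "\<And>p. p \<in> S \<Longrightarrow> G p (F p) = h p" and inj: "\<And>p. p \<in> S \<Longrightarrow> inj (blinfun_apply (G p))"
  shows "k_smooth_on (Suc 0) S F"
proof -
  let ?G' = "\<lambda>p. frechet_derivative G (at p)" and ?h' = "\<lambda>p. frechet_derivative h (at p)"
  note G' = k_smooth_1D[OF G] and h' = k_smooth_1D[OF h]
  have F: "continuous_on S F"
    by (rule solve_continuous_on[OF k_smooth_1_continuous_on[OF G] k_smooth_1_continuous_on[OF h] eq inj])
  have "\<exists>D. (F has_derivative D) (at q) \<and> (\<forall>u. G q (D u) = ?h' q u - ?G' q u (F q))" if q: "q \<in> S" for q
  proof -
    have linG: "linear (blinfun_apply (G q))"
      by (simp add: blinfun.bounded_linear_right bounded_linear.linear)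
    obtain B where B: "linear B" "B \<circ> blinfun_apply (G q) = id"
      using linear_injective_left_inverse[OF linG inj[OF q]] by blast
    have GB: "G q (B y) = y" for y
      using linear_inverse_left[OF linG B(1)] B(2) by (metis comp_apply id_apply)
    have BG: "B (G q y) = y" for y using B(2) by (metis comp_apply id_apply)
    have blB: "bounded_linear B" using B(1) by (simp add: linear_conv_bounded_linear)
    have isF: "isCont F q" using F S q by (simp add: continuous_on_eq_continuous_at)
    have z: "((\<lambda>p. (G p - G q) (F p - F q)) has_derivative (\<lambda>_. 0)) (at q)"
      by (rule has_derivative_zero_product[where g' = "?G' q"])
        (auto intro!: derivative_eq_intros G' q isF continuous_intros)
    have "((\<lambda>p. F q + B ((h p - h q) - (G p - G q) (F q) - (G p - G q) (F p - F q)))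
        has_derivative (\<lambda>u. 0 + B ((?h' q u - 0) - (?G' q u - 0) (F q) - 0))) (at q)"
      by (intro has_derivative_add has_derivative_const has_derivative_diff z h'(1)[OF q]
          bounded_linear.has_derivative[OF blB]
          bounded_linear.has_derivative[OF blinfun.bounded_linear_left] G'(1)[OF q])
    moreover have "F q + B ((h p - h q) - (G p - G q) (F q) - (G p - G q) (F p - F q)) = F p"
      if "p \<in> S" for p
    proof -
      have "(h p - h q) - (G p - G q) (F q) - (G p - G q) (F p - F q) = G q (F p - F q)"
        using eq[OF q] eq[OF that] by (simp add: blinfun.bilinear_simps)
      then show ?thesis by (simp add: BG)
    qed
    ultimately have "(F has_derivative (\<lambda>u. B (?h' q u - ?G' q u (F q)))) (at q)"
      using S q by (auto intro: has_derivative_transform_within_open)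
    then show ?thesis using GB by blast
  qed
  then obtain D where D: "\<And>q. q \<in> S \<Longrightarrow> (F has_derivative D q) (at q)"
    "\<And>q u. q \<in> S \<Longrightarrow> G q (D q u) = ?h' q u - ?G' q u (F q)" by metis
  show ?thesis
  proof (rule k_smooth_1I[OF D(1)])
    show "continuous_on S (\<lambda>q. D q u)" for u
      by (rule solve_continuous_on[OF k_smooth_1_continuous_on[OF G] _ D(2) inj])
        (auto intro!: continuous_intros h' G' F)
  qed
qed

section \<open>Symmetry of second derivatives\<close>

text \<open>The mean value inequality in the direction \<open>u\<close> is applied to the increment
  in the direction \<open>w\<close>, corrected by its expected value. Of the second derivatives only
  that of \<open>f' y u\<close> in \<open>y\<close>, at the single point \<open>x\<close>,
  enters.\<close>

lemma mixed_difference_limit: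
  fixes f :: "'a::real_normed_vector \<Rightarrow> 'b::real_normed_vector"
  assumes S: "open S" "x \<in> S" and f: "\<And>y. y \<in> S \<Longrightarrow> (f has_derivative f' y) (at y)"
    and g: "((\<lambda>y. f' y u) has_derivative g') (at x)" and e: "e > 0"
  obtains d where "d > 0" "\<And>s. 0 < s \<Longrightarrow> s < d \<Longrightarrow>
    norm (f (x + s *\<^sub>R u + s *\<^sub>R w) - f (x + s *\<^sub>R u) - f (x + s *\<^sub>R w) + f x - (s * s) *\<^sub>R g' w) \<le> s * s * e"
proof -
  define K where "K = 2 * norm u + norm w + 1"
  have K: "K > 0" unfolding K_def by (simp add: add_nonneg_pos)
  obtain d1 where d1: "d1 > 0" "ball x d1 \<subseteq> S" using S by (meson open_contains_ball)
  obtain d2 where d2: "d2 > 0" "\<And>y. norm (y - x) < d2 \<Longrightarrow>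
      norm (f' y u - f' x u - g' (y - x)) \<le> (e / (2 * K)) * norm (y - x)"
    using g K e unfolding has_derivative_at_alt by (metis divide_pos_pos mult_pos_pos zero_less_numeral)
  define d where "d = min d1 d2 / K"
  interpret g': bounded_linear g' using g by (rule has_derivative_bounded_linear)
  show ?thesis
  proof (rule that[of d])
    show "d > 0" using d1 d2 K by (simp add: d_def)
    fix s :: real assume s: "0 < s" "s < d"
    then have sK: "s * K < d1" "s * K < d2" using K by (auto simp: d_def field_simps)
    have near: "norm (r *\<^sub>R u + c *\<^sub>R w) \<le> s * K" if "0 \<le> r" "r \<le> s" "0 \<le> c" "c \<le> s" for r c
    proof -
      have "norm (r *\<^sub>R u + c *\<^sub>R w) \<le> r * norm u + c * norm w"
        using that norm_triangle_ineq[of "r *\<^sub>R u" "c *\<^sub>R w"] by simp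
      also have "\<dots> \<le> s * norm u + s * norm w"
        using that by (intro add_mono mult_right_mono) auto
      also have "\<dots> \<le> s * K" using s by (simp add: K_def algebra_simps)
      finally show ?thesis .
    qed
    define h where "h r = f (x + r *\<^sub>R u + s *\<^sub>R w) - f (x + r *\<^sub>R u) - (r * s) *\<^sub>R g' w" for r
    define h' where "h' r = f' (x + r *\<^sub>R u + s *\<^sub>R w) u - f' (x + r *\<^sub>R u) u - s *\<^sub>R g' w" for r
    have "norm (h s - h 0) \<le> (s * e) * \<bar>s - 0\<bar>"
    proof (rule vector_derivative_bound[of "{0..s}" h h'])
      fix r assume r: "r \<in> {0..s}"
      have near': "norm (r *\<^sub>R u + c *\<^sub>R w) \<le> s * K" "norm (r *\<^sub>R u + c *\<^sub>R w) < d1"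
        "norm (r *\<^sub>R u + c *\<^sub>R w) < d2" if "c = 0 \<or> c = s" for c
        using near[of r c] r s sK that by auto
      have in1: "x + (r *\<^sub>R u + c *\<^sub>R w) \<in> S" if "c = 0 \<or> c = s" for c
      proof -
        have "norm (x - (x + y)) = norm y" for y by simp
        then show ?thesis using near'(2)[OF that] d1(2) unfolding subset_iff mem_ball dist_norm by presburger
      qed
      have d: "((\<lambda>r. f (x + r *\<^sub>R u + c)) has_vector_derivative f' (x + r *\<^sub>R u + c) u) (at r within {0..s})"
        if "x + r *\<^sub>R u + c \<in> S" for c
      proof -
        have "((\<lambda>r. x + r *\<^sub>R u + c) has_vector_derivative u) (at r within {0..s})"
          by (auto intro!: derivative_eq_intros simp: has_vector_derivative_def)
        then show ?thesis
          using vector_derivative_diff_chain_within[of "\<lambda>r. x + r *\<^sub>R u + c" u r "{0..s}" f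
              "f' (x + r *\<^sub>R u + c)"] has_derivative_at_withinI[OF f[OF that]] unfolding o_def by blast
      qed
      have "x + r *\<^sub>R u + s *\<^sub>R w \<in> S" using in1[of s] by (simp add: add.assoc)
      then show "(h has_vector_derivative h' r) (at r within {0..s})"
        unfolding h_def h'_def using d[of "s *\<^sub>R w"] d[of 0] in1[of 0]
        by (auto intro!: derivative_eq_intros)
      have n: "norm (f' (x + (r *\<^sub>R u + c *\<^sub>R w)) u - f' x u - g' (r *\<^sub>R u + c *\<^sub>R w)) \<le> (e / (2 * K)) * (s * K)"
        if "c = 0 \<or> c = s" for c
      proof -
        have "norm (f' (x + (r *\<^sub>R u + c *\<^sub>R w)) u - f' x u - g' (r *\<^sub>R u + c *\<^sub>R w))
            \<le> (e / (2 * K)) * norm (r *\<^sub>R u + c *\<^sub>R w)"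
          using d2(2)[of "x + (r *\<^sub>R u + c *\<^sub>R w)"] near'(3)[OF that] by (simp only: add_diff_cancel_left')
        also have "\<dots> \<le> (e / (2 * K)) * (s * K)"
          using near'(1)[OF that] e K by (intro mult_left_mono) auto
        finally show ?thesis .
      qed
      have "h' r = (f' (x + r *\<^sub>R u + s *\<^sub>R w) u - f' x u - g' (r *\<^sub>R u + s *\<^sub>R w))
          - (f' (x + r *\<^sub>R u) u - f' x u - g' (r *\<^sub>R u))"
        by (simp add: h'_def g'.add g'.scaleR add.assoc)
      then have "norm (h' r) \<le> 2 * ((e / (2 * K)) * (s * K))"
        using n[of s] n[of 0] norm_triangle_ineq4[of "f' (x + r *\<^sub>R u + s *\<^sub>R w) u - f' x u - g' (r *\<^sub>R u + s *\<^sub>R w)" "f' (x + r *\<^sub>R u) u - f' x u - g' (r *\<^sub>R u)"]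
        by (simp add: add.assoc)
      then show "norm (h' r) \<le> s * e" using K by (simp add: field_simps)
    qed (use s in auto)
    then show "norm (f (x + s *\<^sub>R u + s *\<^sub>R w) - f (x + s *\<^sub>R u) - f (x + s *\<^sub>R w) + f x - (s * s) *\<^sub>R g' w) \<le> s * s * e"
      using s by (simp add: h_def algebra_simps)
  qed
qed

text \<open>The mixed second difference is unchanged when \<open>u\<close> and \<open>w\<close> are
  exchanged, so after division by \<open>s * s\<close> it tends to both second derivatives. The
  lemma will be applied to transition maps: the transformation law of the Christoffel map rests on
  this symmetry.\<close>

lemma symmetric_second_derivative:
  fixes f :: "'a::real_normed_vector \<Rightarrow> 'b::real_normed_vector"
  assumes S: "open S" "x \<in> S" and f: "\<And>y. y \<in> S \<Longrightarrow> (f has_derivative f' y) (at y)"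
    and u: "((\<lambda>y. f' y u) has_derivative gu) (at x)" and w: "((\<lambda>y. f' y w) has_derivative gw) (at x)"
  shows "gu w = gw u"
proof (rule ccontr)
  assume "gu w \<noteq> gw u"
  define e where "e = norm (gu w - gw u) / 3"
  have e: "e > 0" using \<open>gu w \<noteq> gw u\<close> by (simp add: e_def)
  obtain d1 where d1: "d1 > 0" "\<And>s. 0 < s \<Longrightarrow> s < d1 \<Longrightarrow>
      norm (f (x + s *\<^sub>R u + s *\<^sub>R w) - f (x + s *\<^sub>R u) - f (x + s *\<^sub>R w) + f x - (s * s) *\<^sub>R gu w) \<le> s * s * e"
    using mixed_difference_limit[OF S f u e, of w] by blast
  obtain d2 where d2: "d2 > 0" "\<And>s. 0 < s \<Longrightarrow> s < d2 \<Longrightarrow>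
      norm (f (x + s *\<^sub>R w + s *\<^sub>R u) - f (x + s *\<^sub>R w) - f (x + s *\<^sub>R u) + f x - (s * s) *\<^sub>R gw u) \<le> s * s * e"
    using mixed_difference_limit[OF S f w e, of u] by blast
  define s where "s = min d1 d2 / 2"
  have s: "0 < s" "s < d1" "s < d2" using d1 d2 by (auto simp: s_def)
  define \<Delta> where "\<Delta> = f (x + s *\<^sub>R u + s *\<^sub>R w) - f (x + s *\<^sub>R u) - f (x + s *\<^sub>R w) + f x"
  have "norm (\<Delta> - (s * s) *\<^sub>R gu w) \<le> s * s * e" using d1(2)[of s] s by (simp add: \<Delta>_def)
  moreover have "norm (\<Delta> - (s * s) *\<^sub>R gw u) \<le> s * s * e"
    using d2(2)[of s] s by (simp add: \<Delta>_def algebra_simps)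
  ultimately have "norm ((s * s) *\<^sub>R gu w - (s * s) *\<^sub>R gw u) \<le> 2 * (s * s * e)"
    using norm_triangle_ineq4[of "\<Delta> - (s * s) *\<^sub>R gw u" "\<Delta> - (s * s) *\<^sub>R gu w"] by simp
  then have "(s * s) * norm (gu w - gw u) \<le> (s * s) * (2 * e)"
    by (simp flip: scaleR_diff_right)
  then have "norm (gu w - gw u) \<le> 2 * e" using s by (simp add: mult_le_cancel_left_pos)
  then show False using e by (simp add: e_def)
qed

section \<open>Newton's equations in charts\<close>

text \<open>Smoothness of a metric is assumed for fixed vectors only. This expansion carries it over
  to vectors that vary with the point.\<close>

lemma bilinear_expand:
  fixes B :: "'a::euclidean_space \<Rightarrow> 'b::euclidean_space \<Rightarrow> real"
  assumes "bilinear B"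
  shows "B u w = (\<Sum>i\<in>Basis. \<Sum>j\<in>Basis. (u \<bullet> i) * (w \<bullet> j) * B i j)"
proof -
  have "B u w = B (\<Sum>i\<in>Basis. (u \<bullet> i) *\<^sub>R i) (\<Sum>j\<in>Basis. (w \<bullet> j) *\<^sub>R j)"
    by (simp add: euclidean_representation)
  also have "\<dots> = (\<Sum>i\<in>Basis. \<Sum>j\<in>Basis. B ((u \<bullet> i) *\<^sub>R i) ((w \<bullet> j) *\<^sub>R j))"
    using bilinear_sum[OF assms] by (simp add: sum.cartesian_product)
  finally show ?thesis
    using assms by (simp add: bilinear_lmul bilinear_rmul mult.assoc)
qed

text \<open>Riesz representation in finite dimension: the map that lowers indices is injective,
  hence onto. It discharges the definite descriptions in \<open>gradient\<close> and
  \<open>christoffel\<close>.\<close>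

lemma bilinear_represents:
  fixes B :: "'a::euclidean_space \<Rightarrow> 'a \<Rightarrow> real"
  assumes B: "bilinear B" "\<And>u. u \<noteq> 0 \<Longrightarrow> B u u > 0" and l: "linear l"
  shows "\<exists>!z. \<forall>y. B z y = l y"
proof -
  have lB: "linear (B z)" "linear (\<lambda>z. B z y)" for y z using B(1) by (auto simp: bilinear_def)
  define G where "G z = (\<Sum>i\<in>Basis. B z i *\<^sub>R i)" for z
  have Gi: "G z \<bullet> i = B z i" if "i \<in> Basis" for z i using that by (simp add: G_def)
  have lG: "linear G"
    unfolding G_def by (rule linearI)
      (simp_all add: linear_add[OF lB(2)] linear_cmul[OF lB(2)] scaleR_add_left sum.distrib scaleR_sum_right)
  have inj: "inj G"
  proof (rule linear_injective_0[OF lG, THEN iffD2], intro allI impI)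
    fix z assume "G z = 0"
    then have "B z i = 0" if "i \<in> Basis" for i using Gi[OF that, of z] by simp
    then have "B z = (\<lambda>_. 0)" using linear_eq_stdbasis[OF lB(1) linear_zero] by blast
    then have "B z z = 0" by simp
    then show "z = 0" using B(2)[of z] by auto
  qed
  obtain z where z: "G z = (\<Sum>i\<in>Basis. l i *\<^sub>R i)"
    using linear_injective_imp_surjective[OF lG inj] by (metis surjD)
  have "B z i = l i" if "i \<in> Basis" for i using Gi[OF that, of z] z that by simp
  then have "B z y = l y" for y using linear_eq_stdbasis[OF lB(1) l] by metis
  moreover have "z' = z" if "\<forall>y. B z' y = l y" for z'
  proof -
    have "G z' = G z" using that \<open>\<And>y. B z y = l y\<close> by (simp add: G_def)
    then show ?thesis using inj by (simp add: inj_eq)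
  qed
  ultimately show ?thesis by blast
qed


text \<open>A vector field is as regular as the covector field that the metric assigns to it:
  \<open>F\<close> is recovered from \<open>h\<close> by a linear equation with the coefficients
  \<open>b p i j\<close>.\<close>

lemma solve_metric_k_smooth_1:
  fixes b :: "'p::euclidean_space \<Rightarrow> 'a::euclidean_space \<Rightarrow> 'a \<Rightarrow> real"
  assumes S: "open S" and b: "\<And>i j. k_smooth_on (Suc 0) S (\<lambda>p. b p i j)"
    and bil: "\<And>p. p \<in> S \<Longrightarrow> bilinear (b p)" and pos: "\<And>p u. p \<in> S \<Longrightarrow> u \<noteq> 0 \<Longrightarrow> b p u u > 0"
    and h: "\<And>i. i \<in> Basis \<Longrightarrow> k_smooth_on (Suc 0) S (\<lambda>p. h p i)"
    and eq: "\<And>p i. p \<in> S \<Longrightarrow> i \<in> Basis \<Longrightarrow> b p (F p) i = h p i"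
  shows "k_smooth_on (Suc 0) S F"
proof -
  \<comment> \<open>The elementary operators. They exhibit \<open>G\<close> as a combination with
    coefficients \<open>b p i j\<close>, so that its regularity as an operator follows from that of
    the coefficients.\<close>
  define C :: "'a \<Rightarrow> 'a \<Rightarrow> 'a \<Rightarrow>\<^sub>L 'a" where "C i j = Blinfun (\<lambda>z. (z \<bullet> i) *\<^sub>R j)" for i j
  have C: "C i j z = (z \<bullet> i) *\<^sub>R j" for i j z
    unfolding C_def by (intro bounded_linear_Blinfun_apply[THEN fun_cong] bounded_linear_intros)
  define G where "G p = (\<Sum>i\<in>Basis. \<Sum>j\<in>Basis. b p i j *\<^sub>R C i j)" for p
  have G: "G p z = (\<Sum>j\<in>Basis. b p z j *\<^sub>R j)" if p: "p \<in> S" for p z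
  proof -
    have "b p z j = (\<Sum>i\<in>Basis. (z \<bullet> i) * b p i j)" for j
    proof -
      have l: "linear (\<lambda>z. b p z j)" using bil[OF p] by (simp add: bilinear_def)
      have "b p z j = b p (\<Sum>i\<in>Basis. (z \<bullet> i) *\<^sub>R i) j" by (simp add: euclidean_representation)
      then show ?thesis using linear_sum[OF l, of "\<lambda>i. (z \<bullet> i) *\<^sub>R i" Basis] linear_cmul[OF l] by simp
    qed
    then have "(\<Sum>j\<in>Basis. b p z j *\<^sub>R j) = (\<Sum>j\<in>Basis. \<Sum>i\<in>Basis. ((z \<bullet> i) * b p i j) *\<^sub>R j)"
      by (simp add: scaleR_sum_left)
    also have "\<dots> = (\<Sum>i\<in>Basis. \<Sum>j\<in>Basis. ((z \<bullet> i) * b p i j) *\<^sub>R j)" by (rule sum.swap)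
    finally show ?thesis
      by (simp add: G_def blinfun.sum_left blinfun.scaleR_left C mult.commute)
  qed
  show ?thesis
  proof (rule solve_k_smooth_1[OF S])
    show "k_smooth_on (Suc 0) S G"
      unfolding G_def
      by (intro k_smooth_1_sum k_smooth_1_compose_linear[OF b] bounded_linear_scaleR_left)
    show "k_smooth_on (Suc 0) S (\<lambda>p. \<Sum>i\<in>Basis. h p i *\<^sub>R i)"
      by (intro k_smooth_1_sum k_smooth_1_compose_linear[OF h] bounded_linear_scaleR_left)
    show "G p (F p) = (\<Sum>i\<in>Basis. h p i *\<^sub>R i)" if "p \<in> S" for p
      using eq[OF that] by (simp add: G[OF that])
    show "inj (blinfun_apply (G p))" if p: "p \<in> S" for p
    proof (rule linear_injective_0[THEN iffD2], simp add: blinfun.bounded_linear_right bounded_linear.linear,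
        intro allI impI)
      fix z assume "G p z = 0"
      then have "(\<Sum>j\<in>Basis. b p z j *\<^sub>R j) = 0" using G[OF p] by simp
      moreover have "(\<Sum>j\<in>Basis. b p z j *\<^sub>R j) \<bullet> i = b p z i" if "i \<in> Basis" for i
        using that by simp
      ultimately have 0: "b p z i = 0" if "i \<in> Basis" for i using that by (metis inner_zero_left)
      have "linear (b p z)" using bil[OF p] by (simp add: bilinear_def)
      from linear_eq_stdbasis[OF this linear_zero] 0 have "b p z z = 0" by metis
      then show "z = 0" using pos[OF p, of z] by auto
    qed
  qed
qed

lemma smooth_onD: "smooth_on S f \<Longrightarrow> k_smooth_on k S f"
  by (simp add: smooth_on_def)

lemma k_smooth_on_SucD: "k_smooth_on (Suc k) S f \<Longrightarrow> k_smooth_on k S (\<lambda>x. frechet_derivative f (at x) u)"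
  by simp

lemma smooth_on_has_derivative:
  "smooth_on S f \<Longrightarrow> x \<in> S \<Longrightarrow> (f has_derivative frechet_derivative f (at x)) (at x)"
  using k_smooth_1D(1)[OF smooth_onD] .

lemma smooth_on_k_smooth_1_derivative:
  "smooth_on S f \<Longrightarrow> k_smooth_on (Suc 0) S (\<lambda>x. frechet_derivative f (at x) u)"
  by (rule k_smooth_on_SucD[OF smooth_onD])

lemma is_chartD:
  assumes "is_chart c"
  shows "open (cdom c)" "open (cimage c)" "\<And>q. q \<in> cdom c \<Longrightarrow> cinv c (coord c q) = q"
    "\<And>x. x \<in> cimage c \<Longrightarrow> coord c (cinv c x) = x" "\<And>x. x \<in> cimage c \<Longrightarrow> cinv c x \<in> cdom c"
    "continuous_on (cdom c) (coord c)" "continuous_on (cimage c) (cinv c)"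
  using assms unfolding is_chart_def homeomorphism_def by auto

section \<open>The metric, its derivatives and the Christoffel map under a change of chart\<close>

locale riemannian =
  fixes A :: "('m::{t2_space, second_countable_topology}, 'a::euclidean_space) chart set"
    and g :: "('m, 'a) tensor2"
  assumes riemannian: "riemannian_manifold A g"
begin

lemma chart: "c \<in> A \<Longrightarrow> is_chart c"
  using riemannian by (auto simp: riemannian_manifold_def smooth_atlas_def)

lemma chart_exists: "\<exists>c\<in>A. q \<in> cdom c"
  using riemannian by (auto simp: riemannian_manifold_def smooth_atlas_def)

lemmas chartD = is_chartD[OF chart]

abbreviation overlap :: "('m, 'a) chart \<Rightarrow> ('m, 'a) chart \<Rightarrow> 'a set" where
  "overlap c d \<equiv> coord c ` (cdom c \<inter> cdom d)"

abbreviation transition :: "('m, 'a) chart \<Rightarrow> ('m, 'a) chart \<Rightarrow> 'a \<Rightarrow> 'a" where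
  "transition c d \<equiv> coord d \<circ> cinv c"

definition Dtr :: "('m, 'a) chart \<Rightarrow> ('m, 'a) chart \<Rightarrow> 'a \<Rightarrow> 'a \<Rightarrow> 'a" where
  "Dtr c d x u = frechet_derivative (transition c d) (at x) u"

definition DDtr :: "('m, 'a) chart \<Rightarrow> ('m, 'a) chart \<Rightarrow> 'a \<Rightarrow> 'a \<Rightarrow> 'a \<Rightarrow> 'a" where
  "DDtr c d x e u = frechet_derivative (\<lambda>x. Dtr c d x u) (at x) e"

definition Dg :: "('m, 'a) chart \<Rightarrow> 'a \<Rightarrow> 'a \<Rightarrow> 'a \<Rightarrow> 'a \<Rightarrow> real" where
  "Dg c x e u w = frechet_derivative (\<lambda>x. g c x u w) (at x) e"

lemma overlap_iff: "c \<in> A \<Longrightarrow> x \<in> overlap c d \<longleftrightarrow> x \<in> cimage c \<and> cinv c x \<in> cdom d"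
  using chartD(3)[of c] chartD(4)[of c x] chartD(5)[of c x] by (safe; (metis IntI imageI)?)

lemma open_overlap:
  assumes "c \<in> A" "d \<in> A" shows "open (overlap c d)"
proof -
  have "overlap c d = cimage c \<inter> cinv c -` cdom d" using overlap_iff[OF assms(1)] by blast
  then show ?thesis
    using continuous_on_open_vimage[OF chartD(2)[OF assms(1)], of "cinv c"] chartD(7)[OF assms(1)]
      chartD(1)[OF assms(2)] by (metis Int_commute)
qed

lemma transition_in: "c \<in> A \<Longrightarrow> d \<in> A \<Longrightarrow> x \<in> overlap c d \<Longrightarrow> transition c d x \<in> cimage d"
  using overlap_iff by auto

lemma smooth_transition:
  assumes "c \<in> A" "d \<in> A" shows "smooth_on (overlap c d) (transition c d)"
  using riemannian assms unfolding riemannian_manifold_def smooth_atlas_def by blast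

lemma transition_derivative:
  assumes "c \<in> A" "d \<in> A" "x \<in> overlap c d"
  shows "(transition c d has_derivative Dtr c d x) (at x)"
    "((\<lambda>x. Dtr c d x u) has_derivative (\<lambda>e. DDtr c d x e u)) (at x)"
proof -
  show "(transition c d has_derivative Dtr c d x) (at x)"
    unfolding Dtr_def using smooth_on_has_derivative[OF smooth_transition[OF assms(1,2)] assms(3)] .
  show "((\<lambda>x. Dtr c d x u) has_derivative (\<lambda>e. DDtr c d x e u)) (at x)"
    unfolding DDtr_def unfolding Dtr_def
    using k_smooth_1D(1)[OF smooth_on_k_smooth_1_derivative[OF smooth_transition[OF assms(1,2)]] assms(3)] .
qed

lemma linear_Dtr:
  assumes "c \<in> A" "d \<in> A" "x \<in> overlap c d" shows "linear (Dtr c d x)"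
  using has_derivative_linear[OF transition_derivative(1)[OF assms]] .

lemma DDtr_symmetric:
  assumes "c \<in> A" "d \<in> A" "x \<in> overlap c d" shows "DDtr c d x e u = DDtr c d x u e"
  using symmetric_second_derivative[OF open_overlap[OF assms(1,2)] assms(3)
      transition_derivative(1)[OF assms(1,2)] transition_derivative(2)[OF assms] transition_derivative(2)[OF assms]]
  by simp

lemma metric_bilinear: "c \<in> A \<Longrightarrow> x \<in> cimage c \<Longrightarrow> bilinear (g c x)"
proof -
  assume c: "c \<in> A" "x \<in> cimage c"
  then have sym: "g c x u w = g c x w u" and lin: "linear (g c x u)" for u w
    using riemannian unfolding riemannian_manifold_def riemannian_metric_def by blast+
  have "(\<lambda>u. g c x u w) = g c x w" for w using sym by auto
  then show ?thesis using lin by (auto simp: bilinear_def)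
qed

lemma metric_sym: "c \<in> A \<Longrightarrow> x \<in> cimage c \<Longrightarrow> g c x u w = g c x w u"
  and metric_pos: "c \<in> A \<Longrightarrow> x \<in> cimage c \<Longrightarrow> u \<noteq> 0 \<Longrightarrow> g c x u u > 0"
  using riemannian unfolding riemannian_manifold_def riemannian_metric_def by blast+

lemma metric_smooth: "c \<in> A \<Longrightarrow> smooth_on (cimage c) (\<lambda>x. g c x u w)"
  using riemannian unfolding riemannian_manifold_def riemannian_metric_def by blast

lemma metric_transform:
  assumes "c \<in> A" "d \<in> A" "x \<in> overlap c d"
  shows "g c x u w = g d (transition c d x) (Dtr c d x u) (Dtr c d x w)"
proof -
  have "\<forall>c\<in>A. \<forall>d\<in>A. \<forall>x\<in>overlap c d. \<forall>u w. g c x u w = g d (coord d (cinv c x)) (Dtr c d x u) (Dtr c d x w)"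
    using riemannian unfolding riemannian_manifold_def riemannian_metric_def Dtr_def by blast
  then show ?thesis using assms by (metis comp_apply)
qed

lemma metric_nonneg: "c \<in> A \<Longrightarrow> x \<in> cimage c \<Longrightarrow> g c x u u \<ge> 0"
  using metric_pos[of c x u] bilinear_lzero[OF metric_bilinear[of c x]] by (cases "u = 0") fastforce+

lemma metric_eqI:
  assumes "c \<in> A" "x \<in> cimage c" "\<And>y. g c x z y = g c x z' y" shows "z = z'"
proof (rule ccontr)
  assume "z \<noteq> z'"
  then have "g c x (z - z') (z - z') > 0" by (intro metric_pos assms) simp
  then show False using assms(3) by (simp add: bilinear_lsub[OF metric_bilinear[OF assms(1,2)]])
qed

lemma metric_derivative:
  assumes "c \<in> A" "x \<in> cimage c"
  shows "((\<lambda>x. g c x u w) has_derivative (\<lambda>e. Dg c x e u w)) (at x)"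
  unfolding Dg_def using smooth_on_has_derivative[OF metric_smooth[OF assms(1)] assms(2)] .

lemma Dg_bilinear:
  assumes c: "c \<in> A" "x \<in> cimage c" shows "bilinear (Dg c x e)"
proof -
  note o = chartD(2)[OF c(1)]
  note bil = metric_bilinear[OF c(1)]
  have uniq: "Dg c x e u w = f' e" if "(f has_derivative f') (at x)" "\<And>x. x \<in> cimage c \<Longrightarrow> f x = g c x u w" for f f' u w
  proof -
    have "((\<lambda>x. g c x u w) has_derivative f') (at x)"
      using that o c by (auto intro: has_derivative_transform_within_open)
    then show ?thesis
      using has_derivative_unique[OF metric_derivative[OF c]] by metis
  qed
  note d = metric_derivative[OF c]
  show ?thesis
    unfolding bilinear_def
  proof (intro conjI allI linearI)
    fix u v w and r :: real
    show "Dg c x e w (u + v) = Dg c x e w u + Dg c x e w v"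
      by (rule uniq[OF has_derivative_add[OF d d]]) (simp add: bilinear_radd[OF bil])
    show "Dg c x e (u + v) w = Dg c x e u w + Dg c x e v w"
      by (rule uniq[OF has_derivative_add[OF d d]]) (simp add: bilinear_ladd[OF bil])
    show "Dg c x e w (r *\<^sub>R u) = r *\<^sub>R Dg c x e w u"
      by (rule uniq[OF has_derivative_scaleR_right[OF d]]) (simp add: bilinear_rmul[OF bil])
    show "Dg c x e (r *\<^sub>R u) w = r *\<^sub>R Dg c x e u w"
      by (rule uniq[OF has_derivative_scaleR_right[OF d]]) (simp add: bilinear_lmul[OF bil])
  qed
qed

lemma Dg_linear: "c \<in> A \<Longrightarrow> x \<in> cimage c \<Longrightarrow> linear (\<lambda>e. Dg c x e u w)"
  using has_derivative_linear[OF metric_derivative] .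

lemma metric_comp_derivative:
  assumes c: "c \<in> A" "y p \<in> cimage c" and y: "(y has_derivative y') (at p)"
    and a: "(a has_derivative a') (at p)" and b: "(b has_derivative b') (at p)"
  shows "((\<lambda>q. g c (y q) (a q) (b q)) has_derivative
    (\<lambda>h. Dg c (y p) (y' h) (a p) (b p) + g c (y p) (a' h) (b p) + g c (y p) (a p) (b' h))) (at p)"
proof -
  note bil = bilinear_expand[OF metric_bilinear[OF c(1)]]
  have yg: "((\<lambda>q. g c (y q) i j) has_derivative (\<lambda>h. Dg c (y p) (y' h) i j)) (at p)" for i j
    using has_derivative_compose[OF y metric_derivative[OF c]] .
  have d: "((\<lambda>q. \<Sum>i\<in>Basis. \<Sum>j\<in>Basis. (a q \<bullet> i) * (b q \<bullet> j) * g c (y q) i j) has_derivative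
    (\<lambda>h. \<Sum>i\<in>Basis. \<Sum>j\<in>Basis. (a p \<bullet> i) * (b p \<bullet> j) * Dg c (y p) (y' h) i j
        + ((a p \<bullet> i) * (b' h \<bullet> j) + (a' h \<bullet> i) * (b p \<bullet> j)) * g c (y p) i j)) (at p)"
    by (intro has_derivative_sum has_derivative_mult has_derivative_inner_left a b yg)
  have f: "(\<lambda>h. \<Sum>i\<in>Basis. \<Sum>j\<in>Basis. (a p \<bullet> i) * (b p \<bullet> j) * Dg c (y p) (y' h) i j
        + ((a p \<bullet> i) * (b' h \<bullet> j) + (a' h \<bullet> i) * (b p \<bullet> j)) * g c (y p) i j)
     = (\<lambda>h. Dg c (y p) (y' h) (a p) (b p) + g c (y p) (a' h) (b p) + g c (y p) (a p) (b' h))"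
  proof
    fix h
    show "(\<Sum>i\<in>Basis. \<Sum>j\<in>Basis. (a p \<bullet> i) * (b p \<bullet> j) * Dg c (y p) (y' h) i j
        + ((a p \<bullet> i) * (b' h \<bullet> j) + (a' h \<bullet> i) * (b p \<bullet> j)) * g c (y p) i j)
      = Dg c (y p) (y' h) (a p) (b p) + g c (y p) (a' h) (b p) + g c (y p) (a p) (b' h)"
      unfolding bil[OF c(2), of "a' h" "b p"] bil[OF c(2), of "a p" "b' h"]
        bilinear_expand[OF Dg_bilinear[OF c], of _ "a p" "b p"] sum.distrib[symmetric]
      by (simp only: distrib_right add.assoc add.commute add.left_commute)
  qed
  have "\<forall>\<^sub>F q in at p. y q \<in> cimage c"
    using has_derivative_continuous[OF y] chartD(2)[OF c(1)] c(2)
    by (intro topological_tendstoD) (auto simp: isCont_def)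
  then have e: "\<forall>\<^sub>F q in at p. (\<Sum>i\<in>Basis. \<Sum>j\<in>Basis. (a q \<bullet> i) * (b q \<bullet> j) * g c (y q) i j) = g c (y q) (a q) (b q)"
    by eventually_elim (rule bil[symmetric])
  show ?thesis
    by (rule has_derivative_transform_eventually[OF d[unfolded f] e]) (rule bil[OF c(2), symmetric], simp)
qed


lemma christoffel_char:
  assumes c: "c \<in> A" "x \<in> cimage c"
  shows "2 * g c x (christoffel g c x u w) y = Dg c x u w y + Dg c x w u y - Dg c x y u w"
proof -
  let ?l = "\<lambda>y. (Dg c x u w y + Dg c x w u y - Dg c x y u w) / 2"
  have "linear (\<lambda>y. Dg c x e v y)" for e v
    using Dg_bilinear[OF c] by (simp add: bilinear_def)
  then have l: "linear ?l"
    using Dg_linear[OF c, of u w] unfolding linear_iff by (simp add: field_simps)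
  have "\<exists>!z. \<forall>y. g c x z y = ?l y"
    by (rule bilinear_represents[OF metric_bilinear[OF c] metric_pos[OF c] l])
  moreover have "christoffel g c x u w = (THE z. \<forall>y. g c x z y = ?l y)"
    unfolding christoffel_def Dg_def[symmetric] by (simp add: field_simps)
  ultimately have "\<forall>y. g c x (christoffel g c x u w) y = ?l y"
    using theI'[of "\<lambda>z. \<forall>y. g c x z y = ?l y"] by simp
  then have "g c x (christoffel g c x u w) y = ?l y" by (rule spec)
  then show ?thesis by (simp add: field_simps)
qed

lemma gradient_char:
  assumes c: "c \<in> A" "q \<in> cdom c" and h: "smooth_scalar A h"
  shows "g c (coord c q) (gradient g c h q) y = differential c h q y"
proof -
  have x: "coord c q \<in> cimage c" using c by simp
  have "((h \<circ> cinv c) has_derivative frechet_derivative (h \<circ> cinv c) (at (coord c q))) (at (coord c q))"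
    using h c x by (intro smooth_on_has_derivative[of "cimage c"]) (auto simp: smooth_scalar_def)
  then have l: "linear (differential c h q)"
    unfolding differential_def by (rule has_derivative_linear)
  have "\<exists>!z. \<forall>y. g c (coord c q) z y = differential c h q y"
    by (rule bilinear_represents[OF metric_bilinear[OF c(1) x] metric_pos[OF c(1) x] l])
  then show ?thesis
    using theI'[of "\<lambda>z. \<forall>y. g c (coord c q) z y = differential c h q y"] by (simp add: gradient_def)
qed

text \<open>The transition preserves a positive definite metric, so its derivative is injective and,
  by equality of dimensions, onto. An identity of vectors may therefore be tested on images of
  vectors from the other chart.\<close>

lemma surj_Dtr:
  assumes "c \<in> A" "d \<in> A" "x \<in> overlap c d" shows "surj (Dtr c d x)"
proof (rule linear_injective_imp_surjective[OF linear_Dtr[OF assms]])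
  show "inj (Dtr c d x)"
  proof (rule linear_injective_0[OF linear_Dtr[OF assms], THEN iffD2], intro allI impI)
    fix u assume "Dtr c d x u = 0"
    then have "g c x u u = 0"
      using metric_transform[OF assms, of u u] bilinear_lzero[OF metric_bilinear[OF assms(2) transition_in[OF assms]]]
      by simp
    moreover have "x \<in> cimage c" using assms overlap_iff by blast
    ultimately show "u = 0" using metric_pos[OF assms(1), of x u] by fastforce
  qed
qed simp

lemma gradient_transform:
  assumes c: "c \<in> A" "d \<in> A" and q: "q \<in> cdom c" "q \<in> cdom d" and h: "smooth_scalar A h"
  shows "Dtr c d (coord c q) (gradient g c h q) = gradient g d h q"
proof -
  let ?x = "coord c q" and ?y = "coord d q"
  have x: "?x \<in> overlap c d" using q by simp
  have y: "?y \<in> cimage d" using q by simp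
  have tx: "transition c d ?x = ?y" using chartD(3)[OF c(1) q(1)] by simp
  have "((h \<circ> cinv d) has_derivative differential d h q) (at (transition c d ?x))"
    unfolding differential_def tx using h c y
    by (intro smooth_on_has_derivative[of "cimage d"]) (auto simp: smooth_scalar_def)
  then have "((\<lambda>x. (h \<circ> cinv d) (transition c d x)) has_derivative
      (\<lambda>u. differential d h q (Dtr c d ?x u))) (at ?x)"
    by (rule has_derivative_compose[OF transition_derivative(1)[OF c x]])
  then have "((h \<circ> cinv c) has_derivative (\<lambda>u. differential d h q (Dtr c d ?x u))) (at ?x)"
    using open_overlap[OF c] x
  proof (rule has_derivative_transform_within_open)
    show "(h \<circ> cinv d) (transition c d x) = (h \<circ> cinv c) x" if "x \<in> overlap c d" for x
      using that overlap_iff[OF c(1)] chartD(3)[OF c(2)] by auto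
  qed
  then have dh: "differential c h q u = differential d h q (Dtr c d ?x u)" for u
    unfolding differential_def[of c] using frechet_derivative_at by metis
  show ?thesis
  proof (rule metric_eqI[OF c(2) y])
    fix z
    obtain u where u: "z = Dtr c d ?x u" using surj_Dtr[OF c x] by (metis surjD)
    show "g d ?y (Dtr c d ?x (gradient g c h q)) z = g d ?y (gradient g d h q) z"
      using metric_transform[OF c x, of "gradient g c h q" u] gradient_char[OF c(1) q(1) h]
        gradient_char[OF c(2) q(2) h] dh tx u by simp
  qed
qed

lemma Dg_transform:
  assumes c: "c \<in> A" "d \<in> A" and x: "x \<in> overlap c d"
  shows "Dg c x e u w = Dg d (transition c d x) (Dtr c d x e) (Dtr c d x u) (Dtr c d x w)
    + g d (transition c d x) (DDtr c d x e u) (Dtr c d x w)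
    + g d (transition c d x) (Dtr c d x u) (DDtr c d x e w)"
proof -
  have "((\<lambda>x. g d (transition c d x) (Dtr c d x u) (Dtr c d x w)) has_derivative
    (\<lambda>e. Dg d (transition c d x) (Dtr c d x e) (Dtr c d x u) (Dtr c d x w)
    + g d (transition c d x) (DDtr c d x e u) (Dtr c d x w)
    + g d (transition c d x) (Dtr c d x u) (DDtr c d x e w))) (at x)"
    by (rule metric_comp_derivative[OF c(2), where y = "transition c d"])
      (intro transition_in[OF c x] transition_derivative[OF c x])+
  then have d: "((\<lambda>x. g c x u w) has_derivative
    (\<lambda>e. Dg d (transition c d x) (Dtr c d x e) (Dtr c d x u) (Dtr c d x w)
    + g d (transition c d x) (DDtr c d x e u) (Dtr c d x w)
    + g d (transition c d x) (Dtr c d x u) (DDtr c d x e w))) (at x)"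
    by (rule has_derivative_transform_within_open[OF _ open_overlap[OF c] x])
      (rule metric_transform[OF c, symmetric])
  have "x \<in> cimage c" using x by auto
  from fun_cong[OF has_derivative_unique[OF metric_derivative[OF c(1) this] d], of e]
  show ?thesis .
qed

text \<open>Differentiating the transformation law of the metric adds second derivatives of the
  transition to each term of the Koszul formula. By their symmetry all cancel except
  \<open>DDtr c d x u u\<close>, the classical inhomogeneous term. The diagonal case is the relevant
  one: the acceleration contains \<open>christoffel\<close> at equal arguments.\<close>

lemma christoffel_transform:
  assumes c: "c \<in> A" "d \<in> A" and x: "x \<in> overlap c d"
  shows "Dtr c d x (christoffel g c x u u)
    = christoffel g d (transition c d x) (Dtr c d x u) (Dtr c d x u) + DDtr c d x u u"
proof (rule metric_eqI[OF c(2) transition_in[OF c x]])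
  fix z
  let ?y = "transition c d x"
  have y: "?y \<in> cimage d" by (rule transition_in[OF c x])
  have xc: "x \<in> cimage c" using x by auto
  obtain w where w: "z = Dtr c d x w" using surj_Dtr[OF c x] by (metis surjD)
  have "2 * g d ?y (Dtr c d x (christoffel g c x u u)) z = 2 * g c x (christoffel g c x u u) w"
    using metric_transform[OF c x] w by simp
  also have "\<dots> = 2 * Dg c x u u w - Dg c x w u u"
    using christoffel_char[OF c(1) xc, of u u w] by simp
  also have "\<dots> = 2 * Dg d ?y (Dtr c d x u) (Dtr c d x u) z - Dg d ?y z (Dtr c d x u) (Dtr c d x u)
      + 2 * g d ?y (DDtr c d x u u) z"
    unfolding Dg_transform[OF c x] DDtr_symmetric[OF c x, of w u] w
    using metric_sym[OF c(2) y] by simp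
  also have "\<dots> = 2 * g d ?y (christoffel g d ?y (Dtr c d x u) (Dtr c d x u) + DDtr c d x u u) z"
    using christoffel_char[OF c(2) y, of "Dtr c d x u" "Dtr c d x u" z]
      bilinear_ladd[OF metric_bilinear[OF c(2) y], of "christoffel g d ?y (Dtr c d x u) (Dtr c d x u)" "DDtr c d x u u" z]
    by linarith
  finally show "g d ?y (Dtr c d x (christoffel g c x u u)) z
      = g d ?y (christoffel g d ?y (Dtr c d x u) (Dtr c d x u) + DDtr c d x u u) z" by simp
qed

lemma coord_curve_derivative:
  assumes c: "c \<in> A" "d \<in> A" and dom: "\<gamma> t \<in> cdom c" "\<gamma> t \<in> cdom d" and cont: "isCont \<gamma> t"
    and v: "((coord c \<circ> \<gamma>) has_vector_derivative v) (at t)"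
  shows "((coord d \<circ> \<gamma>) has_vector_derivative Dtr c d (coord c (\<gamma> t)) v) (at t)"
proof -
  have x: "coord c (\<gamma> t) \<in> overlap c d" using dom by simp
  have "((\<lambda>s. transition c d ((coord c \<circ> \<gamma>) s)) has_derivative
      (\<lambda>h. Dtr c d (coord c (\<gamma> t)) (h *\<^sub>R v))) (at t)"
    by (rule has_derivative_compose[OF v[unfolded has_vector_derivative_def]])
      (use transition_derivative(1)[OF c x] in \<open>simp add: o_def\<close>)
  moreover have "\<forall>\<^sub>F s in at t. transition c d ((coord c \<circ> \<gamma>) s) = (coord d \<circ> \<gamma>) s"
  proof -
    have "\<forall>\<^sub>F s in at t. \<gamma> s \<in> cdom c"
      using cont dom chartD(1)[OF c(1)] by (intro topological_tendstoD) (auto simp: isCont_def)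
    then show ?thesis by eventually_elim (use chartD(3)[OF c(1)] in auto)
  qed
  ultimately have "((coord d \<circ> \<gamma>) has_derivative (\<lambda>h. Dtr c d (coord c (\<gamma> t)) (h *\<^sub>R v))) (at t)"
    by (rule has_derivative_transform_eventually) (use dom chartD(3)[OF c(1)] in auto)
  then show ?thesis
    unfolding has_vector_derivative_def using linear_cmul[OF linear_Dtr[OF c x]] by simp
qed

lemma speed_sq_chart:
  assumes c: "c \<in> A" "\<gamma> t \<in> cdom c" and cont: "isCont \<gamma> t"
    and v: "((coord c \<circ> \<gamma>) has_vector_derivative v) (at t)"
  shows "speed_sq A g \<gamma> t = g c (coord c (\<gamma> t)) v v"
proof -
  define d where "d = (SOME c. c \<in> A \<and> \<gamma> t \<in> cdom c)"
  have d: "d \<in> A" "\<gamma> t \<in> cdom d" using someI[of "\<lambda>c. c \<in> A \<and> \<gamma> t \<in> cdom c" c] c unfolding d_def by auto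
  have "velocity d \<gamma> t = Dtr c d (coord c (\<gamma> t)) v"
    unfolding velocity_def by (rule vector_derivative_at[OF coord_curve_derivative[OF c(1) d(1) c(2) d(2) cont v]])
  moreover have "coord c (\<gamma> t) \<in> overlap c d" using c d by simp
  moreover have "transition c d (coord c (\<gamma> t)) = coord d (\<gamma> t)" using chartD(3)[OF c] by simp
  ultimately show ?thesis
    using metric_transform[OF c(1) d(1), of "coord c (\<gamma> t)" v v] by (simp add: speed_sq_def d_def[symmetric] Let_def)
qed

lemma speed_sq_jm:
  "speed_sq A (jm_metric g V E) \<gamma> t = jm_factor V E (\<gamma> t) * speed_sq A g \<gamma> t"
proof -
  have "\<exists>c. c \<in> A \<and> \<gamma> t \<in> cdom c" using chart_exists by blast
  from someI_ex[OF this] show ?thesis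
    using chartD(3) by (simp add: speed_sq_def Let_def jm_metric_def)
qed

lemma speed_sq_nonneg: "speed_sq A g \<gamma> t \<ge> 0"
proof -
  have "\<exists>c. c \<in> A \<and> \<gamma> t \<in> cdom c" using chart_exists by blast
  from someI_ex[OF this] show ?thesis by (simp add: speed_sq_def Let_def metric_nonneg)
qed

end

section \<open>Newton's equations as a first order system in a chart\<close>

locale mechanics = riemannian A g
  for A :: "('m::{t2_space, second_countable_topology}, 'a::euclidean_space) chart set"
    and g :: "('m, 'a) tensor2" +
  fixes V :: "'m \<Rightarrow> real"
  assumes V: "smooth_scalar A V"
begin

definition force :: "('m, 'a) chart \<Rightarrow> 'a \<Rightarrow> 'a \<Rightarrow> 'a" where
  "force c x v = - christoffel g c x v v - gradient g c V (cinv c x)"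

text \<open>Lowering the index turns both definite descriptions into explicit derivatives of
  \<open>g\<close> and \<open>V\<close>, by the Koszul formula with both vectors equal to
  \<open>v\<close>.\<close>

lemma force_char:
  assumes c: "c \<in> A" "x \<in> cimage c"
  shows "g c x (force c x v) y
    = Dg c x y v v / 2 - Dg c x v v y - frechet_derivative (V \<circ> cinv c) (at x) y"
proof -
  have "g c x (gradient g c V (cinv c x)) y = frechet_derivative (V \<circ> cinv c) (at x) y"
    using gradient_char[OF c(1) chartD(5)[OF c] V] chartD(4)[OF c] by (simp add: differential_def)
  then show ?thesis
    using christoffel_char[OF c, of v v y]
    by (simp add: force_def bilinear_lsub[OF metric_bilinear[OF c]] bilinear_lneg[OF metric_bilinear[OF c]])
qed

text \<open>By \<open>force_char\<close> the covector of the force is a polynomial of degree two in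
  \<open>v\<close> whose coefficients are first derivatives of smooth functions of \<open>x\<close>;
  \<open>solve_metric_k_smooth_1\<close> raises the index.\<close>

lemma force_k_smooth_1:
  assumes c: "c \<in> A"
  shows "k_smooth_on (Suc 0) (cimage c \<times> UNIV) (\<lambda>(x, v). force c x v)"
proof -
  let ?S = "cimage c \<times> (UNIV :: 'a set)"
  let ?h = "\<lambda>p i. (\<Sum>k\<in>Basis. \<Sum>l\<in>Basis. (snd p \<bullet> k) * (snd p \<bullet> l) * Dg c (fst p) i k l) * (1/2)
     + ((\<Sum>k\<in>Basis. \<Sum>l\<in>Basis. (snd p \<bullet> k) * (snd p \<bullet> l) * Dg c (fst p) k l i) * (-1)
     + frechet_derivative (V \<circ> cinv c) (at (fst p)) i * (-1))"
  have Dg: "k_smooth_on (Suc 0) (cimage c) (\<lambda>x. Dg c x e u w)" for e u w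
    unfolding Dg_def by (rule smooth_on_k_smooth_1_derivative[OF metric_smooth[OF c]])
  have dV: "k_smooth_on (Suc 0) (cimage c) (\<lambda>x. frechet_derivative (V \<circ> cinv c) (at x) i)" for i
    using V c by (intro smooth_on_k_smooth_1_derivative) (auto simp: smooth_scalar_def)
  have sn: "k_smooth_on (Suc 0) S (\<lambda>p :: 'a \<times> 'a. snd p \<bullet> k)" for k S
    by (rule k_smooth_1_bounded_linear)
      (intro bounded_linear_inner_left_comp bounded_linear_snd)
  have "open ?S" using chartD(2)[OF c] by (intro open_Times) auto
  then show ?thesis
  proof (rule solve_metric_k_smooth_1[where b = "\<lambda>p. g c (fst p)" and h = ?h])
    show "k_smooth_on (Suc 0) ?S (\<lambda>p. g c (fst p) i j)" for i j
      by (rule k_smooth_1_fst[OF smooth_onD[OF metric_smooth[OF c]]])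
    show "bilinear (g c (fst p))" if "p \<in> ?S" for p using that metric_bilinear[OF c] by auto
    show "g c (fst p) u u > 0" if "p \<in> ?S" "u \<noteq> 0" for p u using that metric_pos[OF c] by auto
    show "k_smooth_on (Suc 0) ?S (\<lambda>p. ?h p i)" for i
      by (intro k_smooth_1_add k_smooth_1_mult k_smooth_1_sum k_smooth_1_const sn
          k_smooth_1_fst[OF Dg] k_smooth_1_fst[OF dV])
    show "g c (fst p) (case p of (x, v) \<Rightarrow> force c x v) i = ?h p i" if pS: "p \<in> ?S" for p i
    proof -
      obtain x v where p: "p = (x, v)" "x \<in> cimage c" using pS by (cases p) auto
      have l: "linear (\<lambda>e. Dg c x e v i)" by (rule Dg_linear[OF c p(2)])
      have "Dg c x v v i = Dg c x (\<Sum>k\<in>Basis. (v \<bullet> k) *\<^sub>R k) v i" by (simp add: euclidean_representation)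
      also have "\<dots> = (\<Sum>k\<in>Basis. (v \<bullet> k) * Dg c x k v i)"
        using linear_sum[OF l, of "\<lambda>k. (v \<bullet> k) *\<^sub>R k" Basis] linear_cmul[OF l] by simp
      also have "\<dots> = (\<Sum>k\<in>Basis. \<Sum>l\<in>Basis. (v \<bullet> k) * (v \<bullet> l) * Dg c x k l i)"
      proof (rule sum.cong[OF refl])
        fix k
        have l: "linear (\<lambda>u. Dg c x k u i)" using Dg_bilinear[OF c p(2)] by (simp add: bilinear_def)
        have "Dg c x k v i = Dg c x k (\<Sum>k\<in>Basis. (v \<bullet> k) *\<^sub>R k) i" by (simp add: euclidean_representation)
        also have "\<dots> = (\<Sum>l\<in>Basis. (v \<bullet> l) * Dg c x k l i)"
          using linear_sum[OF l, of "\<lambda>k. (v \<bullet> k) *\<^sub>R k" Basis] linear_cmul[OF l] by simp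
        finally show "(v \<bullet> k) * Dg c x k v i = (\<Sum>l\<in>Basis. (v \<bullet> k) * (v \<bullet> l) * Dg c x k l i)"
          by (simp add: sum_distrib_left mult.assoc)
      qed
      finally have 1: "Dg c x v v i = (\<Sum>k\<in>Basis. \<Sum>l\<in>Basis. (v \<bullet> k) * (v \<bullet> l) * Dg c x k l i)" .
      have 2: "Dg c x i v v = (\<Sum>k\<in>Basis. \<Sum>l\<in>Basis. (v \<bullet> k) * (v \<bullet> l) * Dg c x i k l)"
        by (rule bilinear_expand[OF Dg_bilinear[OF c p(2)]])
      show ?thesis unfolding p(1) using force_char[OF c p(2), of v i] by (simp add: 1[symmetric] 2[symmetric])
    qed
  qed
qed

text \<open>The pointwise clause of \<open>newton_solution\<close>. It depends on
  \<open>\<gamma>\<close> only near \<open>t\<close>, which allows solutions to be glued.\<close>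

definition newton_at :: "(real \<Rightarrow> 'm) \<Rightarrow> real \<Rightarrow> bool" where
  "newton_at \<gamma> t \<longleftrightarrow> (\<forall>c\<in>A. \<gamma> t \<in> cdom c \<longrightarrow>
        (coord c \<circ> \<gamma>) differentiable (at t) \<and> velocity c \<gamma> differentiable (at t) \<and>
        covariant_accel g c \<gamma> t = - gradient g c V (\<gamma> t))"

lemma newton_solution_iff:
  "newton_solution A g V I \<gamma> \<longleftrightarrow>
    I \<noteq> {} \<and> open I \<and> is_interval I \<and> continuous_on I \<gamma> \<and> (\<forall>t\<in>I. newton_at \<gamma> t)"
  by (simp add: newton_solution_def newton_at_def)

lemma newton_at_cong:
  assumes S: "open S" "t \<in> S" and eq: "\<And>s. s \<in> S \<Longrightarrow> \<gamma> s = \<delta> s" and \<gamma>: "newton_at \<gamma> t"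
  shows "newton_at \<delta> t"
proof -
  have tr: "(f has_vector_derivative v) (at s) = (h has_vector_derivative v) (at s)"
    if "\<And>s. s \<in> S \<Longrightarrow> f s = h s" "s \<in> S" for f h :: "real \<Rightarrow> 'a" and v s
    using that S has_vector_derivative_transform_within_open[of f v s S h]
      has_vector_derivative_transform_within_open[of h v s S f] by auto
  have cd: "((coord c \<circ> \<gamma>) has_vector_derivative v) (at s) = ((coord c \<circ> \<delta>) has_vector_derivative v) (at s)"
    if "s \<in> S" for c :: "('m, 'a) chart" and v s
    using that by (intro tr) (auto simp: eq)
  have vel: "velocity c \<gamma> s = velocity c \<delta> s" if "s \<in> S" for c :: "('m, 'a) chart" and s
    unfolding velocity_def vector_derivative_def cd[OF that] ..
  have vd: "(velocity c \<gamma> has_vector_derivative v) (at t) = (velocity c \<delta> has_vector_derivative v) (at t)"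
    for c :: "('m, 'a) chart" and v
    using S by (intro tr) (auto simp: vel)
  have "covariant_accel g c \<gamma> t = covariant_accel g c \<delta> t" for c :: "('m, 'a) chart"
    unfolding covariant_accel_def vel[OF S(2)] eq[OF S(2)]
    unfolding vector_derivative_def vd ..
  moreover have "(coord c \<circ> \<gamma>) differentiable (at t) \<longleftrightarrow> (coord c \<circ> \<delta>) differentiable (at t)"
    "velocity c \<gamma> differentiable (at t) \<longleftrightarrow> velocity c \<delta> differentiable (at t)" for c :: "('m, 'a) chart"
    using cd[OF S(2), of c] vd[of c] differentiableI_vector vector_derivative_works by metis+
  ultimately show ?thesis using \<gamma> eq[OF S(2)] by (simp add: newton_at_def)
qed

end

lemma isCont_open_nhd:
  assumes "isCont f t" "open U" "f t \<in> U"
  obtains N where "open N" "t \<in> N" "\<And>s. s \<in> N \<Longrightarrow> f s \<in> U"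
  using assms unfolding continuous_at_open by metis

context mechanics
begin

lemma Dtr_expand:
  assumes "c \<in> A" "d \<in> A" "x \<in> overlap c d"
  shows "Dtr c d x u = (\<Sum>i\<in>Basis. (u \<bullet> i) *\<^sub>R Dtr c d x i)"
proof -
  note l = linear_Dtr[OF assms]
  have "Dtr c d x u = Dtr c d x (\<Sum>i\<in>Basis. (u \<bullet> i) *\<^sub>R i)" by (simp add: euclidean_representation)
  then show ?thesis using linear_sum[OF l, of "\<lambda>i. (u \<bullet> i) *\<^sub>R i" Basis] linear_cmul[OF l] by simp
qed

lemma DDtr_expand:
  assumes c: "c \<in> A" "d \<in> A" "x \<in> overlap c d"
  shows "DDtr c d x e u = (\<Sum>i\<in>Basis. (u \<bullet> i) *\<^sub>R DDtr c d x e i)"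
proof -
  have l: "linear (\<lambda>u. DDtr c d x u e)" by (rule has_derivative_linear[OF transition_derivative(2)[OF c]])
  have "DDtr c d x u e = DDtr c d x (\<Sum>i\<in>Basis. (u \<bullet> i) *\<^sub>R i) e" by (simp add: euclidean_representation)
  also have "\<dots> = (\<Sum>i\<in>Basis. (u \<bullet> i) *\<^sub>R DDtr c d x i e)"
    using linear_sum[OF l, of "\<lambda>i. (u \<bullet> i) *\<^sub>R i" Basis] linear_cmul[OF l] by simp
  finally show ?thesis by (simp add: DDtr_symmetric[OF c, of e])
qed

lemma Dtr_curve_derivative:
  assumes c: "c \<in> A" "d \<in> A" and x: "x t \<in> overlap c d"
    and dx: "(x has_vector_derivative v t) (at t)" and dv: "(v has_vector_derivative a) (at t)"
  shows "((\<lambda>s. Dtr c d (x s) (v s)) has_vector_derivative DDtr c d (x t) (v t) (v t) + Dtr c d (x t) a) (at t)"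
proof -
  have dD: "((\<lambda>s. Dtr c d (x s) i) has_vector_derivative DDtr c d (x t) (v t) i) (at t)" for i
  proof -
    have "((\<lambda>x. Dtr c d x i) has_derivative (\<lambda>e. DDtr c d (x t) e i)) (at (x t) within range x)"
      by (rule has_derivative_at_withinI) (rule transition_derivative(2)[OF c x])
    from vector_derivative_diff_chain_within[OF dx this] show ?thesis by (simp add: o_def)
  qed
  have di: "((\<lambda>s. v s \<bullet> i) has_real_derivative a \<bullet> i) (at t)" for i
    using bounded_linear.has_vector_derivative[OF bounded_linear_inner_left dv]
    by (simp add: has_real_derivative_iff_has_vector_derivative)
  have "((\<lambda>s. \<Sum>i\<in>Basis. (v s \<bullet> i) *\<^sub>R Dtr c d (x s) i) has_vector_derivative
     (\<Sum>i\<in>Basis. (v t \<bullet> i) *\<^sub>R DDtr c d (x t) (v t) i + (a \<bullet> i) *\<^sub>R Dtr c d (x t) i)) (at t)"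
    by (intro has_vector_derivative_sum has_vector_derivative_scaleR dD di)
  then have S: "((\<lambda>s. \<Sum>i\<in>Basis. (v s \<bullet> i) *\<^sub>R Dtr c d (x s) i) has_vector_derivative
     DDtr c d (x t) (v t) (v t) + Dtr c d (x t) a) (at t)"
    by (simp add: sum.distrib Dtr_expand[OF c x, symmetric] DDtr_expand[OF c x, symmetric])
  have "isCont x t" using dx by (rule has_vector_derivative_continuous)
  then obtain N where N: "open N" "t \<in> N" "\<And>s. s \<in> N \<Longrightarrow> x s \<in> overlap c d"
    using isCont_open_nhd[of t x "overlap c d"] open_overlap[OF c] x by metis
  show ?thesis
    by (rule has_vector_derivative_transform_within_open[OF S N(1,2)]) (simp add: Dtr_expand[OF c N(3), symmetric])
qed

text \<open>A solution of the system in one chart satisfies the equation in all charts: the second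
  derivative of the transition in the transported acceleration cancels against the inhomogeneous
  term of \<open>christoffel_transform\<close>.\<close>

lemma chart_curve_newton_at:
  assumes c: "c \<in> A" and J: "open J" "t \<in> J"
    and xv: "\<And>s. s \<in> J \<Longrightarrow> (x has_vector_derivative v s) (at s)"
      "\<And>s. s \<in> J \<Longrightarrow> (v has_vector_derivative force c (x s) (v s)) (at s)"
      "\<And>s. s \<in> J \<Longrightarrow> x s \<in> cimage c"
  shows "newton_at (\<lambda>s. cinv c (x s)) t"
  unfolding newton_at_def
proof (intro ballI impI)
  let ?\<gamma> = "\<lambda>s. cinv c (x s)"
  fix d assume d: "d \<in> A" and dt: "?\<gamma> t \<in> cdom d"
  have cx: "isCont x s" if "s \<in> J" for s using has_vector_derivative_continuous[OF xv(1)[OF that]] .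
  have ci: "isCont (cinv c) y" if "y \<in> cimage c" for y
    using chartD(7)[OF c] that continuous_on_eq_continuous_at[OF chartD(2)[OF c]] by blast
  have c\<gamma>: "isCont ?\<gamma> s" if "s \<in> J" for s
    by (rule continuous_at_compose[OF cx[OF that], unfolded o_def]) (rule ci[OF xv(3)[OF that]])
  have cc: "((coord c \<circ> ?\<gamma>) has_vector_derivative v s) (at s)" if "s \<in> J" for s
    by (rule has_vector_derivative_transform_within_open[OF xv(1)[OF that] J(1) that])
      (simp add: chartD(4)[OF c xv(3)])
  obtain N where N: "open N" "t \<in> N" "\<And>s. s \<in> N \<Longrightarrow> ?\<gamma> s \<in> cdom d"
    using isCont_open_nhd[OF c\<gamma>[OF J(2)] chartD(1)[OF d] dt] by metis
  let ?S = "J \<inter> N"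
  have S: "open ?S" "t \<in> ?S" using J N by auto
  have dd: "((coord d \<circ> ?\<gamma>) has_vector_derivative Dtr c d (x s) (v s)) (at s)" if "s \<in> ?S" for s
    using coord_curve_derivative[OF c d _ _ c\<gamma> cc, of s] that chartD(4,5)[OF c xv(3)] N(3) by simp
  then have vel: "velocity d ?\<gamma> s = Dtr c d (x s) (v s)" if "s \<in> ?S" for s
    unfolding velocity_def using that by (auto intro: vector_derivative_at)
  have xo: "x t \<in> overlap c d" using overlap_iff[OF c] dt xv(3)[OF J(2)] by simp
  have dvel: "(velocity d ?\<gamma> has_vector_derivative
      DDtr c d (x t) (v t) (v t) + Dtr c d (x t) (force c (x t) (v t))) (at t)"
    by (rule has_vector_derivative_transform_within_open[OF
          Dtr_curve_derivative[where v = v, OF c d xo xv(1)[OF J(2)] xv(2)[OF J(2)]] S]) (simp add: vel)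
  have tr: "transition c d (x t) = coord d (?\<gamma> t)" by simp
  have l: "linear (Dtr c d (x t))" by (rule linear_Dtr[OF c d xo])
  have "covariant_accel g d ?\<gamma> t = DDtr c d (x t) (v t) (v t) + Dtr c d (x t) (force c (x t) (v t))
      + christoffel g d (transition c d (x t)) (Dtr c d (x t) (v t)) (Dtr c d (x t) (v t))"
    unfolding covariant_accel_def vector_derivative_at[OF dvel] vel[OF S(2)] tr ..
  also have "\<dots> = Dtr c d (x t) (force c (x t) (v t)) + Dtr c d (x t) (christoffel g c (x t) (v t) (v t))"
    unfolding christoffel_transform[OF c d xo] by (simp only: add.assoc add.commute add.left_commute)
  also have "\<dots> = - Dtr c d (x t) (gradient g c V (?\<gamma> t))"
    by (simp add: force_def linear_diff[OF l] linear_neg[OF l])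
  also have "\<dots> = - gradient g d V (?\<gamma> t)"
    using gradient_transform[OF c d chartD(5)[OF c xv(3)[OF J(2)]] dt V] chartD(4)[OF c xv(3)[OF J(2)]] by simp
  finally show "(coord d \<circ> ?\<gamma>) differentiable (at t) \<and> velocity d ?\<gamma> differentiable (at t) \<and>
        covariant_accel g d ?\<gamma> t = - gradient g d V (?\<gamma> t)"
    using differentiableI_vector[OF dd[OF S(2)]] differentiableI_vector[OF dvel] by blast
qed

lemma newton_at_chart:
  assumes "newton_at \<gamma> t" "c \<in> A" "\<gamma> t \<in> cdom c"
  shows "((coord c \<circ> \<gamma>) has_vector_derivative velocity c \<gamma> t) (at t)"
    "(velocity c \<gamma> has_vector_derivative force c (coord c (\<gamma> t)) (velocity c \<gamma> t)) (at t)"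
proof -
  have n: "(coord c \<circ> \<gamma>) differentiable (at t)" "velocity c \<gamma> differentiable (at t)"
    "covariant_accel g c \<gamma> t = - gradient g c V (\<gamma> t)"
    using assms by (auto simp: newton_at_def)
  show "((coord c \<circ> \<gamma>) has_vector_derivative velocity c \<gamma> t) (at t)"
    using n(1) vector_derivative_works unfolding velocity_def by blast
  have "vector_derivative (velocity c \<gamma>) (at t)
      = - gradient g c V (\<gamma> t) - christoffel g c (coord c (\<gamma> t)) (velocity c \<gamma> t) (velocity c \<gamma> t)"
    using n(3) unfolding covariant_accel_def by (simp only: eq_diff_eq)
  then have "vector_derivative (velocity c \<gamma>) (at t) = force c (coord c (\<gamma> t)) (velocity c \<gamma> t)"
    using chartD(3)[OF assms(2,3)] by (simp add: force_def minus_diff_commute)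
  then show "(velocity c \<gamma> has_vector_derivative force c (coord c (\<gamma> t)) (velocity c \<gamma> t)) (at t)"
    using n(2) vector_derivative_works by metis
qed

definition newton_field :: "('m, 'a) chart \<Rightarrow> 'a \<times> 'a \<Rightarrow> 'a \<times> 'a" where
  "newton_field c z = (snd z, force c (fst z) (snd z))"

lemma newton_field_k_smooth_1:
  assumes "c \<in> A" shows "k_smooth_on (Suc 0) (cimage c \<times> UNIV) (newton_field c)"
proof -
  note f = k_smooth_1D[OF force_k_smooth_1[OF assms]]
  show ?thesis
  proof (rule k_smooth_1I[where f' = "\<lambda>z u. (snd u, frechet_derivative (\<lambda>(x, v). force c x v) (at z) u)"])
    have "newton_field c = (\<lambda>z. (snd z, (\<lambda>(x, v). force c x v) z))"
      by (simp add: fun_eq_iff newton_field_def split_beta)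
    then show "(newton_field c has_derivative
        (\<lambda>u. (snd u, frechet_derivative (\<lambda>(x, v). force c x v) (at z) u))) (at z)"
      if "z \<in> cimage c \<times> UNIV" for z
      using f(1)[OF that] by (auto intro!: derivative_intros)
  qed (intro continuous_intros f(2))
qed

end

lemma k_smooth_1_imp_C1_field:
  fixes F :: "'b::euclidean_space \<Rightarrow> 'b"
  assumes F: "k_smooth_on (Suc 0) S F" and S: "cball p r \<subseteq> S" "r > 0"
  obtains F' M L T where "C1_field F F' p r M L T"
proof -
  define F' where "F' z = Blinfun (frechet_derivative F (at z))" for z
  have dF: "(F has_derivative frechet_derivative F (at z)) (at z)" if "z \<in> cball p r" for z
    using k_smooth_1D(1)[OF F] that S by blast
  have F': "blinfun_apply (F' z) = frechet_derivative F (at z)" if "z \<in> cball p r" for z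
    unfolding F'_def by (intro bounded_linear_Blinfun_apply has_derivative_bounded_linear[OF dF] that)
  have cF': "continuous_on (cball p r) F'"
  proof (rule continuous_on_blinfun_componentwise)
    show "continuous_on (cball p r) (\<lambda>z. F' z i)" for i
      using continuous_on_subset[OF k_smooth_1D(2)[OF F, of i] S(1)]
      by (rule continuous_on_eq) (simp only: F')
  qed
  have cF: "continuous_on (cball p r) F"
    using continuous_on_subset[OF k_smooth_1_continuous_on[OF F] S(1)] .
  have bd: "\<exists>B>0. \<forall>z\<in>cball p r. norm (f z) \<le> B" if "continuous_on (cball p r) f"
    for f :: "'b \<Rightarrow> 'c::real_normed_vector"
    using compact_imp_bounded[OF compact_continuous_image[OF that compact_cball]]
    unfolding bounded_pos by auto
  obtain M where M: "M > 0" "\<And>z. z \<in> cball p r \<Longrightarrow> norm (F z) \<le> M" using bd[OF cF] by blast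
  obtain L where L: "L > 0" "\<And>z. z \<in> cball p r \<Longrightarrow> norm (F' z) \<le> L" using bd[OF cF'] by blast
  \<comment> \<open>Gives \<open>L * (2 * T) \<le> 1/2\<close> and
    \<open>M * T \<le> r/4 < r/2\<close>, the two conditions on time in
    \<open>C1_field\<close>.\<close>
  define T where "T = min (1 / (4 * L)) (r / (4 * M))"
  have "L * T \<le> 1/4" "M * T \<le> r/4"
    using L(1) M(1) by (auto simp: T_def min_def field_simps)
  then have "C1_field F F' p r M L T"
    using S(2) L M cF' dF F' by unfold_locales (auto simp: T_def)
  then show ?thesis by (rule that)
qed

section \<open>Solutions on the manifold compared with the flow in a chart\<close>

locale chart_flow = mechanics A g V + C1_field "newton_field c" F' p r M L T
  for A :: "('m::{t2_space, second_countable_topology}, 'a::euclidean_space) chart set"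
    and g :: "('m, 'a) tensor2" and V c F' p r M L T +
  assumes c: "c \<in> A" and ball_in: "cball p r \<subseteq> cimage c \<times> UNIV"
begin

definition state :: "(real \<Rightarrow> 'm) \<Rightarrow> real \<Rightarrow> 'a \<times> 'a" where
  "state \<gamma> t = (coord c (\<gamma> t), velocity c \<gamma> t)"

definition curve :: "(real \<Rightarrow> 'a \<times> 'a) \<Rightarrow> real \<Rightarrow> 'm" where
  "curve Z t = cinv c (fst (Z t))"

lemma state_derivative:
  assumes "newton_at \<gamma> t" "\<gamma> t \<in> cdom c"
  shows "(state \<gamma> has_vector_derivative newton_field c (state \<gamma> t)) (at t)"
proof -
  have "state \<gamma> = (\<lambda>t. ((coord c \<circ> \<gamma>) t, velocity c \<gamma> t))" by (simp add: fun_eq_iff state_def)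
  then show ?thesis
    using has_vector_derivative_Pair[OF newton_at_chart(1,2)[OF assms(1) c assms(2)]]
    by (simp add: newton_field_def state_def)
qed

lemma chart_in: "z \<in> cball p r \<Longrightarrow> fst z \<in> cimage c"
  using ball_in by (cases z) auto

lemma curve_newton:
  assumes J: "open J" "J \<noteq> {}" "is_interval J"
    and Z: "\<And>t. t \<in> J \<Longrightarrow> (Z has_vector_derivative newton_field c (Z t)) (at t)"
      "\<And>t. t \<in> J \<Longrightarrow> Z t \<in> cball p r"
  shows "newton_solution A g V J (curve Z)" "\<And>t. t \<in> J \<Longrightarrow> state (curve Z) t = Z t"
proof -
  have dx: "((\<lambda>t. fst (Z t)) has_vector_derivative snd (Z t)) (at t)"
    and dv: "((\<lambda>t. snd (Z t)) has_vector_derivative force c (fst (Z t)) (snd (Z t))) (at t)" if "t \<in> J" for t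
    using bounded_linear.has_vector_derivative[OF bounded_linear_fst Z(1)[OF that]]
      bounded_linear.has_vector_derivative[OF bounded_linear_snd Z(1)[OF that]]
    by (simp_all add: newton_field_def)
  have "newton_at (curve Z) t" if "t \<in> J" for t
    unfolding curve_def by (rule chart_curve_newton_at[OF c J(1) that dx dv chart_in[OF Z(2)]])
  moreover have "continuous_on J (curve Z)"
    unfolding curve_def
  proof (rule continuous_on_compose2[OF chartD(7)[OF c]])
    show "continuous_on J (\<lambda>t. fst (Z t))"
      using has_vector_derivative_continuous[OF dx] by (rule continuous_at_imp_continuous_on[rule_format])
  qed (use chart_in Z(2) in blast)
  ultimately show "newton_solution A g V J (curve Z)"
    using J by (simp add: newton_solution_iff)
  show "state (curve Z) t = Z t" if t: "t \<in> J" for t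
  proof -
    have cc: "coord c (curve Z s) = fst (Z s)" if "s \<in> J" for s
      unfolding curve_def using chartD(4)[OF c chart_in[OF Z(2)[OF that]]] .
    have "((coord c \<circ> curve Z) has_vector_derivative snd (Z t)) (at t)"
      by (rule has_vector_derivative_transform_within_open[OF dx[OF t] J(1) t]) (simp add: cc)
    then have "velocity c (curve Z) t = snd (Z t)" unfolding velocity_def by (rule vector_derivative_at)
    then show ?thesis using cc[OF t] by (simp add: state_def)
  qed
qed

text \<open>Uniqueness in the chart cannot be invoked at once, since \<open>\<gamma>\<close> is not
  known to stay in the chart. Instead the property \<open>E\<close> of agreement in position and
  velocity is shown to be locally constant: disagreement persists nearby by the Hausdorff property,
  agreement by local uniqueness. Connectedness of the interval does the rest.\<close>

lemma newton_unique:
  assumes \<gamma>: "newton_solution A g V J \<gamma>" and ab: "{a..b} \<subseteq> J" "b - a \<le> 2 * T"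
    and Z: "solves {a..b} Z" "\<And>t. t \<in> {a..b} \<Longrightarrow> Z t \<in> ball p r"
    and t0: "t0 \<in> {a..b}" "\<gamma> t0 \<in> cdom c" "state \<gamma> t0 = Z t0" and t: "t \<in> {a..b}"
  shows "\<gamma> t = curve Z t" "state \<gamma> t = Z t"
proof -
  let ?I = "{a..b}"
  define E where "E t \<longleftrightarrow> \<gamma> t = curve Z t \<and> state \<gamma> t = Z t" for t
  have nat: "newton_at \<gamma> t" if "t \<in> ?I" for t using \<gamma> ab that by (auto simp: newton_solution_iff)
  have c\<gamma>: "continuous (at t within ?I) \<gamma>" if "t \<in> ?I" for t
    using \<gamma> ab that by (meson continuous_on_eq_continuous_within continuous_on_subset newton_solution_iff)
  have dZ: "(Z has_vector_derivative newton_field c (Z t)) (at t within ?I)" if "t \<in> ?I" for t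
    using Z(1) that by (simp add: solves_def)
  have cZ: "continuous (at t within ?I) Z" if "t \<in> ?I" for t
    using has_vector_derivative_continuous[OF dZ[OF that]] .
  have ccZ: "continuous (at t within ?I) (curve Z)" if "t \<in> ?I" for t
  proof -
    have "continuous_on ?I (\<lambda>t. fst (Z t))"
      using cZ by (intro continuous_on_fst) (simp add: continuous_on_eq_continuous_within)
    then have "continuous_on ?I (curve Z)"
      unfolding curve_def
      by (rule continuous_on_compose2[OF chartD(7)[OF c]]) (use chart_in Z(1) in \<open>simp add: solves_def image_subset_iff del: mem_cball\<close>)
    then show ?thesis using that by (simp add: continuous_on_eq_continuous_within)
  qed
  have cd: "curve Z t \<in> cdom c" "coord c (curve Z t) = fst (Z t)" if "t \<in> ?I" for t
    unfolding curve_def using chartD(4,5)[OF c chart_in, of "Z t"] Z(1) that by (simp_all add: solves_def del: mem_cball)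
  have local: "\<forall>\<^sub>F s in at t within ?I. E t = E s" if t: "t \<in> ?I" for t
  proof (cases "\<gamma> t = curve Z t")
    case False
    then obtain U W where UW: "open U" "open W" "\<gamma> t \<in> U" "curve Z t \<in> W" "U \<inter> W = {}"
      using hausdorff by metis
    have "\<forall>\<^sub>F s in at t within ?I. \<gamma> s \<in> U" "\<forall>\<^sub>F s in at t within ?I. curve Z s \<in> W"
      using topological_tendstoD[OF c\<gamma>[OF t, unfolded continuous_within] UW(1,3)]
        topological_tendstoD[OF ccZ[OF t, unfolded continuous_within] UW(2,4)] by auto
    then show ?thesis
      by eventually_elim (use UW False in \<open>auto simp: E_def\<close>)
  next
    case True
    then have dom: "\<gamma> t \<in> cdom c" using cd t by simp
    \<comment> \<open>The state is known to be continuous only where \<open>\<gamma> t\<close> lies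
      in the chart domain; this is why positions are compared before velocities.\<close>
    have cst: "continuous (at t within ?I) (state \<gamma>)"
      using has_vector_derivative_continuous[OF state_derivative[OF nat[OF t] dom]]
        continuous_at_imp_continuous_at_within by blast
    show ?thesis
    proof (cases "state \<gamma> t = Z t")
      case False
      then obtain U W where UW: "open U" "open W" "state \<gamma> t \<in> U" "Z t \<in> W" "U \<inter> W = {}"
        using hausdorff by metis
      have "\<forall>\<^sub>F s in at t within ?I. state \<gamma> s \<in> U" "\<forall>\<^sub>F s in at t within ?I. Z s \<in> W"
        using topological_tendstoD[OF cst[unfolded continuous_within] UW(1,3)]
          topological_tendstoD[OF cZ[OF t, unfolded continuous_within] UW(2,4)] by auto
      then show ?thesis
        by eventually_elim (use UW False in \<open>auto simp: E_def\<close>)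
    next
      case eq: True
      have "\<forall>\<^sub>F s in at t within ?I. \<gamma> s \<in> cdom c \<and> state \<gamma> s \<in> ball p r"
        using topological_tendstoD[OF c\<gamma>[OF t, unfolded continuous_within] chartD(1)[OF c] dom]
          topological_tendstoD[OF cst[unfolded continuous_within] open_ball[of p r]] Z(2)[OF t] eq
        by (intro eventually_conj) simp_all
      then obtain e where e: "e > 0"
        "\<And>s. s \<in> ?I \<Longrightarrow> s \<noteq> t \<Longrightarrow> dist s t < e \<Longrightarrow> \<gamma> s \<in> cdom c \<and> state \<gamma> s \<in> ball p r"
        unfolding eventually_at by blast
      have e': "\<gamma> s \<in> cdom c \<and> state \<gamma> s \<in> ball p r" if "s \<in> ?I" "dist s t < e" for s
        using e(2)[of s] that dom Z(2)[OF t] eq by (cases "s = t") auto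
      have "E s" if s: "s \<in> ?I" "dist s t < e" for s
      proof -
        let ?J = "{min s t..max s t}"
        have J: "?J \<subseteq> ?I" "\<And>u. u \<in> ?J \<Longrightarrow> dist u t < e"
          using s t by (auto simp: dist_real_def min_def max_def split: if_splits)
        have sJ: "solves ?J (state \<gamma>)"
          unfolding solves_def
        proof (intro ballI conjI)
          fix u assume u: "u \<in> ?J"
          then have u': "u \<in> ?I" "dist u t < e" using J by auto
          show "(state \<gamma> has_vector_derivative newton_field c (state \<gamma> u)) (at u within ?J)"
            using has_vector_derivative_at_within[OF state_derivative[OF nat[OF u'(1)]]] e'[OF u'] by blast
          show "state \<gamma> u \<in> cball p r" using e'[OF u'] by auto
        qed
        have "solves ?J Z"
          using Z(1) J(1) has_vector_derivative_within_subset[OF _ J(1)] unfolding solves_def by (meson subsetD)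
        from solves_unique[OF sJ this, of t s] have "state \<gamma> s = Z s"
          using eq ab(2) s t by (auto simp: min_def max_def split: if_splits)
        moreover have "\<gamma> s = curve Z s"
          using \<open>state \<gamma> s = Z s\<close> chartD(3)[OF c, of "\<gamma> s"] e'[OF s] by (metis curve_def state_def fst_conv)
        ultimately show "E s" by (simp add: E_def)
      qed
      moreover have "E t" using True eq by (simp add: E_def)
      ultimately show ?thesis
        unfolding eventually_at using e(1) by blast
    qed
  qed
  have "E t0 = E t"
    by (rule connected_local_const[of ?I]) (use t0 t local in auto)
  moreover have "E t0"
    using t0 chartD(3)[OF c t0(2)] unfolding E_def by (metis curve_def state_def fst_conv)
  ultimately show "\<gamma> t = curve Z t" "state \<gamma> t = Z t" by (auto simp: E_def)
qed


lemma flow_curve: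
  assumes z: "z \<in> cball p (r/2)"
  shows "newton_solution A g V {-T<..<T} (curve (flow z))"
    "\<And>t. t \<in> {-T<..<T} \<Longrightarrow> state (curve (flow z)) t = flow z t"
proof -
  have J: "open {-T<..<T}" "{-T<..<T} \<noteq> {}" "is_interval {-T<..<T}"
    using T by (auto simp: is_interval_connected_1)
  have Z: "(flow z has_vector_derivative newton_field c (flow z t)) (at t)" "flow z t \<in> cball p r"
    if "t \<in> {-T<..<T}" for t
    using flow_deriv_at[OF z that] flow_in_cball[OF z, of t] that by auto
  show "newton_solution A g V {-T<..<T} (curve (flow z))" by (rule curve_newton(1)[OF J Z])
  show "state (curve (flow z)) t = flow z t" if "t \<in> {-T<..<T}" for t
    by (rule curve_newton(2)[OF J Z that])
qed

lemma shifted_flow_solves: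
  assumes z: "z \<in> cball p (r/2)" and ab: "{a..b} \<subseteq> {t0 - T<..<t0 + T}"
  shows "solves {a..b} (\<lambda>t. flow z (t - t0))"
    "\<And>t. t \<in> {a..b} \<Longrightarrow> flow z (t - t0) \<in> ball p r"
    "\<And>t. t \<in> {t0 - T<..<t0 + T} \<Longrightarrow>
      ((\<lambda>t. flow z (t - t0)) has_vector_derivative newton_field c (flow z (t - t0))) (at t)"
proof -
  show d: "((\<lambda>t. flow z (t - t0)) has_vector_derivative newton_field c (flow z (t - t0))) (at t)"
    if "t \<in> {t0 - T<..<t0 + T}" for t
  proof -
    have "((\<lambda>t. t - t0) has_vector_derivative 1) (at t)" by (auto intro!: derivative_eq_intros)
    moreover have "(flow z has_vector_derivative newton_field c (flow z (t - t0))) (at (t - t0))"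
      using that by (intro flow_deriv_at[OF z]) auto
    ultimately show ?thesis using vector_diff_chain_at[of "\<lambda>t. t - t0" 1 t "flow z"] by (simp add: o_def)
  qed
  show "flow z (t - t0) \<in> ball p r" if "t \<in> {a..b}" for t
    using that ab by (intro flow(3)[OF z]) (auto simp: subset_iff)
  then show "solves {a..b} (\<lambda>t. flow z (t - t0))"
    unfolding solves_def using has_vector_derivative_at_within[OF d] ab by (fastforce simp: less_imp_le)
qed

lemma newton_solution_eq_flow:
  assumes \<gamma>: "newton_solution A g V J \<gamma>" and t0: "t0 \<in> J" "\<gamma> t0 \<in> cdom c" "state \<gamma> t0 \<in> cball p (r/2)"
    and t: "t \<in> J" "t \<in> {t0 - T<..<t0 + T}"
  shows "\<gamma> t = curve (flow (state \<gamma> t0)) (t - t0)" "state \<gamma> t = flow (state \<gamma> t0) (t - t0)"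
proof -
  let ?a = "min t t0" and ?b = "max t t0"
  have J: "{?a..?b} \<subseteq> J"
    using \<gamma> t0 t mem_is_interval_1_I[of J ?a ?b] unfolding newton_solution_def
    by (metis atLeastAtMost_iff min_def max_def subsetI)
  have I: "{?a..?b} \<subseteq> {t0 - T<..<t0 + T}" using t T by auto
  have "?b - ?a \<le> 2 * T" using t by (auto simp: min_def max_def)
  from newton_unique[OF \<gamma> J this shifted_flow_solves(1,2)[OF t0(3) I], of t0 t]
  show "\<gamma> t = curve (flow (state \<gamma> t0)) (t - t0)" "state \<gamma> t = flow (state \<gamma> t0) (t - t0)"
    using t0 flow(2)[OF t0(3)] by (auto simp: curve_def)
qed

text \<open>Gluing the flow to the given solution produces one on
  \<open>I \<union> {t0 - T<..<t0 + T}\<close>, and maximality makes this set equal to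
  \<open>I\<close>. So all maximal solutions with state in the half ball exist for at least the same
  time \<open>T\<close> in both directions.\<close>

lemma maximal_solution_extends:
  assumes \<gamma>: "maximal_newton_solution A g V I \<gamma>"
    and t0: "t0 \<in> I" "\<gamma> t0 \<in> cdom c" "state \<gamma> t0 \<in> cball p (r/2)"
  shows "{t0 - T<..<t0 + T} \<subseteq> I"
proof -
  let ?K = "{t0 - T<..<t0 + T}" and ?z = "state \<gamma> t0"
  have sol: "newton_solution A g V I \<gamma>" using \<gamma> by (simp add: maximal_newton_solution_def)
  then have I: "open I" "is_interval I" "continuous_on I \<gamma>" "\<And>t. t \<in> I \<Longrightarrow> newton_at \<gamma> t"
    by (auto simp: newton_solution_iff)
  let ?\<epsilon> = "\<lambda>t. curve (flow ?z) (t - t0)"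
  have "newton_solution A g V ?K (curve (\<lambda>t. flow ?z (t - t0)))"
  proof (rule curve_newton)
    show "((\<lambda>t. flow ?z (t - t0)) has_vector_derivative newton_field c (flow ?z (t - t0))) (at t)"
      "flow ?z (t - t0) \<in> cball p r" if "t \<in> ?K" for t
      \<comment> \<open>With \<open>a = 1\<close> and \<open>b = 0\<close> the interval is empty and
        its inclusion trivial.\<close>
      using shifted_flow_solves(3)[OF t0(3), where a = 1 and b = 0] that flow_in_cball[OF t0(3), of "t - t0"] by auto
  qed (use T in \<open>auto simp: is_interval_connected_1\<close>)
  then have K: "newton_solution A g V ?K ?\<epsilon>" by (simp add: curve_def[abs_def])
  define \<delta> where "\<delta> t = (if t \<in> I then \<gamma> t else ?\<epsilon> t)" for t
  have \<delta>I: "\<delta> t = \<gamma> t" if "t \<in> I" for t using that by (simp add: \<delta>_def)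
  have \<delta>K: "\<delta> t = ?\<epsilon> t" if "t \<in> ?K" for t
    using newton_solution_eq_flow(1)[OF sol t0] that by (simp add: \<delta>_def)
  have "newton_solution A g V (I \<union> ?K) \<delta>"
    unfolding newton_solution_iff
  proof (intro conjI ballI)
    show "is_interval (I \<union> ?K)"
      using I(2) t0(1) T unfolding is_interval_connected_1
      by (intro connected_Un) auto
    show "continuous_on (I \<union> ?K) \<delta>"
    proof (rule continuous_on_open_Un)
      show "continuous_on I \<delta>" using I(3) by (rule continuous_on_eq) (simp add: \<delta>I)
      show "continuous_on ?K \<delta>"
        using K unfolding newton_solution_iff by (auto intro: continuous_on_eq simp: \<delta>K[symmetric] simp del: greaterThanLessThan_iff)
    qed (use I in auto)
    show "newton_at \<delta> t" if "t \<in> I \<union> ?K" for t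
      using that
    proof
      assume "t \<in> I"
      then show ?thesis using newton_at_cong[OF I(1), of t \<gamma> \<delta>] I(4) \<delta>I by auto
    next
      assume t: "t \<in> ?K"
      have "newton_at ?\<epsilon> t" using K t unfolding newton_solution_iff by blast
      with t show ?thesis using newton_at_cong[of ?K t ?\<epsilon> \<delta>] \<delta>K by auto
    qed
  qed (use I t0 in auto)
  then have "I \<union> ?K = I"
    using \<gamma> \<delta>I unfolding maximal_newton_solution_def by blast
  then show ?thesis by blast
qed

lemma reaches_iff:
  assumes q: "q \<in> cdom c" "(coord c q, v) \<in> cball p (r/2)" and t: "t \<in> {-T<..<T}"
  shows "reaches A g V c q v t b \<longleftrightarrow> b = curve (flow (coord c q, v)) t"
proof
  assume "reaches A g V c q v t b"
  then obtain J \<delta> where \<delta>: "newton_solution A g V J \<delta>" "0 \<in> J" "t \<in> J" "\<delta> 0 = q" "velocity c \<delta> 0 = v" "\<delta> t = b"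
    unfolding reaches_def by blast
  then have "state \<delta> 0 = (coord c q, v)" by (simp add: state_def)
  then show "b = curve (flow (coord c q, v)) t"
    using newton_solution_eq_flow(1)[OF \<delta>(1,2), of t] \<delta> q t by simp
next
  let ?z = "(coord c q, v)"
  assume b: "b = curve (flow ?z) t"
  have "0 \<in> {-T<..<T}" using T by simp
  then have "state (curve (flow ?z)) 0 = ?z" using flow_curve(2)[OF q(2)] flow(2)[OF q(2)] by simp
  moreover have "curve (flow ?z) 0 = q" unfolding curve_def using flow(2)[OF q(2)] chartD(3)[OF c q(1)] by simp
  ultimately show "reaches A g V c q v t b"
    unfolding reaches_def using flow_curve(1)[OF q(2)] b t T
    by (intro exI[of _ "{-T<..<T}"] exI[of _ "curve (flow ?z)"]) (auto simp: state_def)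
qed

lemma end_map_eq:
  assumes "q \<in> cdom c" "(coord c q, v) \<in> cball p (r/2)" "t \<in> {-T<..<T}"
  shows "end_map A g V c q (v, t) = curve (flow (coord c q, v)) t"
  unfolding end_map_def by (auto intro!: the_equality simp: reaches_iff[OF assms])

section \<open>The differential of the end map and its critical points\<close>

text \<open>Joint differentiability in velocity and time comes from splitting
  \<open>flow (x, u) s\<close> into the linearization error at time \<open>s\<close>, the term
  \<open>(W s - W t) (0, u - v)\<close>, the linear term at time \<open>t\<close>, and the reference
  trajectory. The first is \<open>o(norm (u - v))\<close> uniformly in \<open>s\<close>, the second
  is small by continuity of \<open>W\<close>; so both have derivative 0.\<close>

lemma flow_velocity_derivative:
  assumes z: "(x, v) \<in> ball p (r/2)" and t: "t \<in> {-T<..<T}"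
    and W: "continuous_on {-T..T} W"
      "\<And>e. e > 0 \<Longrightarrow> \<exists>d>0. \<forall>y\<in>cball p (r/2). norm (y - (x, v)) < d \<longrightarrow>
        (\<forall>t\<in>{-T..T}. norm (flow y t - flow (x, v) t - blinfun_apply (W t) (y - (x, v))) \<le> e * norm (y - (x, v)))"
  shows "((\<lambda>(u, s). fst (flow (x, u) s)) has_derivative
    (\<lambda>(h, s). fst (W t (0, h)) + s *\<^sub>R snd (flow (x, v) t))) (at (v, t))"
proof -
  let ?z = "(x, v)"
  have zc: "?z \<in> cball p (r/2)" using z by auto
  have r1: "((\<lambda>(u, s). flow (x, u) s - flow ?z s - W s (0, u - v)) has_derivative (\<lambda>_. 0)) (at (v, t))"
    unfolding has_derivative_within_alt2
  proof (intro conjI allI impI bounded_linear_zero)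
    fix e :: real assume "e > 0"
    from W(2)[OF this] obtain d where d: "d > 0" "\<And>y t. y \<in> cball p (r/2) \<Longrightarrow> norm (y - ?z) < d \<Longrightarrow> t \<in> {-T..T} \<Longrightarrow>
      norm (flow y t - flow ?z t - W t (y - ?z)) \<le> e * norm (y - ?z)" by blast
    have "\<forall>\<^sub>F q in at (v, t). snd q \<in> {-T<..<T}"
      using t by (intro topological_tendstoD[OF tendsto_snd]) (auto intro: tendsto_ident_at)
    moreover have "\<forall>\<^sub>F q in at (v, t). (x, fst q) \<in> ball p (r/2)"
      using z by (intro topological_tendstoD[OF tendsto_Pair[OF tendsto_const tendsto_fst]])
        (auto intro: tendsto_ident_at)
    moreover have "\<forall>\<^sub>F q in at (v, t). dist (fst q) v < d"
      using tendstoD[OF tendsto_fst[OF tendsto_ident_at] d(1), of "(v, t)" UNIV] by simp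
    ultimately show "\<forall>\<^sub>F q in at (v, t). norm ((case q of (u, s) \<Rightarrow> flow (x, u) s - flow ?z s - W s (0, u - v))
        - (case (v, t) of (u, s) \<Rightarrow> flow (x, u) s - flow ?z s - W s (0, u - v)) - 0) \<le> e * norm (q - (v, t))"
    proof eventually_elim
      case (elim q)
      obtain u s where q: "q = (u, s)" by (cases q)
      have "norm (flow (x, u) s - flow ?z s - W s ((x, u) - ?z)) \<le> e * norm ((x, u) - ?z)"
        using elim q by (intro d(2)) (auto simp: norm_Pair dist_norm less_imp_le)
      also have "\<dots> \<le> e * norm (q - (v, t))"
        using \<open>e > 0\<close> q by (intro mult_left_mono) (auto simp: norm_Pair)
      finally show ?case by (simp add: q blinfun.zero_right flip: zero_prod_def)
    qed
  qed
  have r2: "((\<lambda>(u, s). (W s - W t) (0, u - v)) has_derivative (\<lambda>_. 0)) (at (v, t))"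
    unfolding has_derivative_within_alt2
  proof (intro conjI allI impI bounded_linear_zero)
    fix e :: real assume e: "e > 0"
    have "isCont W t" using continuous_on_interior[OF W(1)] t by (simp add: interior_atLeastAtMost_real)
    then have "((\<lambda>q. W (snd q)) \<longlongrightarrow> W t) (at (v, t))"
      by (intro isCont_tendsto_compose[where g = W]) (auto intro!: tendsto_eq_intros)
    from tendstoD[OF this e]
    show "\<forall>\<^sub>F q in at (v, t). norm ((case q of (u, s) \<Rightarrow> (W s - W t) (0, u - v))
        - (case (v, t) of (u, s) \<Rightarrow> (W s - W t) (0, u - v)) - 0) \<le> e * norm (q - (v, t))"
    proof eventually_elim
      case (elim q)
      obtain u s where q: "q = (u, s)" by (cases q)
      have "norm ((W s - W t) (0, u - v)) \<le> norm (W s - W t) * norm (0 :: 'a, u - v)" by (rule norm_blinfun)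
      also have "\<dots> \<le> e * norm (q - (v, t))"
        using elim e q by (intro mult_mono) (auto simp: norm_Pair dist_norm)
      finally show ?case by (simp add: q)
    qed
  qed
  have d3: "((\<lambda>q. flow ?z (snd q)) has_derivative (\<lambda>q. snd q *\<^sub>R newton_field c (flow ?z t))) (at (v, t))"
  proof (rule has_derivative_compose[OF bounded_linear_imp_has_derivative[OF bounded_linear_snd]])
    show "(flow ?z has_derivative (\<lambda>h. h *\<^sub>R newton_field c (flow ?z t))) (at (snd (v, t)))"
      using flow_deriv_at[OF zc t] by (simp add: has_vector_derivative_def)
  qed
  have d4: "((\<lambda>q. W t (0, fst q - v)) has_derivative (\<lambda>q. W t (0, fst q))) (at (v, t))"
  proof -
    have "((\<lambda>q. (0 :: 'a, fst q - v)) has_derivative (\<lambda>q. (0, fst q - 0))) (at (v, t))"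
      by (intro derivative_intros)
    then show ?thesis using bounded_linear.has_derivative[OF blinfun.bounded_linear_right] by fastforce
  qed
  have "((\<lambda>q. ((case q of (u, s) \<Rightarrow> flow (x, u) s - flow ?z s - W s (0, u - v)) + (case q of (u, s) \<Rightarrow> (W s - W t) (0, u - v)))
      + (W t (0, fst q - v) + flow ?z (snd q))) has_derivative
      (\<lambda>q. (0 + 0) + (W t (0, fst q) + snd q *\<^sub>R newton_field c (flow ?z t)))) (at (v, t))"
    by (intro has_derivative_add r1 r2 d3 d4)
  then have "((\<lambda>q. flow (x, fst q) (snd q)) has_derivative
      (\<lambda>q. W t (0, fst q) + snd q *\<^sub>R newton_field c (flow ?z t))) (at (v, t))"
    by (simp add: split_beta blinfun.diff_left)
  from has_derivative_fst[OF this] show ?thesis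
    by (simp add: case_prod_unfold newton_field_def)
qed

text \<open>The range of the differential is \<open>W\<^sub>t (0, v\<^sup>\<bottom>)\<close> plus the line through the final velocity; a
  solution \<open>w\<close> orthogonal to \<open>v\<close> of \<open>W\<^sub>t (0, w) = final velocity\<close> makes that line superfluous.\<close>

lemma conjugate_alongI:
  assumes \<gamma>: "newton_solution A g V I \<gamma>" "t1 \<in> I" "t1 + t \<in> I" "t \<in> {0<..<T}"
    and dom: "\<gamma> t1 \<in> cdom c" and z: "state \<gamma> t1 = (x, v)" "(x, v) \<in> ball p (r/2)"
    and en: "g c x v v = jm_factor V E (\<gamma> t1)" "v \<noteq> 0"
    and W: "continuous_on {-T..T} W"
      "\<And>e. e > 0 \<Longrightarrow> \<exists>d>0. \<forall>y\<in>cball p (r/2). norm (y - (x, v)) < d \<longrightarrow>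
        (\<forall>t\<in>{-T..T}. norm (flow y t - flow (x, v) t - blinfun_apply (W t) (y - (x, v))) \<le> e * norm (y - (x, v)))"
    and inj: "\<And>h. fst (W t (0, h)) = 0 \<Longrightarrow> h = 0"
    and w: "fst (W t (0, w)) = snd (flow (x, v) t)" "g c x v w = 0"
  shows "conjugate_along A g V E \<gamma> t1 (t1 + t)"
proof -
  have x: "coord c (\<gamma> t1) = x" "velocity c \<gamma> t1 = v" using z by (auto simp: state_def)
  have xc: "x \<in> cimage c" using x dom by auto
  have zc: "(x, v) \<in> cball p (r/2)" using z by auto
  have tT: "t \<in> {-T<..<T}" using \<gamma>(4) T by auto
  note bil = metric_bilinear[OF c xc]
  have pos: "g c x v v > 0" by (rule metric_pos[OF c xc en(2)])
  have \<gamma>t: "\<gamma> (t1 + t) = curve (flow (x, v)) t"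
    using newton_solution_eq_flow(1)[OF \<gamma>(1,2) dom, of "t1 + t"] \<gamma>(3) zc z tT by simp
  have ftin: "fst (flow (x, v) t) \<in> cimage c" using chart_in flow_in_cball[OF zc] tT by auto
  have \<gamma>td: "\<gamma> (t1 + t) \<in> cdom c" unfolding \<gamma>t curve_def using chartD(5)[OF c ftin] .
  let ?dom = "end_map_domain A g V E c (\<gamma> t1)"
  let ?D = "\<lambda>(h, s). fst (W t (0, h)) + s *\<^sub>R snd (flow (x, v) t)"
  have vt: "(v, t) \<in> ?dom"
    using reaches_iff[OF dom, of v t] zc tT \<gamma>(4) x en(1) by (auto simp: end_map_domain_def energy_sphere_def)
  \<comment> \<open>Differentiated over all velocities near \<open>v\<close>, on and off the energy
    sphere; the derivative within the domain of the end map is a restriction.\<close>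
  have "((\<lambda>(u, s). fst (flow (x, u) s)) has_derivative ?D) (at (v, t))"
    by (rule flow_velocity_derivative[OF z(2) tT W])
  then have d1: "((\<lambda>(u, s). fst (flow (x, u) s)) has_derivative ?D) (at (v, t) within ?dom)"
    by (rule has_derivative_at_withinI)
  have e: "(\<lambda>(u, s). fst (flow (x, u) s)) q = (coord c \<circ> end_map A g V c (\<gamma> t1)) q"
    if "(x, fst q) \<in> ball p (r/2)" "snd q \<in> {-T<..<T}" for q
  proof -
    obtain u s where q: "q = (u, s)" by (cases q)
    have u: "(x, u) \<in> cball p (r/2)" using that q by auto
    have "end_map A g V c (\<gamma> t1) (u, s) = curve (flow (x, u)) s"
      using end_map_eq[OF dom, of u s] u x that q by simp
    moreover have "fst (flow (x, u) s) \<in> cimage c" using that q chart_in flow_in_cball[OF u, of s] by auto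
    ultimately show ?thesis using chartD(4)[OF c] by (simp add: q curve_def)
  qed
  have "\<forall>\<^sub>F q in at (v, t) within ?dom. snd q \<in> {-T<..<T}"
    using tT by (intro topological_tendstoD[OF tendsto_snd]) (auto intro: tendsto_ident_at)
  moreover have "\<forall>\<^sub>F q in at (v, t) within ?dom. (x, fst q) \<in> ball p (r/2)"
    using z by (intro topological_tendstoD[OF tendsto_Pair[OF tendsto_const tendsto_fst]])
      (auto intro: tendsto_ident_at)
  ultimately have "\<forall>\<^sub>F q in at (v, t) within ?dom.
      (\<lambda>(u, s). fst (flow (x, u) s)) q = (coord c \<circ> end_map A g V c (\<gamma> t1)) q"
    by eventually_elim (rule e)
  then have D: "((coord c \<circ> end_map A g V c (\<gamma> t1)) has_derivative ?D) (at (v, t) within ?dom)"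
    by (rule has_derivative_transform_eventually[OF d1]) (use e[of "(v, t)"] z(2) tT vt in auto)
  \<comment> \<open>The missed vector is the image of \<open>v\<close> itself: were it in the range,
    injectivity would give \<open>v = h + s *\<^sub>R w\<close> with \<open>h\<close> and
    \<open>w\<close> orthogonal to \<open>v\<close>, against \<open>g c x v v > 0\<close>.\<close>
  have "fst (W t (0, v)) \<notin> ?D ` ({w. g c x v w = 0} \<times> UNIV)"
  proof
    assume "fst (W t (0, v)) \<in> ?D ` ({w. g c x v w = 0} \<times> UNIV)"
    then obtain h s where hs: "g c x v h = 0" "fst (W t (0, v)) = fst (W t (0, h)) + s *\<^sub>R snd (flow (x, v) t)"
      by auto
    have "(0 :: 'a, v - h - s *\<^sub>R w) = (0, v) - (0, h) - s *\<^sub>R (0, w)" by simp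
    then have eq: "fst (W t (0, v - h - s *\<^sub>R w)) = fst (W t (0, v)) - fst (W t (0, h)) - s *\<^sub>R fst (W t (0, w))"
      by (simp only: blinfun.diff_right blinfun.scaleR_right fst_diff fst_scaleR)
    have "fst (W t (0, v - h - s *\<^sub>R w)) = 0" unfolding eq hs(2) w(1) by simp
    then have "v - h - s *\<^sub>R w = 0" by (rule inj)
    then have "v = h + s *\<^sub>R w" by (simp add: diff_diff_eq)
    then have "g c x v v = g c x v (h + s *\<^sub>R w)" by (rule arg_cong)
    then show False
      using pos hs(1) w(2) bilinear_radd[OF bil, of v h "s *\<^sub>R w"] bilinear_rmul[OF bil, of v s w] by simp
  qed
  then have "?D ` ({w. g c x v w = 0} \<times> UNIV) \<noteq> UNIV" by (metis UNIV_I)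
  then have "end_map_critical A g V E c c (\<gamma> t1) v t"
    unfolding end_map_critical_def x using vt D by blast
  then show ?thesis
    unfolding conjugate_along_def using pos en(1) \<gamma>(4) c dom \<gamma>td x by auto
qed

end

section \<open>Lengths of curves\<close>

lemma curve_length_le:
  assumes "a \<le> b" "\<And>t. t \<in> {a..b} \<Longrightarrow> sqrt (speed_sq A h \<gamma> t) \<le> B" "B \<ge> 0"
  shows "curve_length A h \<gamma> a b \<le> ennreal (B * (b - a))"
proof -
  have "curve_length A h \<gamma> a b \<le> (\<integral>\<^sup>+t. ennreal B * indicator {a..b} t \<partial>lborel)"
    unfolding curve_length_def
    by (intro nn_integral_mono) (auto simp: indicator_def intro!: ennreal_leI assms(2))
  also have "\<dots> = ennreal (B * (b - a))"
    using assms by (simp add: nn_integral_cmult_indicator ennreal_mult)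
  finally show ?thesis .
qed

lemma curve_length_ge:
  assumes "a' \<le> b'" "{a'..b'} \<subseteq> {a..b}" "\<And>t. t \<in> {a'..b'} \<Longrightarrow> B \<le> sqrt (speed_sq A h \<gamma> t)" "B \<ge> 0"
  shows "ennreal (B * (b' - a')) \<le> curve_length A h \<gamma> a b"
proof -
  have "ennreal (B * (b' - a')) = (\<integral>\<^sup>+t. ennreal B * indicator {a'..b'} t \<partial>lborel)"
    using assms by (simp add: nn_integral_cmult_indicator ennreal_mult)
  also have "\<dots> \<le> curve_length A h \<gamma> a b"
    unfolding curve_length_def using assms(2)
    by (intro nn_integral_mono) (auto simp: indicator_def subset_iff intro!: ennreal_leI assms(3))
  finally show ?thesis .
qed

context riemannian
begin

lemma chart_segment:
  assumes c: "c \<in> A" and B: "open B" "convex B" "B \<subseteq> cimage c" and xy: "x \<in> B" "y \<in> B"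
  defines "\<delta> \<equiv> \<lambda>s. cinv c (x + s *\<^sub>R (y - x))"
  shows "piecewise_C1_curve A \<delta>"
    "\<And>s. s \<in> {0..1} \<Longrightarrow> x + s *\<^sub>R (y - x) \<in> B"
    "\<And>s. s \<in> {0..1} \<Longrightarrow> speed_sq A g \<delta> s = g c (x + s *\<^sub>R (y - x)) (y - x) (y - x)"
proof -
  let ?l = "\<lambda>s :: real. x + s *\<^sub>R (y - x)"
  have cl: "continuous_on UNIV ?l" by (intro continuous_intros)
  show inB: "?l s \<in> B" if "s \<in> {0..1}" for s
    using convexD_alt[OF B(2) xy, of s] that by (simp add: algebra_simps)
  \<comment> \<open>The segment is continued to an open set of parameters around
    \<open>{0..1}\<close>, because the velocity at the end points is a two-sided derivative.\<close>
  define S where "S = ?l -` B"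
  have S: "open S" unfolding S_def by (rule open_vimage[OF B(1) cl])
  have S01: "s \<in> S" if "s \<in> {0..1}" for s using inB[OF that] by (simp add: S_def)
  have Sc: "?l s \<in> cimage c" if "s \<in> S" for s using that B(3) by (auto simp: S_def)
  have c\<delta>: "continuous_on S \<delta>"
    unfolding \<delta>_def by (rule continuous_on_compose2[OF chartD(7)[OF c] continuous_on_subset[OF cl]])
      (use Sc in auto)
  have iso: "isCont \<delta> s" if "s \<in> S" for s
    using c\<delta> that continuous_on_eq_continuous_at[OF S] by blast
  have dom: "\<delta> s \<in> cdom c" "coord c (\<delta> s) = ?l s" if "s \<in> S" for s
    unfolding \<delta>_def using chartD(4,5)[OF c Sc[OF that]] by blast+
  have dl: "(?l has_vector_derivative (y - x)) (at s)" for s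
    by (auto intro!: derivative_eq_intros simp: has_vector_derivative_def)
  have d\<delta>: "((coord c \<circ> \<delta>) has_vector_derivative (y - x)) (at s)" if "s \<in> S" for s
    by (rule has_vector_derivative_transform_within_open[OF dl S that]) (simp add: dom)
  show "speed_sq A g \<delta> s = g c (?l s) (y - x) (y - x)" if "s \<in> {0..1}" for s
    using speed_sq_chart[OF c dom(1) iso d\<delta>, OF S01 S01 S01, OF that that that] dom(2)[OF S01[OF that]] by simp
  have "C1_arc A \<delta> 0 1"
    unfolding C1_arc_def
  proof (intro ballI exI conjI impI)
    fix d assume d: "d \<in> A"
    have ov: "?l s \<in> overlap c d" if "s \<in> S" "\<delta> s \<in> cdom d" for s
      unfolding overlap_iff[OF c] using Sc[OF that(1)] that(2) by (simp add: \<delta>_def)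
    have "continuous_on (overlap c d) (\<lambda>z. Dtr c d z (y - x))"
      unfolding Dtr_def by (rule k_smooth_1D(2)[OF smooth_onD[OF smooth_transition[OF c d]]])
    then show "continuous_on {s \<in> {0..1}. \<delta> s \<in> cdom d} (\<lambda>s. Dtr c d (?l s) (y - x))"
      by (rule continuous_on_compose2[OF _ continuous_on_subset[OF cl]]) (use ov S01 in auto)
    fix s :: real assume s: "s \<in> {0..1}" "\<delta> s \<in> cdom d"
    show "((coord d \<circ> \<delta>) has_vector_derivative Dtr c d (?l s) (y - x)) (at s within {0..1})"
      using coord_curve_derivative[OF c d dom(1)[OF S01[OF s(1)]] s(2) iso[OF S01[OF s(1)]] d\<delta>[OF S01[OF s(1)]]]
        dom(2)[OF S01[OF s(1)]] has_vector_derivative_at_within by metis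
  qed
  moreover have "continuous_on {0..1} \<delta>" by (rule continuous_on_subset[OF c\<delta>]) (use S01 in auto)
  ultimately show "piecewise_C1_curve A \<delta>"
    \<comment> \<open>A single piece: \<open>n = Suc 0\<close> and \<open>p = real\<close> give the
      partition 0, 1.\<close>
    unfolding piecewise_C1_curve_def by (intro conjI exI[of _ "Suc 0"] exI[of _ real]) auto
qed

end

section \<open>Trajectories near a regular boundary point\<close>

context chart_flow
begin

text \<open>The position component of the field is the projection to the velocity. Hence, in the
  variational equation, the variation of position has the variation of velocity as its
  derivative.\<close>

lemma field_derivative_fst: "z \<in> cball p r \<Longrightarrow> fst (F' z h) = snd h"
proof -
  assume z: "z \<in> cball p r"
  have "((\<lambda>z. fst (newton_field c z)) has_derivative (\<lambda>h. fst (F' z h))) (at z)"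
    by (rule has_derivative_fst[OF deriv[OF z]])
  then have "(snd has_derivative (\<lambda>h. fst (F' z h))) (at z)" by (simp add: newton_field_def)
  from has_derivative_unique[OF this bounded_linear_imp_has_derivative[OF bounded_linear_snd]]
  show ?thesis by (rule fun_cong)
qed

text \<open>A variation that starts as \<open>(0, h)\<close> keeps its velocity component close to
  \<open>h\<close>, as its derivative is at most \<open>L * (2 * norm h)\<close>; one more
  integration brings the position component close to \<open>s *\<^sub>R h\<close>. The error carries
  the factor \<open>s\<close>, as invertibility for small \<open>s\<close> requires.\<close>

lemma linearized_flow_estimate:
  assumes z: "z \<in> cball p (r/2)"
    and W: "W 0 = id_blinfun"
      "\<And>h t. t \<in> {-T..T} \<Longrightarrow>
        ((\<lambda>t. blinfun_apply (W t) h) has_vector_derivative F' (flow z t) (W t h)) (at t within {-T..T})"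
      "\<And>h t. t \<in> {-T..T} \<Longrightarrow> norm (W t h) \<le> 2 * norm h"
    and S: "0 \<le> S" "S \<le> T" "s \<in> {0..S}"
  shows "norm (fst (W s (0, h)) - s *\<^sub>R h) \<le> 2 * L * S * s * norm h"
proof -
  let ?w = "\<lambda>t. W t (0, h)"
  have sub: "{0..S} \<subseteq> {-T..T}" using S T by auto
  have dW: "(?w has_vector_derivative F' (flow z t) (?w t)) (at t within {0..S})" if "t \<in> {0..S}" for t
    using has_vector_derivative_within_subset[OF W(2) sub] that sub by blast
  have snd_est: "norm (snd (?w t) - h) \<le> 2 * L * S * norm h" if t: "t \<in> {0..S}" for t
  proof -
    have "norm (snd (?w t) - snd (?w 0)) \<le> (2 * L * norm h) * \<bar>t - 0\<bar>"
    proof (rule vector_derivative_bound[of "{0..S}"])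
      fix u assume u: "u \<in> {0..S}"
      show "((\<lambda>t. snd (?w t)) has_vector_derivative snd (F' (flow z u) (?w u))) (at u within {0..S})"
        by (rule bounded_linear.has_vector_derivative[OF bounded_linear_snd dW[OF u]])
      have u': "u \<in> {-T..T}" using u sub by blast
      have "norm (snd (F' (flow z u) (?w u))) \<le> norm (F' (flow z u) (?w u))"
        by (metis norm_snd_le prod.collapse)
      also have "\<dots> \<le> norm (F' (flow z u)) * norm (?w u)" by (rule norm_blinfun)
      also have "\<dots> \<le> L * (2 * norm h)"
        using bound[OF flow_in_cball[OF z u']] W(3)[OF u', of "(0, h)"] L by (intro mult_mono) (auto simp: norm_Pair)
      finally show "norm (snd (F' (flow z u) (?w u))) \<le> 2 * L * norm h" by simp
    qed (use t S in auto)
    also have "\<dots> \<le> (2 * L * norm h) * S" using t L by (intro mult_left_mono) auto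
    finally show ?thesis by (simp add: W(1) mult.commute mult.left_commute)
  qed
  have "norm ((fst (?w s) - s *\<^sub>R h) - (fst (?w 0) - 0 *\<^sub>R h)) \<le> (2 * L * S * norm h) * \<bar>s - 0\<bar>"
  proof (rule vector_derivative_bound[of "{0..S}"])
    fix u assume u: "u \<in> {0..S}"
    have u': "u \<in> {-T..T}" using u sub by blast
    have "((\<lambda>t. fst (?w t)) has_vector_derivative snd (?w u)) (at u within {0..S})"
      using bounded_linear.has_vector_derivative[OF bounded_linear_fst dW[OF u]]
        field_derivative_fst[OF flow_in_cball[OF z u']] by simp
    moreover have "((\<lambda>t. t *\<^sub>R h) has_vector_derivative h) (at u within {0..S})"
      by (auto intro!: derivative_eq_intros simp: has_vector_derivative_def)
    ultimately show "((\<lambda>t. fst (?w t) - t *\<^sub>R h) has_vector_derivative snd (?w u) - h) (at u within {0..S})"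
      by (rule has_vector_derivative_diff)
  qed (use snd_est S in auto)
  then show ?thesis using S(3) by (simp add: W(1) mult.commute mult.left_commute)
qed

end

section \<open>Comparison with a parabola\<close>

text \<open>\<open>a\<close> is the acceleration of the parabola and \<open>\<kappa>\<close> the
  relative error of the comparison. \<open>1/64\<close> makes velocity errors at most
  \<open>norm a * \<tau> / 32\<close>; \<open>288 * N * \<kappa> < m\<close> decides the comparison
  of lengths and, with much to spare, the signs in the intermediate value argument;
  \<open>16 * C * \<kappa> \<le> m * norm a\<close> keeps the comparison segment in the Hill
  region.\<close>

locale near_hill_boundary = chart_flow A g V c F' "(y0, 0)" r M L T
  for A :: "('m::{t2_space, second_countable_topology}, 'a::euclidean_space) chart set"
    and g :: "('m, 'a) tensor2" and V c F' y0 r M L T +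
  fixes E m N C \<kappa> :: real and a :: 'a
  assumes a: "a \<noteq> 0" and m: "m > 0" and C: "C \<ge> 0" and \<kappa>: "0 < \<kappa>" "\<kappa> \<le> 1/64" "288 * N * \<kappa> < m"
      "16 * C * \<kappa> \<le> m * norm a"
    and metric_lower: "\<And>x u. x \<in> cball y0 r \<Longrightarrow> m * (norm u)\<^sup>2 \<le> g c x u u"
    and metric_upper: "\<And>x u w. x \<in> cball y0 r \<Longrightarrow> \<bar>g c x u w\<bar> \<le> N * (norm u * norm w)"
    and force_near: "\<And>x v. (x, v) \<in> cball (y0, 0) r \<Longrightarrow> norm (force c x v - a) \<le> \<kappa> * norm a"
    and factor_lipschitz: "\<And>x y. x \<in> cball y0 r \<Longrightarrow> y \<in> cball y0 r \<Longrightarrow>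
      \<bar>jm_factor V E (cinv c x) - jm_factor V E (cinv c y)\<bar> \<le> C * norm (x - y)"
begin

lemma fst_in: "z \<in> cball (y0, 0) r \<Longrightarrow> fst z \<in> cball y0 r"
  using dist_fst_le[of "(y0, 0)" z] by auto

lemma fst_in_ball: "z \<in> ball (y0, 0) r \<Longrightarrow> fst z \<in> ball y0 r"
  using dist_fst_le[of "(y0, 0)" z] by auto

lemma cball_in: "cball y0 r \<subseteq> cimage c"
proof
  fix x assume "x \<in> cball y0 r"
  then have "(x, 0) \<in> cball (y0, 0) r" by (simp add: dist_Pair_Pair)
  then show "x \<in> cimage c" using ball_in by auto
qed

text \<open>One \<open>\<kappa> * norm a * \<tau>\<close> is the starting velocity, the other the
  deviation of the force from \<open>a\<close>, integrated over a time of at most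
  \<open>\<tau>\<close>.\<close>

lemma velocity_estimate:
  assumes z: "z \<in> cball (y0, 0) (r/2)" "norm (snd z) \<le> \<kappa> * norm a * \<tau>" and \<tau>: "0 < \<tau>" "\<tau> \<le> T"
    and t: "t \<in> {-\<tau>..\<tau>}"
  shows "norm (snd (flow z t) - t *\<^sub>R a) \<le> 2 * \<kappa> * norm a * \<tau>"
proof -
  have sub: "{-\<tau>..\<tau>} \<subseteq> {-T..T}" using \<tau> by auto
  have "norm ((snd (flow z t) - t *\<^sub>R a) - (snd (flow z 0) - 0 *\<^sub>R a)) \<le> (\<kappa> * norm a) * \<bar>t - 0\<bar>"
  proof (rule vector_derivative_bound[of "{-\<tau>..\<tau>}"])
    fix u assume u: "u \<in> {-\<tau>..\<tau>}"
    then have u': "u \<in> {-T..T}" using sub by blast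
    have "((\<lambda>t. snd (flow z t)) has_vector_derivative force c (fst (flow z u)) (snd (flow z u))) (at u within {-\<tau>..\<tau>})"
      using bounded_linear.has_vector_derivative[OF bounded_linear_snd
          has_vector_derivative_within_subset[OF flow_deriv[OF z(1) u'] sub]] by (simp add: newton_field_def)
    moreover have "((\<lambda>t. t *\<^sub>R a) has_vector_derivative a) (at u within {-\<tau>..\<tau>})"
      by (auto intro!: derivative_eq_intros simp: has_vector_derivative_def)
    ultimately show "((\<lambda>t. snd (flow z t) - t *\<^sub>R a) has_vector_derivative
        force c (fst (flow z u)) (snd (flow z u)) - a) (at u within {-\<tau>..\<tau>})"
      by (rule has_vector_derivative_diff)
    show "norm (force c (fst (flow z u)) (snd (flow z u)) - a) \<le> \<kappa> * norm a"
      using flow_in_cball[OF z(1) u'] by (intro force_near) (simp add: prod.collapse)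
  qed (use t \<tau> in auto)
  also have "\<dots> \<le> (\<kappa> * norm a) * \<tau>" using t \<kappa> by (intro mult_left_mono) auto
  finally have "norm ((snd (flow z t) - t *\<^sub>R a) - snd z) \<le> \<kappa> * norm a * \<tau>"
    using flow(2)[OF z(1)] by simp
  then show ?thesis
    using z(2) norm_triangle_ineq[of "(snd (flow z t) - t *\<^sub>R a) - snd z" "snd z"] by simp
qed

text \<open>Integration of \<open>velocity_estimate\<close>. For \<open>t = \<tau>\<close> and
  \<open>s = -\<tau>\<close> the quadratic term cancels and the arc almost closes up; if
  \<open>\<bar>t\<bar>\<close> and \<open>\<bar>s\<bar>\<close> differ enough, that term separates
  the two positions.\<close>

lemma position_estimate:
  assumes z: "z \<in> cball (y0, 0) (r/2)" "norm (snd z) \<le> \<kappa> * norm a * \<tau>" and \<tau>: "0 < \<tau>" "\<tau> \<le> T"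
    and t: "t \<in> {-\<tau>..\<tau>}" and s: "s \<in> {-\<tau>..\<tau>}"
  shows "norm (fst (flow z t) - fst (flow z s) - ((t\<^sup>2 - s\<^sup>2) / 2) *\<^sub>R a) \<le> 4 * \<kappa> * norm a * \<tau>\<^sup>2"
proof -
  have sub: "{-\<tau>..\<tau>} \<subseteq> {-T..T}" using \<tau> by auto
  have "norm ((fst (flow z t) - (t\<^sup>2 / 2) *\<^sub>R a) - (fst (flow z s) - (s\<^sup>2 / 2) *\<^sub>R a))
      \<le> (2 * \<kappa> * norm a * \<tau>) * \<bar>t - s\<bar>"
  proof (rule vector_derivative_bound[of "{-\<tau>..\<tau>}"])
    fix u assume u: "u \<in> {-\<tau>..\<tau>}"
    then have u': "u \<in> {-T..T}" using sub by blast
    have "((\<lambda>t. fst (flow z t)) has_vector_derivative snd (flow z u)) (at u within {-\<tau>..\<tau>})"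
      using bounded_linear.has_vector_derivative[OF bounded_linear_fst
          has_vector_derivative_within_subset[OF flow_deriv[OF z(1) u'] sub]] by (simp add: newton_field_def)
    moreover have "((\<lambda>t. (t\<^sup>2 / 2) *\<^sub>R a) has_vector_derivative u *\<^sub>R a) (at u within {-\<tau>..\<tau>})"
      by (auto intro!: derivative_eq_intros simp: has_vector_derivative_def)
    ultimately show "((\<lambda>t. fst (flow z t) - (t\<^sup>2 / 2) *\<^sub>R a) has_vector_derivative
        snd (flow z u) - u *\<^sub>R a) (at u within {-\<tau>..\<tau>})"
      by (rule has_vector_derivative_diff)
    show "norm (snd (flow z u) - u *\<^sub>R a) \<le> 2 * \<kappa> * norm a * \<tau>"
      by (rule velocity_estimate[OF z \<tau> u])
  qed (use t s in auto)
  also have "\<dots> \<le> (2 * \<kappa> * norm a * \<tau>) * (2 * \<tau>)" using t s \<kappa> \<tau> by (intro mult_left_mono) auto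
  finally show ?thesis by (simp add: algebra_simps power2_eq_square diff_divide_distrib)
qed

end

text \<open>With the errors \<open>e\<close> of \<open>u\<close> against
  \<open>- \<tau> *\<^sub>R a\<close> and \<open>f\<close> of \<open>w\<close> against
  \<open>\<theta> *\<^sub>R a\<close>, the quantity to be bounded is
  \<open>B e f + \<theta> * B e a - \<tau> * B a f\<close>. In units of
  \<open>N * \<kappa> * (norm a)\<^sup>2 * \<tau>\<^sup>2\<close> the three terms contribute
  \<open>8 * \<kappa>\<close>, 2 and 4, and \<open>8 * \<kappa> \<le> 1\<close>.\<close>

lemma bilinear_perturbation:
  fixes B :: "'a::real_normed_vector \<Rightarrow> 'a \<Rightarrow> real"
  assumes B: "bilinear B" "\<And>u w. \<bar>B u w\<bar> \<le> N * (norm u * norm w)"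
    and u: "norm (u + \<tau> *\<^sub>R a) \<le> 2 * \<kappa> * norm a * \<tau>" and w: "norm (w - \<theta> *\<^sub>R a) \<le> 4 * \<kappa> * norm a * \<tau>"
    and "0 \<le> \<tau>" "\<bar>\<theta>\<bar> \<le> \<tau>" "0 \<le> \<kappa>" "\<kappa> \<le> 1/64" "0 \<le> N"
  shows "\<bar>B u w + \<tau> * \<theta> * B a a\<bar> \<le> 7 * N * \<kappa> * (norm a)\<^sup>2 * \<tau>\<^sup>2"
proof -
  define e f where "e = u + \<tau> *\<^sub>R a" and "f = w - \<theta> *\<^sub>R a"
  let ?x = "norm a * \<tau>"
  have x: "0 \<le> ?x" using assms by simp
  have e: "norm e \<le> 2 * \<kappa> * ?x" and f: "norm f \<le> 4 * \<kappa> * ?x" using u w by (simp_all add: e_def f_def mult.assoc)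
  have uw: "u = e - \<tau> *\<^sub>R a" "w = f + \<theta> *\<^sub>R a" by (simp_all add: e_def f_def)
  have "B u w + \<tau> * \<theta> * B a a = B e f + \<theta> * B e a - \<tau> * B a f"
    unfolding uw by (simp add: bilinear_lsub[OF B(1)] bilinear_radd[OF B(1)] bilinear_lmul[OF B(1)]
        bilinear_rmul[OF B(1)] algebra_simps)
  moreover have "\<bar>B e f\<bar> \<le> N * ((2 * \<kappa> * ?x) * (4 * \<kappa> * ?x))"
  proof -
    have "\<bar>B e f\<bar> \<le> N * (norm e * norm f)" by (rule B(2))
    also have "\<dots> \<le> N * ((2 * \<kappa> * ?x) * (4 * \<kappa> * ?x))"
      using e f assms x by (intro mult_left_mono mult_mono) auto
    finally show ?thesis .
  qed
  moreover have "\<bar>\<theta> * B e a\<bar> \<le> \<tau> * (N * ((2 * \<kappa> * ?x) * norm a))"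
  proof -
    have "\<bar>\<theta> * B e a\<bar> \<le> \<tau> * (N * (norm e * norm a))"
      unfolding abs_mult using assms B(2) by (intro mult_mono) auto
    also have "\<dots> \<le> \<tau> * (N * ((2 * \<kappa> * ?x) * norm a))"
      using e assms by (intro mult_left_mono mult_right_mono) auto
    finally show ?thesis .
  qed
  moreover have "\<bar>\<tau> * B a f\<bar> \<le> \<tau> * (N * (norm a * (4 * \<kappa> * ?x)))"
  proof -
    have "\<bar>\<tau> * B a f\<bar> \<le> \<tau> * (N * (norm a * norm f))"
      unfolding abs_mult using assms B(2) by (intro mult_mono) auto
    also have "\<dots> \<le> \<tau> * (N * (norm a * (4 * \<kappa> * ?x)))"
      using f assms by (intro mult_left_mono) auto
    finally show ?thesis .
  qed
  ultimately have "\<bar>B u w + \<tau> * \<theta> * B a a\<bar>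
      \<le> N * ((2 * \<kappa> * ?x) * (4 * \<kappa> * ?x)) + \<tau> * (N * ((2 * \<kappa> * ?x) * norm a)) + \<tau> * (N * (norm a * (4 * \<kappa> * ?x)))"
    by linarith
  also have "\<dots> = (8 * \<kappa> + 6) * (N * \<kappa> * (norm a)\<^sup>2 * \<tau>\<^sup>2)"
    by (simp add: algebra_simps power2_eq_square)
  also have "\<dots> \<le> 7 * (N * \<kappa> * (norm a)\<^sup>2 * \<tau>\<^sup>2)"
    using assms by (intro mult_right_mono) auto
  finally show ?thesis by (simp add: mult.assoc)
qed

context mechanics
begin

lemma jm_geodesic_energy:
  assumes \<gamma>: "jm_geodesic A g V E I \<gamma>" and t: "t \<in> I"
  shows "speed_sq A g \<gamma> t = jm_factor V E (\<gamma> t)"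
    "c \<in> A \<Longrightarrow> \<gamma> t \<in> cdom c \<Longrightarrow>
      jm_factor V E (\<gamma> t) = g c (coord c (\<gamma> t)) (velocity c \<gamma> t) (velocity c \<gamma> t)"
proof -
  have "speed_sq A g \<gamma> t / 2 + V (\<gamma> t) = E" using assms by (simp add: jm_geodesic_def)
  then show f: "speed_sq A g \<gamma> t = jm_factor V E (\<gamma> t)" by (simp add: jm_factor_def field_simps)
  assume c: "c \<in> A" "\<gamma> t \<in> cdom c"
  have sol: "newton_solution A g V I \<gamma>" using \<gamma> by (simp add: jm_geodesic_def maximal_newton_solution_def)
  then have "newton_at \<gamma> t" using t by (simp add: newton_solution_iff)
  note v = newton_at_chart(1)[OF this c]
  have "isCont \<gamma> t"
    using sol t unfolding newton_solution_iff by (metis continuous_on_eq_continuous_at)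
  from speed_sq_chart[OF c this v] f
  show "jm_factor V E (\<gamma> t) = g c (coord c (\<gamma> t)) (velocity c \<gamma> t) (velocity c \<gamma> t)" by simp
qed

text \<open>By energy the squared kinetic speed is \<open>f\<close>, so the JM speed, the root of
  \<open>f\<close> times that square, is \<open>f\<close> itself: the JM length of a geodesic is the
  integral of \<open>f\<close> over Newtonian time.\<close>

lemma jm_geodesic_in_hill:
  assumes "jm_geodesic A g V E I \<gamma>" "t \<in> I"
  shows "\<gamma> t \<in> hill_region V E" "sqrt (speed_sq A (jm_metric g V E) \<gamma> t) = jm_factor V E (\<gamma> t)"
proof -
  have f: "jm_factor V E (\<gamma> t) \<ge> 0"
    using jm_geodesic_energy(1)[OF assms] speed_sq_nonneg[of \<gamma> t] by simp
  then show "\<gamma> t \<in> hill_region V E" by (simp add: hill_region_def)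
  show "sqrt (speed_sq A (jm_metric g V E) \<gamma> t) = jm_factor V E (\<gamma> t)"
    using f by (simp add: speed_sq_jm jm_geodesic_energy(1)[OF assms] flip: power2_eq_square)
qed

end

context near_hill_boundary
begin

lemma m_le_N: "m \<le> N"
proof -
  have y: "y0 \<in> cball y0 r" using r by simp
  have "m * (norm a)\<^sup>2 \<le> N * (norm a)\<^sup>2"
    using metric_lower[OF y, of a] metric_upper[OF y, of a a] by (simp add: power2_eq_square)
  then show ?thesis using a by simp
qed

text \<open>The vector \<open>s *\<^sub>R w s\<close>, rather than \<open>w s\<close>, is compared
  with \<open>(s - \<tau>) *\<^sub>R a\<close>: it differs from the final velocity, and the final
  velocity from \<open>(s - \<tau>) *\<^sub>R a\<close>, by a multiple of
  \<open>\<kappa> * norm a * \<tau>\<close>. The factor \<open>s > 0\<close> leaves the sign of the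
  inner product unchanged. Continuity of \<open>w\<close> comes from
  \<open>solve_continuous_on\<close>.\<close>

lemma final_velocity_transverse:
  assumes z: "z \<in> cball (y0, 0) (r/2)" "norm (snd z) \<le> \<kappa> * norm a * \<tau>"
    and \<tau>: "0 < \<tau>" "2 * \<tau> < T" "4 * L * \<tau> \<le> \<kappa>"
    and z1: "z1 = flow z (-\<tau>)" "z1 \<in> cball (y0, 0) (r/2)"
    and W: "W 0 = id_blinfun"
      "\<And>h t. t \<in> {-T..T} \<Longrightarrow>
        ((\<lambda>t. blinfun_apply (W t) h) has_vector_derivative F' (flow z1 t) (W t h)) (at t within {-T..T})"
      "\<And>h t. t \<in> {-T..T} \<Longrightarrow> norm (W t h) \<le> 2 * norm h"
      "continuous_on {-T..T} W"
  shows "\<And>s h. s \<in> {0<..2 * \<tau>} \<Longrightarrow> fst (W s (0, h)) = 0 \<Longrightarrow> h = 0"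
    "\<exists>s\<in>{\<tau>/2..3*\<tau>/2}. \<exists>w. fst (W s (0, w)) = snd (flow z1 s) \<and> g c (fst z1) (snd z1) w = 0"
proof -
  have est: "norm (fst (W s (0, h)) - s *\<^sub>R h) \<le> \<kappa> * (s * norm h)" if s: "s \<in> {0..2*\<tau>}" for s h
  proof -
    have "norm (fst (W s (0, h)) - s *\<^sub>R h) \<le> 2 * L * (2 * \<tau>) * s * norm h"
      using linearized_flow_estimate[OF z1(2) W(1-3), of "2 * \<tau>" s h] s \<tau> by simp
    also have "\<dots> = (4 * L * \<tau>) * (s * norm h)" by simp
    also have "\<dots> \<le> \<kappa> * (s * norm h)" using \<tau>(3) s by (intro mult_right_mono) auto
    finally show ?thesis .
  qed
  show inj: "h = 0" if s: "s \<in> {0<..2 * \<tau>}" and h: "fst (W s (0, h)) = 0" for s h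
  proof -
    have "s * norm h \<le> \<kappa> * (s * norm h)" using est[of s h] s h by simp
    moreover have "\<kappa> * (s * norm h) \<le> (1/2) * (s * norm h)" using \<kappa> s by (intro mult_right_mono) auto
    moreover have "0 \<le> s * norm h" using s by simp
    ultimately have "s * norm h = 0" by linarith
    then show "h = 0" using s by simp
  qed
  \<comment> \<open>The trajectory from \<open>z1\<close> is that from \<open>z\<close> with time
    shifted by \<open>\<tau>\<close>; this makes the velocity estimate available, which is centered
    at the slow moment.\<close>
  have flow1: "flow z1 s = flow z (s - \<tau>)" if s: "s \<in> {0..2*\<tau>}" for s
  proof -
    have "solves {0..2*\<tau>} (flow z1)"
      using flow(1)[OF z1(2)] \<tau> has_vector_derivative_within_subset[of "flow z1" _ _ "{-T..T}" "{0..2*\<tau>}"]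
      unfolding solves_def by fastforce
    moreover have "solves {0..2*\<tau>} (\<lambda>t. flow z (t - \<tau>))"
      using \<tau> by (intro shifted_flow_solves(1)[OF z(1)]) auto
    ultimately show ?thesis
      using solves_unique[of 0 "2*\<tau>" "flow z1" "\<lambda>t. flow z (t - \<tau>)" 0 s] s \<tau> z1 flow(2)[OF z1(2)] by simp
  qed
  let ?I = "{\<tau>/2..3*\<tau>/2}"
  have sub: "?I \<subseteq> {0..2*\<tau>}" "?I \<subseteq> {0<..2*\<tau>}" "?I \<subseteq> {-T..T}" using \<tau> by auto
  define G where "G s = Blinfun (\<lambda>h. fst (W s (0, h)))" for s
  have blin: "bounded_linear (\<lambda>h. fst (W s (0, h)))" for s
    by (intro bounded_linear_compose[OF bounded_linear_fst] bounded_linear_compose[OF blinfun.bounded_linear_right]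
        bounded_linear_Pair bounded_linear_zero bounded_linear_ident)
  have G: "G s h = fst (W s (0, h))" for s h
    unfolding G_def using bounded_linear_Blinfun_apply[OF blin] by simp
  have Ginj: "inj (blinfun_apply (G s))" if "s \<in> ?I" for s
    using inj[of s] that sub(2)
    by (subst linear_injective_0) (auto simp: G blinfun.bounded_linear_right bounded_linear.linear)
  have cG: "continuous_on ?I G"
    by (rule continuous_on_blinfun_componentwise, unfold G)
      (intro continuous_intros continuous_on_subset[OF W(4) sub(3)])
  have "surj (blinfun_apply (G s))" if "s \<in> ?I" for s
    using linear_injective_imp_surjective[OF _ Ginj[OF that]]
    by (simp add: blinfun.bounded_linear_right bounded_linear.linear)
  then have "\<forall>s. \<exists>w. s \<in> ?I \<longrightarrow> G s w = snd (flow z1 s)" by (metis surjD)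
  then obtain w where w: "\<And>s. s \<in> ?I \<Longrightarrow> G s (w s) = snd (flow z1 s)" by metis
  have cflow: "continuous_on {-T..T} (flow z1)"
    using flow_deriv[OF z1(2)] by (meson continuous_on_eq_continuous_within has_vector_derivative_continuous)
  have cw: "continuous_on ?I w"
    by (rule solve_continuous_on[OF cG _ w Ginj]) (intro continuous_intros continuous_on_subset[OF cflow sub(3)])
  let ?B = "g c (fst z1)"
  have x1: "fst z1 \<in> cball y0 r" using fst_in flow_in_cball[OF z(1), of "-\<tau>"] z1(1) \<tau> by simp
  then have x1c: "fst z1 \<in> cimage c" using cball_in by blast
  note bil = metric_bilinear[OF c x1c]
  have Baa: "m * (norm a)\<^sup>2 \<le> ?B a a" by (rule metric_lower[OF x1])
  have near: "\<bar>s * ?B (snd z1) (w s) + \<tau> * (s - \<tau>) * ?B a a\<bar> \<le> 7 * N * \<kappa> * (norm a)\<^sup>2 * \<tau>\<^sup>2"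
    if s: "s \<in> ?I" for s
  proof -
    let ?v = "snd (flow z1 s)"
    have s': "s \<in> {0..2*\<tau>}" using s sub by blast
    have "norm (snd (flow z (s - \<tau>)) - (s - \<tau>) *\<^sub>R a) \<le> 2 * \<kappa> * norm a * \<tau>"
      using s' \<tau> by (intro velocity_estimate[OF z]) auto
    then have v: "norm (?v - (s - \<tau>) *\<^sub>R a) \<le> 2 * \<kappa> * norm a * \<tau>" using flow1[OF s'] by simp
    have u: "norm (snd z1 + \<tau> *\<^sub>R a) \<le> 2 * \<kappa> * norm a * \<tau>"
      using velocity_estimate[OF z, of "-\<tau>"] \<tau> z1(1) by simp
    have e: "norm (?v - s *\<^sub>R w s) \<le> \<kappa> * (s * norm (w s))" using est[OF s', of "w s"] w[OF s] by (simp add: G)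
    have \<tau>0: "0 \<le> norm a * \<tau>" using \<tau> by simp
    have "norm ((s - \<tau>) *\<^sub>R a) \<le> \<tau> * norm a" using s' by (simp add: abs_le_iff mult_right_mono)
    then have nv: "norm ?v \<le> norm a * \<tau> + 2 * \<kappa> * (norm a * \<tau>)"
      using v norm_triangle_ineq[of "?v - (s - \<tau>) *\<^sub>R a" "(s - \<tau>) *\<^sub>R a"] by (simp add: mult.commute mult.left_commute)
    have "\<kappa> * (norm a * \<tau>) \<le> 1/64 * (norm a * \<tau>)" "\<kappa> * (s * norm (w s)) \<le> 1/64 * (s * norm (w s))"
      using mult_right_mono[OF \<kappa>(2) \<tau>0] mult_right_mono[OF \<kappa>(2), of "s * norm (w s)"] s' by auto
    moreover have "s * norm (w s) \<le> norm ?v + \<kappa> * (s * norm (w s))"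
      using e norm_triangle_ineq2[of "s *\<^sub>R w s" ?v] s' by (simp add: norm_minus_commute)
    \<comment> \<open>With \<open>\<kappa> \<le> 1/64\<close> the facts say that
      \<open>63/64\<close> of the left side is at most \<open>33/32\<close> of
      \<open>norm a * \<tau>\<close>; the factor 2 is generous.\<close>
    ultimately have sw: "s * norm (w s) \<le> 2 * (norm a * \<tau>)" using nv \<tau>0 by linarith
    have "norm (s *\<^sub>R w s - (s - \<tau>) *\<^sub>R a) \<le> \<kappa> * (s * norm (w s)) + 2 * \<kappa> * norm a * \<tau>"
      using e v norm_triangle_ineq4[of "?v - (s - \<tau>) *\<^sub>R a" "?v - s *\<^sub>R w s"] by simp
    also have "\<dots> \<le> 4 * \<kappa> * norm a * \<tau>"
      using mult_left_mono[OF sw, of \<kappa>] \<kappa>(1) by (simp add: mult.commute mult.left_commute)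
    finally have w': "norm (s *\<^sub>R w s - (s - \<tau>) *\<^sub>R a) \<le> 4 * \<kappa> * norm a * \<tau>" .
    have "\<bar>?B (snd z1) (s *\<^sub>R w s) + \<tau> * (s - \<tau>) * ?B a a\<bar> \<le> 7 * N * \<kappa> * (norm a)\<^sup>2 * \<tau>\<^sup>2"
      using \<tau> s' \<kappa> m m_le_N by (intro bilinear_perturbation[OF bil metric_upper[OF x1] u w']) auto
    then show ?thesis by (simp add: bilinear_rmul[OF bil])
  qed
  have a\<tau>: "0 < (norm a)\<^sup>2 * \<tau>\<^sup>2" using a \<tau> by simp
  have "(288 * N * \<kappa>) * ((norm a)\<^sup>2 * \<tau>\<^sup>2) < m * ((norm a)\<^sup>2 * \<tau>\<^sup>2)"
    using \<kappa>(3) a\<tau> by (rule mult_strict_right_mono)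
  moreover have "m * (norm a)\<^sup>2 * \<tau>\<^sup>2 \<le> ?B a a * \<tau>\<^sup>2" using Baa by (rule mult_right_mono) simp
  moreover have "0 \<le> N * \<kappa> * ((norm a)\<^sup>2 * \<tau>\<^sup>2)" using m m_le_N \<kappa> a\<tau> by simp
  \<comment> \<open>At both ends of the interval the main term has absolute value
    \<open>?B a a * \<tau>\<^sup>2 / 2\<close>, so twice the error constant 7 has to stay below
    \<open>?B a a * \<tau>\<^sup>2\<close>.\<close>
  ultimately have Bn: "14 * (N * \<kappa> * (norm a)\<^sup>2 * \<tau>\<^sup>2) < ?B a a * \<tau>\<^sup>2"
    by (simp add: mult.assoc)
  have in12: "\<tau>/2 \<in> ?I" "3*\<tau>/2 \<in> ?I" using \<tau> by auto
  have e12: "\<tau> * (\<tau>/2 - \<tau>) * ?B a a = - (?B a a * \<tau>\<^sup>2 / 2)" "\<tau> * (3*\<tau>/2 - \<tau>) * ?B a a = ?B a a * \<tau>\<^sup>2 / 2"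
    by (simp_all add: power2_eq_square field_simps)
  have "0 \<le> (\<tau>/2) * ?B (snd z1) (w (\<tau>/2))"
    using near[OF in12(1)] Bn unfolding e12 by linarith
  then have 1: "0 \<le> ?B (snd z1) (w (\<tau>/2))" using \<tau> by (simp add: zero_le_mult_iff)
  have "(3*\<tau>/2) * ?B (snd z1) (w (3*\<tau>/2)) \<le> 0"
    using near[OF in12(2)] Bn unfolding e12 by linarith
  then have 2: "?B (snd z1) (w (3*\<tau>/2)) \<le> 0" using \<tau> by (simp add: mult_le_0_iff)
  have lB: "bounded_linear (?B (snd z1))"
    using bil by (simp add: bilinear_def linear_conv_bounded_linear)
  have "continuous_on ?I (\<lambda>s. ?B (snd z1) (w s))"
    by (rule bounded_linear.continuous_on[OF lB cw])
  from IVT2'[of "\<lambda>s. ?B (snd z1) (w s)", OF 2 1 _ this] \<tau>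
  obtain s where "s \<in> ?I" "?B (snd z1) (w s) = 0" by auto
  then show "\<exists>s\<in>?I. \<exists>w. fst (W s (0, w)) = snd (flow z1 s) \<and> g c (fst z1) (snd z1) w = 0"
    using w G by metis
qed

end

section \<open>A geodesic with a slow moment near the boundary\<close>

text \<open>The radii leave room for the change of base point: during a time \<open>\<tau>\<close>
  the state moves by at most \<open>M * \<tau> \<le> r/8\<close>, so at \<open>t0 - \<tau>\<close>
  it still lies strictly inside the ball of radius \<open>r/2\<close> of admissible starting points.
  \<open>2 * \<tau> < T\<close> covers the whole arc as seen from there.\<close>

locale geodesic_near_boundary = near_hill_boundary A g V c F' y0 r M L T E m N C \<kappa> a
  for A :: "('m::{t2_space, second_countable_topology}, 'a::euclidean_space) chart set"
    and g :: "('m, 'a) tensor2" and V c F' y0 r M L T E m N C \<kappa> a +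
  fixes I :: "real set" and \<gamma> :: "real \<Rightarrow> 'm" and t0 \<tau> :: real
  assumes geodesic: "jm_geodesic A g V E I \<gamma>" and t0: "t0 \<in> I" "\<gamma> t0 \<in> cdom c"
    and start: "state \<gamma> t0 \<in> cball (y0, 0) (r/4)" "norm (velocity c \<gamma> t0) \<le> \<kappa> * norm a * \<tau>"
    and \<tau>: "0 < \<tau>" "2 * \<tau> < T" "M * \<tau> \<le> r/8" "4 * L * \<tau> \<le> \<kappa>"
begin

definition Z :: "real \<Rightarrow> 'a \<times> 'a" where "Z = flow (state \<gamma> t0)"

lemma start': "state \<gamma> t0 \<in> cball (y0, 0) (r/2)" "norm (snd (state \<gamma> t0)) \<le> \<kappa> * norm a * \<tau>"
proof -
  show "state \<gamma> t0 \<in> cball (y0, 0) (r/2)" using start(1) r by (simp only: mem_cball)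
  show "norm (snd (state \<gamma> t0)) \<le> \<kappa> * norm a * \<tau>" using start(2) by (simp add: state_def)
qed

lemma solution: "newton_solution A g V I \<gamma>"
  using geodesic by (simp add: jm_geodesic_def maximal_newton_solution_def)

lemma interval_in: "{t0 - T<..<t0 + T} \<subseteq> I"
  using maximal_solution_extends[OF _ t0 start'(1)] geodesic by (simp add: jm_geodesic_def)

lemma along:
  assumes t: "t \<in> {-T<..<T}"
  shows "t0 + t \<in> I" "\<gamma> (t0 + t) = cinv c (fst (Z t))" "state \<gamma> (t0 + t) = Z t"
    "\<gamma> (t0 + t) \<in> cdom c" "fst (Z t) \<in> ball y0 r"
    "jm_factor V E (\<gamma> (t0 + t)) = g c (fst (Z t)) (snd (Z t)) (snd (Z t))"
proof -
  show I: "t0 + t \<in> I" using interval_in t by auto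
  show \<gamma>: "\<gamma> (t0 + t) = cinv c (fst (Z t))" and s: "state \<gamma> (t0 + t) = Z t"
    using newton_solution_eq_flow[OF solution t0 start'(1) I] t by (auto simp: Z_def curve_def)
  show b: "fst (Z t) \<in> ball y0 r"
    unfolding Z_def using t by (intro fst_in_ball flow(3)[OF start'(1)]) auto
  show d: "\<gamma> (t0 + t) \<in> cdom c"
    unfolding \<gamma> using b cball_in by (intro chartD(5)[OF c]) auto
  show "jm_factor V E (\<gamma> (t0 + t)) = g c (fst (Z t)) (snd (Z t)) (snd (Z t))"
    using jm_geodesic_energy(2)[OF geodesic I c d] s unfolding state_def by (metis fst_conv snd_conv)
qed

text \<open>The velocity is \<open>t *\<^sub>R a\<close> up to \<open>norm a * \<tau> / 32\<close>,
  so its norm is at least \<open>k * norm a * \<tau>\<close> once \<open>\<bar>t\<bar>\<close>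
  exceeds \<open>k * \<tau>\<close> by \<open>\<tau> / 32\<close>. The values in use are
  \<open>k = 1/2\<close> at time \<open>-\<tau>\<close> and \<open>k = 1/4\<close> on the last
  quarter of the arc.\<close>

lemma speed_bounds:
  assumes t: "t \<in> {-\<tau>..\<tau>}"
  shows "norm (snd (Z t) - t *\<^sub>R a) \<le> norm a * \<tau> / 32"
    "g c (fst (Z t)) (snd (Z t)) (snd (Z t)) \<le> 4 * N * (norm a)\<^sup>2 * \<tau>\<^sup>2"
    "0 \<le> k \<Longrightarrow> k * \<tau> + \<tau> / 32 \<le> \<bar>t\<bar> \<Longrightarrow> m * (k * norm a * \<tau>)\<^sup>2 \<le> g c (fst (Z t)) (snd (Z t)) (snd (Z t))"
proof -
  have a\<tau>: "0 \<le> norm a * \<tau>" using \<tau> by simp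
  have "norm (snd (Z t) - t *\<^sub>R a) \<le> 2 * \<kappa> * norm a * \<tau>"
    unfolding Z_def using t \<tau> by (intro velocity_estimate[OF start']) auto
  also have "\<dots> \<le> norm a * \<tau> / 32" using mult_right_mono[OF \<kappa>(2) a\<tau>] by simp
  finally show n: "norm (snd (Z t) - t *\<^sub>R a) \<le> norm a * \<tau> / 32" .
  have x: "fst (Z t) \<in> cball y0 r" using along(5)[of t] t \<tau> by auto
  have "norm (t *\<^sub>R a) \<le> norm a * \<tau>" using t by (simp add: mult.commute[of "norm a"] mult_right_mono abs_le_iff)
  then have u: "norm (snd (Z t)) \<le> 2 * (norm a * \<tau>)"
    using n norm_triangle_ineq[of "snd (Z t) - t *\<^sub>R a" "t *\<^sub>R a"] a\<tau> by simp
  have "g c (fst (Z t)) (snd (Z t)) (snd (Z t)) \<le> N * (norm (snd (Z t)) * norm (snd (Z t)))"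
    using metric_upper[OF x] by (simp add: abs_le_iff)
  also have "\<dots> \<le> N * ((2 * (norm a * \<tau>)) * (2 * (norm a * \<tau>)))"
    using u m m_le_N a\<tau> by (intro mult_left_mono mult_mono) auto
  finally show "g c (fst (Z t)) (snd (Z t)) (snd (Z t)) \<le> 4 * N * (norm a)\<^sup>2 * \<tau>\<^sup>2"
    by (simp add: power2_eq_square mult.assoc mult.left_commute)
  assume k: "0 \<le> k" "k * \<tau> + \<tau> / 32 \<le> \<bar>t\<bar>"
  have "norm a * (k * \<tau> + \<tau> / 32) \<le> norm (t *\<^sub>R a)"
    using mult_left_mono[OF k(2), of "norm a"] by (simp add: mult.commute)
  then have "k * norm a * \<tau> \<le> norm (snd (Z t))"
    using n norm_triangle_ineq2[of "t *\<^sub>R a" "snd (Z t)"] by (simp add: algebra_simps norm_minus_commute)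
  then have "(k * norm a * \<tau>)\<^sup>2 \<le> (norm (snd (Z t)))\<^sup>2" using k \<tau> by (intro power_mono) auto
  then have "m * (k * norm a * \<tau>)\<^sup>2 \<le> m * (norm (snd (Z t)))\<^sup>2" using m by (intro mult_left_mono) auto
  also have "\<dots> \<le> g c (fst (Z t)) (snd (Z t)) (snd (Z t))" by (rule metric_lower[OF x])
  finally show "m * (k * norm a * \<tau>)\<^sup>2 \<le> g c (fst (Z t)) (snd (Z t)) (snd (Z t))" .
qed

lemma jm_speed:
  "t \<in> {-T<..<T} \<Longrightarrow> sqrt (speed_sq A (jm_metric g V E) \<gamma> (t0 + t)) = g c (fst (Z t)) (snd (Z t)) (snd (Z t))"
  using jm_geodesic_in_hill(2)[OF geodesic along(1)] along(6) by simp

text \<open>Besides conjugacy, the two points have to be shown distinct on the manifold, since the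
  arc nearly retraces itself.\<close>

lemma contains_conjugate_points:
  assumes \<eta>: "8 * N * (norm a)\<^sup>2 * \<tau>^3 < \<eta>"
    and U: "\<And>x. x \<in> ball y0 r \<Longrightarrow> cinv c x \<in> hill_region V E \<Longrightarrow> cinv c x \<in> U"
  shows "\<exists>t1\<in>I. \<exists>t2\<in>I. \<gamma> t1 \<noteq> \<gamma> t2 \<and> conjugate_along A g V E \<gamma> t1 t2 \<and>
    \<gamma> ` {t1..t2} \<subseteq> U \<and> jm_length A g V E \<gamma> t1 t2 < ennreal \<eta>"
proof -
  let ?z1 = "Z (-\<tau>)"
  have \<tau>T: "-\<tau> \<in> {-T..T}" "-\<tau> \<in> {-T<..<T}" using \<tau> by auto
  have \<tau>\<tau>: "-\<tau> \<in> {-\<tau>..\<tau>}" using \<tau> by auto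
  have z1: "?z1 \<in> ball (y0, 0) (r/2)"
  proof -
    have "norm (?z1 - state \<gamma> t0) \<le> M * \<bar>-\<tau>\<bar>"
      unfolding Z_def by (rule flow_start_near[OF start'(1) \<tau>T(1)])
    then have "dist (state \<gamma> t0) ?z1 \<le> r/8" using \<tau> by (simp add: dist_norm norm_minus_commute)
    then have "dist (y0, 0) ?z1 \<le> r/4 + r/8"
      using start(1) dist_triangle[of "(y0, 0)" ?z1 "state \<gamma> t0"] unfolding mem_cball by linarith
    then show ?thesis using r by (simp only: mem_ball)
  qed
  then have z1c: "?z1 \<in> cball (y0, 0) (r/2)" by (simp only: mem_ball mem_cball less_imp_le)
  obtain W where W: "W 0 = id_blinfun"
    "\<And>h t. t \<in> {-T..T} \<Longrightarrow>
      ((\<lambda>t. blinfun_apply (W t) h) has_vector_derivative F' (flow ?z1 t) (W t h)) (at t within {-T..T})"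
    "\<And>h t. t \<in> {-T..T} \<Longrightarrow> norm (W t h) \<le> 2 * norm h"
    "continuous_on {-T..T} W"
    "\<And>e. e > 0 \<Longrightarrow> \<exists>d>0. \<forall>y\<in>cball (y0, 0) (r/2). norm (y - ?z1) < d \<longrightarrow>
      (\<forall>t\<in>{-T..T}. norm (flow y t - flow ?z1 t - W t (y - ?z1)) \<le> e * norm (y - ?z1))"
    using flow_linearization[OF z1c] by blast
  have Zm: "?z1 = flow (state \<gamma> t0) (-\<tau>)" by (simp add: Z_def)
  have transverse: "\<And>s h. s \<in> {0<..2 * \<tau>} \<Longrightarrow> fst (W s (0, h)) = 0 \<Longrightarrow> h = 0"
    "\<exists>s\<in>{\<tau>/2..3*\<tau>/2}. \<exists>w. fst (W s (0, w)) = snd (flow ?z1 s) \<and> g c (fst ?z1) (snd ?z1) w = 0"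
    using final_velocity_transverse[OF start' \<tau>(1,2,4) Zm z1c W(1-4)] by blast+
  obtain s w where s: "s \<in> {\<tau>/2..3*\<tau>/2}" and w: "fst (W s (0, w)) = snd (flow ?z1 s)"
    "g c (fst ?z1) (snd ?z1) w = 0"
    using transverse(2) by blast
  have s': "s \<in> {0<..2*\<tau>}" "s - \<tau> \<in> {-\<tau>..\<tau>}" "s - \<tau> \<in> {-T<..<T}" "s \<in> {0<..<T}" using s \<tau> by auto
  let ?t1 = "t0 + - \<tau>" and ?t2 = "t0 + (s - \<tau>)"
  have t12: "?t1 + s = ?t2" by simp
  have gpos: "0 < g c (fst ?z1) (snd ?z1) (snd ?z1)"
  proof -
    have "m * (1/2 * norm a * \<tau>)\<^sup>2 \<le> g c (fst ?z1) (snd ?z1) (snd ?z1)"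
      using \<tau> by (intro speed_bounds(3)[OF \<tau>\<tau>]) auto
    moreover have "0 < m * (1/2 * norm a * \<tau>)\<^sup>2" using m a \<tau> by simp
    ultimately show ?thesis by linarith
  qed
  have "fst ?z1 \<in> cimage c" using along(5)[OF \<tau>T(2)] by (intro subsetD[OF cball_in]) auto
  from bilinear_lzero[OF metric_bilinear[OF c this], of 0] have v1: "snd ?z1 \<noteq> 0"
    using gpos by (metis less_irrefl)
  have conj: "conjugate_along A g V E \<gamma> ?t1 (?t1 + s)"
  proof (rule conjugate_alongI[OF solution along(1)[OF \<tau>T(2)] _ s'(4) along(4)[OF \<tau>T(2)]])
    show "?t1 + s \<in> I" unfolding t12 by (rule along(1)[OF s'(3)])
    show "state \<gamma> ?t1 = (fst ?z1, snd ?z1)" using along(3)[OF \<tau>T(2)] by simp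
    show "g c (fst ?z1) (snd ?z1) (snd ?z1) = jm_factor V E (\<gamma> ?t1)" using along(6)[OF \<tau>T(2)] by simp
    show "h = 0" if "fst (W s (0, h)) = 0" for h using transverse(1)[OF s'(1) that] .
  qed (use z1 v1 W(4,5) w in simp_all)
  \<comment> \<open>As \<open>s\<close> lies in \<open>{\<tau>/2..3*\<tau>/2}\<close>, the parabola
    moves by at least \<open>3/8 * \<tau>\<^sup>2 * norm a\<close> between the two moments, while
    the error is at most \<open>4 * \<kappa> * \<tau>\<^sup>2 * norm a\<close>, with
    \<open>4 * \<kappa> \<le> 1/16\<close>.\<close>
  have ne: "\<gamma> ?t1 \<noteq> \<gamma> ?t2"
  proof
    assume "\<gamma> ?t1 = \<gamma> ?t2"
    then have "coord c (\<gamma> ?t1) = coord c (\<gamma> ?t2)" by simp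
    then have "fst ?z1 = fst (Z (s - \<tau>))"
      using along(3)[OF \<tau>T(2)] along(3)[OF s'(3)] by (metis fst_conv state_def)
    then have "norm ((((s - \<tau>)\<^sup>2 - (-\<tau>)\<^sup>2) / 2) *\<^sub>R a) \<le> 4 * \<kappa> * norm a * \<tau>\<^sup>2"
      using position_estimate[OF start' \<tau>(1) _ s'(2) \<tau>\<tau>] \<tau> by (simp add: Z_def)
    then have "\<bar>(s - \<tau>)\<^sup>2 - \<tau>\<^sup>2\<bar> / 2 * norm a \<le> 4 * \<kappa> * \<tau>\<^sup>2 * norm a" by (simp add: mult.commute mult.left_commute)
    then have "\<bar>(s - \<tau>)\<^sup>2 - \<tau>\<^sup>2\<bar> / 2 \<le> 4 * \<kappa> * \<tau>\<^sup>2" using a by simp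
    moreover have "(s - \<tau>)\<^sup>2 \<le> (\<tau>/2)\<^sup>2"
      using s by (intro abs_le_square_iff[THEN iffD1]) (auto simp: abs_if)
    moreover have "\<kappa> * \<tau>\<^sup>2 \<le> 1/64 * \<tau>\<^sup>2" using \<kappa> by (intro mult_right_mono) auto
    moreover have "\<tau>\<^sup>2 > 0" using \<tau> by simp
    ultimately show False by (simp add: power_divide abs_le_iff)
  qed
  have U': "\<gamma> ` {?t1..?t2} \<subseteq> U"
  proof clarify
    fix t assume t: "t \<in> {?t1..?t2}"
    have tT: "t - t0 \<in> {-T<..<T}" using t s \<tau> by auto
    have "\<gamma> (t0 + (t - t0)) \<in> U"
      unfolding along(2)[OF tT]
      using jm_geodesic_in_hill(1)[OF geodesic along(1)[OF tT]] along(2,5)[OF tT] by (intro U) auto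
    then show "\<gamma> t \<in> U" by simp
  qed
  have "jm_length A g V E \<gamma> ?t1 ?t2 \<le> ennreal (4 * N * (norm a)\<^sup>2 * \<tau>\<^sup>2 * (?t2 - ?t1))"
  proof (rule curve_length_le)
    fix t assume t: "t \<in> {?t1..?t2}"
    have tT: "t - t0 \<in> {-T<..<T}" "t - t0 \<in> {-\<tau>..\<tau>}" using t s \<tau> by auto
    show "sqrt (speed_sq A (jm_metric g V E) \<gamma> t) \<le> 4 * N * (norm a)\<^sup>2 * \<tau>\<^sup>2"
      using jm_speed[OF tT(1)] speed_bounds(2)[OF tT(2)] by simp
  qed (use s' m m_le_N in auto)
  also have "\<dots> < ennreal \<eta>"
  proof (rule ennreal_lessI)
    have "4 * N * (norm a)\<^sup>2 * \<tau>\<^sup>2 * (?t2 - ?t1) \<le> 4 * N * (norm a)\<^sup>2 * \<tau>\<^sup>2 * (2 * \<tau>)"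
      using s \<tau> m m_le_N by (intro mult_left_mono) auto
    also have "\<dots> = 8 * N * (norm a)\<^sup>2 * \<tau>^3" by (simp add: power2_eq_square power3_eq_cube)
    finally show "4 * N * (norm a)\<^sup>2 * \<tau>\<^sup>2 * (?t2 - ?t1) < \<eta>" using \<eta> by linarith
    have "0 \<le> 8 * N * (norm a)\<^sup>2 * \<tau>^3" using m m_le_N \<tau> by simp
    then show "0 < \<eta>" using \<eta> by linarith
  qed
  finally have "jm_length A g V E \<gamma> ?t1 ?t2 < ennreal \<eta>" .
  then show ?thesis
    using conj ne U' along(1)[OF \<tau>T(2)] along(1)[OF s'(3)] unfolding t12 by blast
qed

text \<open>The end points of the arc over \<open>[t\<^sub>0 - \<tau>, t\<^sub>0 + \<tau>]\<close> have distance \<open>O(\<kappa> \<tau>\<^sup>2)\<close>, and \<open>f = O(\<tau>\<^sup>2)\<close>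
  there: the chart segment between them has JM length \<open>O(\<kappa> \<tau>\<^sup>3)\<close>, the arc itself has length of order
  \<open>\<tau>\<^sup>3\<close>.\<close>

lemma not_minimizing: "fails_to_minimize A g V E I \<gamma>"
proof -
  let ?x = "fst (Z (-\<tau>))" and ?y = "fst (Z \<tau>)"
  let ?d = "?y - ?x"
  have \<tau>T: "-\<tau> \<in> {-T<..<T}" "\<tau> \<in> {-T<..<T}" using \<tau> by auto
  have \<tau>\<tau>: "-\<tau> \<in> {-\<tau>..\<tau>}" "\<tau> \<in> {-\<tau>..\<tau>}" using \<tau> by auto
  \<comment> \<open>Bound for the JM speed of the segment:
    \<open>f \<le> 5 * N * (norm a)\<^sup>2 * \<tau>\<^sup>2\<close> and a squared metric length of
    at most \<open>16 * N * \<kappa>\<^sup>2 * (norm a)\<^sup>2 * \<tau>^4\<close> multiply to 80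
    times a square, and \<open>80 \<le> 9\<^sup>2\<close>.\<close>
  define B where "B = 9 * N * \<kappa> * (norm a)\<^sup>2 * \<tau>^3"
  have N: "0 < N" using m m_le_N by simp
  have B0: "0 \<le> B" using N \<kappa> \<tau> by (simp add: B_def)
  have d: "norm ?d \<le> 4 * \<kappa> * norm a * \<tau>\<^sup>2"
    using position_estimate[OF start' \<tau>(1) _ \<tau>\<tau>(2,1)] \<tau> by (simp add: Z_def)
  have xy: "?x \<in> ball y0 r" "?y \<in> ball y0 r" using along(5) \<tau>T by auto
  define \<delta> where "\<delta> = (\<lambda>s. cinv c (?x + s *\<^sub>R ?d))"
  note seg = chart_segment[OF c open_ball convex_ball order_trans[OF ball_subset_cball cball_in] xy, folded \<delta>_def]
  have fx: "m * (1/2 * norm a * \<tau>)\<^sup>2 \<le> jm_factor V E (cinv c ?x)"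
    "jm_factor V E (cinv c ?x) \<le> 4 * N * (norm a)\<^sup>2 * \<tau>\<^sup>2"
    using speed_bounds(2)[OF \<tau>\<tau>(1)] speed_bounds(3)[OF \<tau>\<tau>(1), of "1/2"] along(2,6)[OF \<tau>T(1)] \<tau> by auto
  \<comment> \<open>The Hill region need not be convex in the chart. The segment stays in it because
    \<open>f\<close> is at least \<open>m * (1/2 * norm a * \<tau>)\<^sup>2\<close> at
    \<open>?x\<close> and, by the choice of \<open>\<kappa>\<close> relative to \<open>C\<close>,
    varies by no more than that along so short a segment.\<close>
  have f: "0 \<le> jm_factor V E (\<delta> s)" "jm_factor V E (\<delta> s) \<le> 5 * N * (norm a)\<^sup>2 * \<tau>\<^sup>2" if s: "s \<in> {0..1}" for s
  proof -
    have "\<bar>jm_factor V E (\<delta> s) - jm_factor V E (cinv c ?x)\<bar> \<le> C * norm (s *\<^sub>R ?d)"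
      using factor_lipschitz[of "?x + s *\<^sub>R ?d" ?x] seg(2)[OF s] xy(1) by (simp add: \<delta>_def)
    also have "\<dots> \<le> C * (4 * \<kappa> * norm a * \<tau>\<^sup>2)"
    proof (rule mult_left_mono[OF _ C])
      have "norm (s *\<^sub>R ?d) \<le> 1 * norm ?d" using s by (simp add: mult_left_le_one_le)
      then show "norm (s *\<^sub>R ?d) \<le> 4 * \<kappa> * norm a * \<tau>\<^sup>2" using d by linarith
    qed
    also have "\<dots> = (16 * C * \<kappa>) * (norm a * \<tau>\<^sup>2 / 4)" by simp
    also have "\<dots> \<le> (m * norm a) * (norm a * \<tau>\<^sup>2 / 4)" using \<kappa>(4) by (rule mult_right_mono) simp
    also have "\<dots> = m * (1/2 * norm a * \<tau>)\<^sup>2" by (simp add: power2_eq_square)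
    finally have e: "\<bar>jm_factor V E (\<delta> s) - jm_factor V E (cinv c ?x)\<bar> \<le> m * (1/2 * norm a * \<tau>)\<^sup>2" .
    then show "0 \<le> jm_factor V E (\<delta> s)" using fx(1) by linarith
    have "m * (1/2 * norm a * \<tau>)\<^sup>2 \<le> N * (norm a * \<tau>)\<^sup>2"
      using m m_le_N \<tau> by (intro mult_mono power_mono) auto
    then show "jm_factor V E (\<delta> s) \<le> 5 * N * (norm a)\<^sup>2 * \<tau>\<^sup>2"
      using e fx(2) by (simp add: power_mult_distrib)
  qed
  have speed: "sqrt (speed_sq A (jm_metric g V E) \<delta> s) \<le> B" if s: "s \<in> {0..1}" for s
  proof (rule real_le_lsqrt)
    have xs: "?x + s *\<^sub>R ?d \<in> cball y0 r" using seg(2)[OF s] by auto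
    have "g c (?x + s *\<^sub>R ?d) ?d ?d \<le> N * (norm ?d * norm ?d)"
      using metric_upper[OF xs] by (simp add: abs_le_iff)
    also have "\<dots> \<le> N * ((4 * \<kappa> * norm a * \<tau>\<^sup>2) * (4 * \<kappa> * norm a * \<tau>\<^sup>2))"
      using d N \<kappa> by (intro mult_left_mono mult_mono) auto
    finally have gd: "g c (?x + s *\<^sub>R ?d) ?d ?d \<le> N * ((4 * \<kappa> * norm a * \<tau>\<^sup>2) * (4 * \<kappa> * norm a * \<tau>\<^sup>2))" .
    have "speed_sq A (jm_metric g V E) \<delta> s = jm_factor V E (\<delta> s) * g c (?x + s *\<^sub>R ?d) ?d ?d"
      using seg(3)[OF s] by (simp add: speed_sq_jm)
    also have "\<dots> \<le> (5 * N * (norm a)\<^sup>2 * \<tau>\<^sup>2) * (N * ((4 * \<kappa> * norm a * \<tau>\<^sup>2) * (4 * \<kappa> * norm a * \<tau>\<^sup>2)))"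
      using f[OF s] gd N cball_in xs by (intro mult_mono metric_nonneg[OF c]) auto
    also have "\<dots> = 80 * (N * \<kappa> * (norm a)\<^sup>2 * \<tau>^3)\<^sup>2"
      by (simp add: power2_eq_square power3_eq_cube)
    also have "\<dots> \<le> 81 * (N * \<kappa> * (norm a)\<^sup>2 * \<tau>^3)\<^sup>2" by (rule mult_right_mono) auto
    also have "\<dots> = B\<^sup>2" by (simp add: B_def power2_eq_square)
    finally show "speed_sq A (jm_metric g V E) \<delta> s \<le> B\<^sup>2" .
  qed (rule B0)
  have ends: "\<delta> 0 = \<gamma> (t0 + - \<tau>)" "\<delta> 1 = \<gamma> (t0 + \<tau>)"
    using along(2)[OF \<tau>T(1)] along(2)[OF \<tau>T(2)] by (simp_all add: \<delta>_def)
  have "jm_dist A g V E (\<gamma> (t0 + - \<tau>)) (\<gamma> (t0 + \<tau>)) \<le> jm_length A g V E \<delta> 0 1"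
    unfolding jm_dist_def
  proof (rule INF_lower)
    have "\<delta> ` {0..1} \<subseteq> hill_region V E" using f(1) by (auto simp: hill_region_def)
    then show "\<delta> \<in> {\<delta>. piecewise_C1_curve A \<delta> \<and> \<delta> ` {0..1} \<subseteq> hill_region V E \<and>
        \<delta> 0 = \<gamma> (t0 + - \<tau>) \<and> \<delta> 1 = \<gamma> (t0 + \<tau>)}"
      using seg(1) ends by simp
  qed
  also have "\<dots> \<le> ennreal (B * (1 - 0))" by (rule curve_length_le) (use speed B0 in auto)
  \<comment> \<open>Only the part of the arc over \<open>{t0 + \<tau>/2..t0 + \<tau>}\<close> is
    counted; it has length at least \<open>m * (norm a)\<^sup>2 * \<tau>^3 / 32\<close>, and the
    constant 288 is \<open>9 * 32\<close>.\<close>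
  also have "\<dots> < ennreal (m * (1/4 * norm a * \<tau>)\<^sup>2 * ((t0 + \<tau>) - (t0 + \<tau>/2)))"
  proof (rule ennreal_lessI)
    have k: "0 < (norm a)\<^sup>2 * \<tau>^3 / 32" using a \<tau> by simp
    have "B * (1 - 0) = (288 * N * \<kappa>) * ((norm a)\<^sup>2 * \<tau>^3 / 32)" by (simp add: B_def)
    also have "\<dots> < m * ((norm a)\<^sup>2 * \<tau>^3 / 32)" using \<kappa>(3) k by (rule mult_strict_right_mono)
    also have "\<dots> = m * (1/4 * norm a * \<tau>)\<^sup>2 * ((t0 + \<tau>) - (t0 + \<tau>/2))"
      by (simp add: power2_eq_square power3_eq_cube)
    finally show lt: "B * (1 - 0) < m * (1/4 * norm a * \<tau>)\<^sup>2 * ((t0 + \<tau>) - (t0 + \<tau>/2))" .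
    show "0 < m * (1/4 * norm a * \<tau>)\<^sup>2 * ((t0 + \<tau>) - (t0 + \<tau>/2))"
      using B0 by (intro le_less_trans[OF _ lt]) simp
  qed
  also have "\<dots> \<le> jm_length A g V E \<gamma> (t0 + - \<tau>) (t0 + \<tau>)"
  proof (rule curve_length_ge)
    fix t assume t: "t \<in> {t0 + \<tau>/2..t0 + \<tau>}"
    have tT: "t - t0 \<in> {-T<..<T}" "t - t0 \<in> {-\<tau>..\<tau>}" "1/4 * \<tau> + \<tau>/32 \<le> \<bar>t - t0\<bar>" using t \<tau> by auto
    show "m * (1/4 * norm a * \<tau>)\<^sup>2 \<le> sqrt (speed_sq A (jm_metric g V E) \<gamma> t)"
      using jm_speed[OF tT(1)] speed_bounds(3)[OF tT(2) _ tT(3)] by simp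
  qed (use \<tau> m in auto)
  finally have "jm_dist A g V E (\<gamma> (t0 + - \<tau>)) (\<gamma> (t0 + \<tau>)) < jm_length A g V E \<gamma> (t0 + - \<tau>) (t0 + \<tau>)" .
  moreover have "t0 + - \<tau> < t0 + \<tau>" using \<tau> by simp
  ultimately show ?thesis
    unfolding fails_to_minimize_def using along(1)[OF \<tau>T(1)] along(1)[OF \<tau>T(2)] by blast
qed

end

section \<open>Constants from compactness\<close>

text \<open>Derivatives are known to be continuous for each fixed direction, so they are bounded on
  basis vectors, and the sum of these bounds controls the operator norm.\<close>

lemma k_smooth_1_lipschitz_on_cball:
  fixes f :: "'a::euclidean_space \<Rightarrow> real"
  assumes f: "k_smooth_on (Suc 0) S f" and S: "cball x0 r \<subseteq> S"
  obtains C where "C \<ge> 0" "\<And>x y. x \<in> cball x0 r \<Longrightarrow> y \<in> cball x0 r \<Longrightarrow> \<bar>f x - f y\<bar> \<le> C * norm (x - y)"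
proof -
  let ?f' = "\<lambda>x. frechet_derivative f (at x)"
  have "\<exists>B\<ge>0. \<forall>x\<in>cball x0 r. \<bar>?f' x i\<bar> \<le> B" for i
  proof -
    have "continuous_on (cball x0 r) (\<lambda>x. ?f' x i)"
      by (rule continuous_on_subset[OF k_smooth_1D(2)[OF f] S])
    then have "bounded ((\<lambda>x. ?f' x i) ` cball x0 r)"
      by (intro compact_imp_bounded compact_continuous_image) auto
    then obtain b where "b > 0" "\<forall>y\<in>(\<lambda>x. ?f' x i) ` cball x0 r. norm y \<le> b" unfolding bounded_pos by blast
    then show ?thesis by (intro exI[of _ b]) auto
  qed
  then obtain B where B: "\<And>i. B i \<ge> 0" "\<And>i x. x \<in> cball x0 r \<Longrightarrow> \<bar>?f' x i\<bar> \<le> B i" by metis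
  let ?C = "\<Sum>i\<in>Basis. B i"
  have C: "?C \<ge> 0" using B(1) by (simp add: sum_nonneg)
  have df: "(f has_derivative ?f' x) (at x)" if "x \<in> cball x0 r" for x
    using k_smooth_1D(1)[OF f] that S by blast
  have "onorm (?f' x) \<le> ?C" if x: "x \<in> cball x0 r" for x
  proof (rule onorm_bound[OF C])
    fix u
    have l: "linear (?f' x)" by (rule has_derivative_linear[OF df[OF x]])
    have "?f' x u = ?f' x (\<Sum>i\<in>Basis. (u \<bullet> i) *\<^sub>R i)" by (simp add: euclidean_representation)
    also have "\<dots> = (\<Sum>i\<in>Basis. (u \<bullet> i) * ?f' x i)"
      using linear_sum[OF l, of "\<lambda>i. (u \<bullet> i) *\<^sub>R i" Basis] linear_cmul[OF l] by simp
    also have "norm \<dots> \<le> (\<Sum>i\<in>Basis. norm u * B i)"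
      by (intro sum_norm_le) (auto simp: abs_mult Basis_le_norm intro!: mult_mono B(2) x)
    finally show "norm (?f' x u) \<le> ?C * norm u" by (simp add: sum_distrib_left mult.commute)
  qed
  then have "\<bar>f x - f y\<bar> \<le> ?C * norm (x - y)" if "x \<in> cball x0 r" "y \<in> cball x0 r" for x y
    using differentiable_bound[of "cball x0 r" f ?f' ?C x y] that df has_derivative_at_withinI by force
  then show ?thesis using C that by blast
qed

context riemannian
begin

lemma metric_bounds:
  assumes c: "c \<in> A" and K: "compact K" "K \<noteq> {}" "K \<subseteq> cimage c"
  obtains m N where "m > 0" "N > 0" "\<And>x u. x \<in> K \<Longrightarrow> m * (norm u)\<^sup>2 \<le> g c x u u"
    "\<And>x u w. x \<in> K \<Longrightarrow> \<bar>g c x u w\<bar> \<le> N * (norm u * norm w)"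
proof -
  let ?S = "sphere 0 1 :: 'a set"
  have bil: "bilinear (g c x)" if "x \<in> K" for x using metric_bilinear[OF c] that K by blast
  have cg: "continuous_on (K \<times> (?S \<times> ?S)) (\<lambda>p. g c (fst p) (fst (snd p)) (snd (snd p)))"
  proof (rule continuous_on_eq)
    have "continuous_on K (\<lambda>x. g c x i j)" for i j
      by (rule continuous_on_subset[OF k_smooth_1_continuous_on[OF smooth_onD[OF metric_smooth[OF c]]] K(3)])
    then have "continuous_on (K \<times> (?S \<times> ?S)) (\<lambda>p. g c (fst p) i j)" for i j
      by (rule continuous_on_compose2[OF _ continuous_on_fst[OF continuous_on_id]]) auto
    then show "continuous_on (K \<times> (?S \<times> ?S)) (\<lambda>p. \<Sum>i\<in>Basis. \<Sum>j\<in>Basis.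
        (fst (snd p) \<bullet> i) * (snd (snd p) \<bullet> j) * g c (fst p) i j)"
      by (intro continuous_intros)
    show "(\<Sum>i\<in>Basis. \<Sum>j\<in>Basis. (fst (snd p) \<bullet> i) * (snd (snd p) \<bullet> j) * g c (fst p) i j)
        = g c (fst p) (fst (snd p)) (snd (snd p))" if "p \<in> K \<times> (?S \<times> ?S)" for p
      using bil that by (auto intro: bilinear_expand[symmetric])
  qed
  have "bounded ((\<lambda>p. g c (fst p) (fst (snd p)) (snd (snd p))) ` (K \<times> (?S \<times> ?S)))"
    by (intro compact_imp_bounded compact_continuous_image cg compact_Times K) auto
  then obtain N where N: "N > 0" "\<And>x u w. x \<in> K \<Longrightarrow> norm u = 1 \<Longrightarrow> norm w = 1 \<Longrightarrow> \<bar>g c x u w\<bar> \<le> N"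
    unfolding bounded_pos by fastforce
  have cd: "continuous_on (K \<times> ?S) (\<lambda>p. g c (fst p) (snd p) (snd p))"
  proof -
    have "continuous_on (K \<times> ?S) (\<lambda>p. (fst p, (snd p, snd p)))" by (intro continuous_intros)
    moreover have "(\<lambda>p. (fst p, (snd p, snd p))) ` (K \<times> ?S) \<subseteq> K \<times> (?S \<times> ?S)" by auto
    ultimately show ?thesis using continuous_on_compose2[OF cg] by fastforce
  qed
  obtain b :: 'a where "b \<in> ?S" using vector_choose_size[of 1] by (auto simp: sphere_def dist_norm)
  then have "K \<times> ?S \<noteq> {}" using K by blast
  from continuous_attains_inf[OF compact_Times[OF K(1) compact_sphere] this cd]
  obtain p where p: "p \<in> K \<times> ?S" "\<And>q. q \<in> K \<times> ?S \<Longrightarrow> g c (fst p) (snd p) (snd p) \<le> g c (fst q) (snd q) (snd q)"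
    by blast
  define m where "m = g c (fst p) (snd p) (snd p)"
  have m: "m > 0" unfolding m_def using p(1) K(3) by (intro metric_pos[OF c]) auto
  show ?thesis
  proof (rule that[OF m N(1)])
    fix x u assume x: "x \<in> K"
    show "m * (norm u)\<^sup>2 \<le> g c x u u"
    proof (cases "u = 0")
      case True
      then show ?thesis using bilinear_lzero[OF bil[OF x]] by simp
    next
      case False
      define e where "e = u /\<^sub>R norm u"
      have e: "u = norm u *\<^sub>R e" "norm e = 1" using False by (simp_all add: e_def)
      have "m \<le> g c x e e" using p(2)[of "(x, e)"] x e(2) by (simp add: m_def)
      then have "m * (norm u)\<^sup>2 \<le> g c x e e * (norm u)\<^sup>2" by (rule mult_right_mono) simp
      also have "\<dots> = g c x u u"
        by (subst (2 3) e(1)) (simp add: bilinear_lmul[OF bil[OF x]] bilinear_rmul[OF bil[OF x]] power2_eq_square)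
      finally show ?thesis .
    qed
  next
    fix x u w assume x: "x \<in> K"
    show "\<bar>g c x u w\<bar> \<le> N * (norm u * norm w)"
    proof (cases "u = 0 \<or> w = 0")
      case True
      then show ?thesis using bilinear_lzero[OF bil[OF x]] bilinear_rzero[OF bil[OF x]] by auto
    next
      case False
      define e f where "e = u /\<^sub>R norm u" and "f = w /\<^sub>R norm w"
      have e: "u = norm u *\<^sub>R e" "norm e = 1" "w = norm w *\<^sub>R f" "norm f = 1"
        using False by (simp_all add: e_def f_def)
      have "g c x u w = norm u * (norm w * g c x e f)"
        by (subst e(1), subst e(3)) (simp add: bilinear_lmul[OF bil[OF x]] bilinear_rmul[OF bil[OF x]])
      then have "\<bar>g c x u w\<bar> = (norm u * norm w) * \<bar>g c x e f\<bar>" by (simp add: abs_mult)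
      also have "\<dots> \<le> (norm u * norm w) * N" using N(2)[OF x e(2,4)] by (intro mult_left_mono) auto
      finally show ?thesis by (simp add: mult.commute)
    qed
  qed
qed

end

context mechanics
begin

lemma jm_factor_in_chart:
  assumes "c \<in> A"
  shows "k_smooth_on (Suc 0) (cimage c) (\<lambda>x. jm_factor V E (cinv c x))"
    "\<And>x. x \<in> cimage c \<Longrightarrow> ((\<lambda>x. jm_factor V E (cinv c x)) has_derivative
      (\<lambda>u. - 2 * frechet_derivative (V \<circ> cinv c) (at x) u)) (at x)"
proof -
  have sV: "smooth_on (cimage c) (V \<circ> cinv c)" using V assms by (auto simp: smooth_scalar_def)
  show d: "((\<lambda>x. jm_factor V E (cinv c x)) has_derivative
      (\<lambda>u. - 2 * frechet_derivative (V \<circ> cinv c) (at x) u)) (at x)" if "x \<in> cimage c" for x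
    unfolding jm_factor_def
    using smooth_on_has_derivative[OF sV that] unfolding o_def by (auto intro!: derivative_eq_intros)
  show "k_smooth_on (Suc 0) (cimage c) (\<lambda>x. jm_factor V E (cinv c x))"
    by (rule k_smooth_1I[OF d]) (auto intro!: continuous_intros k_smooth_1D(2)[OF smooth_onD[OF sV]])
qed

text \<open>At zero velocity the Christoffel term vanishes and the force is the negative gradient of
  \<open>V\<close>, which is nonzero because \<open>df = - 2 dV\<close> is.\<close>

lemma force_at_regular_point:
  assumes c: "c \<in> A" "q \<in> cdom c" and u: "differential c (jm_factor V E) q u \<noteq> 0"
  shows "force c (coord c q) 0 \<noteq> 0"
proof
  have x: "coord c q \<in> cimage c" using c by simp
  assume "force c (coord c q) 0 = 0"
  then have "frechet_derivative (V \<circ> cinv c) (at (coord c q)) u = 0"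
    using force_char[OF c(1) x, of 0 u] bilinear_lzero[OF metric_bilinear[OF c(1) x]]
      bilinear_lzero[OF Dg_bilinear[OF c(1) x]] by simp
  moreover have "differential c (jm_factor V E) q u = - 2 * frechet_derivative (V \<circ> cinv c) (at (coord c q)) u"
    unfolding differential_def using frechet_derivative_at[OF jm_factor_in_chart(2)[OF c(1) x, of E]]
    by (simp add: o_def fun_eq_iff)
  ultimately show False using u by simp
qed

section \<open>Choice of the neighborhood\<close>

text \<open>The order of choice matters: \<open>\<kappa>\<close> depends on the metric bounds and
  the Lipschitz constant on a fixed ball, which survive its shrinking to the radius \<open>r\<close>
  on which the force is close to \<open>a\<close>; only then come \<open>M\<close>, \<open>L\<close>
  and \<open>T\<close>, next \<open>\<tau>\<close>, and last \<open>\<rho>\<close>. No constant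
  depends on the geodesic.\<close>

lemma jm_geodesic_conjugate_near_boundary:
  assumes q0: "regular_hill_boundary_point A V E q0" and U: "hill_nhd V E q0 U" and \<eta>: "\<eta> > 0"
  shows "\<exists>U'\<subseteq>U. hill_nhd V E q0 U' \<and>
      (\<forall>I \<gamma>. jm_geodesic A g V E I \<gamma> \<and> \<gamma> ` I \<inter> U' \<noteq> {} \<longrightarrow>
         (\<exists>t1\<in>I. \<exists>t2\<in>I. \<gamma> t1 \<noteq> \<gamma> t2 \<and> conjugate_along A g V E \<gamma> t1 t2 \<and>
            \<gamma> ` {t1..t2} \<subseteq> U \<and> jm_length A g V E \<gamma> t1 t2 < ennreal \<eta>) \<and>
         fails_to_minimize A g V E I \<gamma>)"
proof -
  let ?f = "jm_factor V E"
  obtain c u where c0: "c \<in> A" "q0 \<in> cdom c" and u: "differential c ?f q0 u \<noteq> 0" and f0: "?f q0 = 0"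
    using q0 unfolding regular_hill_boundary_point_def by blast
  define y0 where "y0 = coord c q0"
  have y0: "y0 \<in> cimage c" "cinv c y0 = q0" unfolding y0_def using c0 chartD(3)[OF c0] by auto
  define a where "a = force c y0 0"
  have a: "a \<noteq> 0" unfolding a_def y0_def by (rule force_at_regular_point[OF c0 u])
  have na: "norm a > 0" using a by simp
  obtain r0 where r0: "r0 > 0" "cball y0 r0 \<subseteq> cimage c"
    using chartD(2)[OF c0(1)] y0(1) by (meson open_contains_cball)
  have ne: "cball y0 r0 \<noteq> {}" using r0 by simp
  obtain m N where m: "m > 0" and N: "N > 0"
    and lower: "\<And>x u. x \<in> cball y0 r0 \<Longrightarrow> m * (norm u)\<^sup>2 \<le> g c x u u"
    and upper: "\<And>x u w. x \<in> cball y0 r0 \<Longrightarrow> \<bar>g c x u w\<bar> \<le> N * (norm u * norm w)"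
    using metric_bounds[OF c0(1) compact_cball ne r0(2)] by blast
  obtain C where C: "C \<ge> 0" and lip: "\<And>x y. x \<in> cball y0 r0 \<Longrightarrow> y \<in> cball y0 r0 \<Longrightarrow>
      \<bar>?f (cinv c x) - ?f (cinv c y)\<bar> \<le> C * norm (x - y)"
    using k_smooth_1_lipschitz_on_cball[OF jm_factor_in_chart(1)[OF c0(1)] r0(2)] by blast
  \<comment> \<open>300 instead of 288 leaves room for the strict inequality, and
    \<open>C + 1\<close> instead of \<open>C\<close> avoids a zero denominator.\<close>
  define \<kappa> where "\<kappa> = Min {1/64, m / (300 * N), m * norm a / (16 * (C + 1))}"
  have \<kappa>_le: "\<kappa> \<le> 1/64" "\<kappa> \<le> m / (300 * N)" "\<kappa> \<le> m * norm a / (16 * (C + 1))"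
    unfolding \<kappa>_def by (rule Min_le; simp)+
  have \<kappa>0: "0 < \<kappa>" unfolding \<kappa>_def using m N C na by (simp add: add_nonneg_pos)
  have "300 * N * \<kappa> \<le> m" using \<kappa>_le(2) N by (simp add: pos_le_divide_eq mult.commute)
  then have \<kappa>N: "288 * N * \<kappa> < m" using mult_pos_pos[OF N \<kappa>0] by linarith
  have "\<kappa> * (16 * (C + 1)) \<le> m * norm a"
    using \<kappa>_le(3) C by (simp add: pos_le_divide_eq)
  then have \<kappa>C: "16 * C * \<kappa> \<le> m * norm a" using \<kappa>0 by (simp add: algebra_simps)
  obtain W where W: "open W" "q0 \<in> W" "W \<inter> hill_region V E \<subseteq> U"
    using U unfolding hill_nhd_def by blast
  have "\<exists>r1>0. \<forall>z\<in>cball (y0, 0) r1. fst z \<in> cimage c \<and> cinv c (fst z) \<in> W \<and>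
      norm (force c (fst z) (snd z) - a) \<le> \<kappa> * norm a"
  proof -
    let ?D = "cimage c \<times> (UNIV :: 'a set)"
    have D: "open ?D" "(y0, 0) \<in> ?D" using chartD(2)[OF c0(1)] y0 by (auto intro: open_Times)
    have "isCont (\<lambda>(x, v). force c x v) (y0, 0)"
      using k_smooth_1_continuous_on[OF force_k_smooth_1[OF c0(1)]] D continuous_on_eq_continuous_at by blast
    then obtain N1 where N1: "open N1" "(y0, 0) \<in> N1"
      "\<And>z. z \<in> N1 \<Longrightarrow> (\<lambda>(x, v). force c x v) z \<in> ball a (\<kappa> * norm a)"
      using isCont_open_nhd[of "(y0, 0)" "\<lambda>(x, v). force c x v" "ball a (\<kappa> * norm a)"] \<kappa>0 na
      by (auto simp: a_def)
    have "isCont (cinv c) y0"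
      using chartD(7)[OF c0(1)] y0(1) continuous_on_eq_continuous_at[OF chartD(2)[OF c0(1)]] by blast
    then obtain N2 where N2: "open N2" "y0 \<in> N2" "\<And>x. x \<in> N2 \<Longrightarrow> cinv c x \<in> W"
      using isCont_open_nhd[of y0 "cinv c" W] W y0(2) by auto
    have "open (N1 \<inter> (N2 \<times> UNIV) \<inter> ?D)" "(y0, 0) \<in> N1 \<inter> (N2 \<times> UNIV) \<inter> ?D"
      using N1 N2 D by (auto intro!: open_Int open_Times)
    then obtain e where e: "e > 0" "cball (y0, 0) e \<subseteq> N1 \<inter> (N2 \<times> UNIV) \<inter> ?D"
      by (meson open_contains_cball)
    have "fst z \<in> cimage c \<and> cinv c (fst z) \<in> W \<and> norm (force c (fst z) (snd z) - a) \<le> \<kappa> * norm a"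
      if "z \<in> cball (y0, 0) e" for z
    proof -
      have z: "z \<in> N1" "fst z \<in> N2" "fst z \<in> cimage c" using subsetD[OF e(2) that] by auto
      then show ?thesis
        using N1(3)[OF z(1)] N2(3)[OF z(2)] by (simp add: case_prod_unfold dist_norm norm_minus_commute)
    qed
    then show ?thesis using e(1) by blast
  qed
  then obtain r1 where r1: "r1 > 0" "\<And>z. z \<in> cball (y0, 0) r1 \<Longrightarrow> fst z \<in> cimage c \<and> cinv c (fst z) \<in> W \<and>
      norm (force c (fst z) (snd z) - a) \<le> \<kappa> * norm a" by blast
  define r where "r = min r0 r1"
  have r2: "r > 0" "cball y0 r \<subseteq> cball y0 r0" "cball (y0, 0 :: 'a) r \<subseteq> cball (y0, 0) r1"
    using r0 r1 by (auto simp: r_def)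
  have near: "fst z \<in> cimage c" "cinv c (fst z) \<in> W" "norm (force c (fst z) (snd z) - a) \<le> \<kappa> * norm a"
    if "z \<in> cball (y0, 0) r" for z
    using r1(2)[OF subsetD[OF r2(3) that]] by blast+
  have ballD: "cball (y0, 0 :: 'a) r \<subseteq> cimage c \<times> UNIV"
    using near(1) by (intro subsetI) (simp only: mem_Times_iff UNIV_I simp_thms)
  have Wr: "cinv c x \<in> W" if "x \<in> cball y0 r" for x
  proof -
    have "(x, 0) \<in> cball (y0, 0 :: 'a) r" using that by (simp add: dist_Pair_Pair)
    from near(2)[OF this] show ?thesis by simp
  qed
  obtain F' M L T where flow: "C1_field (newton_field c) F' (y0, 0) r M L T"
    using k_smooth_1_imp_C1_field[OF newton_field_k_smooth_1[OF c0(1)] ballD r2(1)] by blast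
  interpret near_hill_boundary A g V c F' y0 r M L T E m N C \<kappa> a
  proof -
    interpret C1_field "newton_field c" F' "(y0, 0)" r M L T by (rule flow)
    show "near_hill_boundary A g V c F' y0 r M L T E m N C \<kappa> a"
    proof unfold_locales
      show "norm (force c x v - a) \<le> \<kappa> * norm a" if "(x, v) \<in> cball (y0, 0) r" for x v
        using near(3)[OF that] by simp
    qed (use c0 a m C \<kappa>0 \<kappa>_le \<kappa>N \<kappa>C lower upper lip r2(2) ballD in blast)+
  qed
  have LM: "0 \<le> L" "0 \<le> M" using L M_nonneg by auto
  \<comment> \<open>The entries serve in turn \<open>\<tau>^3 \<le> \<tau>\<close>,
    \<open>2 * \<tau> < T\<close>, \<open>M * \<tau> \<le> r/8\<close>,
    \<open>4 * L * \<tau> \<le> \<kappa>\<close>, the bound \<open>r/8\<close> on the velocity at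
    \<open>t0\<close>, and the bound \<open>\<eta>\<close> on the JM length.\<close>
  define \<tau> where "\<tau> = Min {1, T / 4, r / (8 * (M + 1)), \<kappa> / (4 * (L + 1)), r / (8 * (\<kappa> * norm a)),
    \<eta> / (16 * N * (norm a)\<^sup>2)}"
  have \<tau>0: "0 < \<tau>"
    unfolding \<tau>_def using T r2(1) LM \<kappa>0 na \<eta> N by (simp add: add_nonneg_pos)
  have \<tau>_le: "\<tau> \<le> 1" "\<tau> \<le> T / 4" "\<tau> \<le> r / (8 * (M + 1))" "\<tau> \<le> \<kappa> / (4 * (L + 1))"
    "\<tau> \<le> r / (8 * (\<kappa> * norm a))" "\<tau> \<le> \<eta> / (16 * N * (norm a)\<^sup>2)"
    unfolding \<tau>_def by (rule Min_le; simp)+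
  have \<tau>T: "2 * \<tau> < T" using \<tau>_le(2) T by linarith
  have "\<tau> * (8 * (M + 1)) \<le> r" using \<tau>_le(3) LM by (simp add: pos_le_divide_eq)
  then have \<tau>M: "M * \<tau> \<le> r/8" using \<tau>0 by (simp add: algebra_simps)
  have "\<tau> * (4 * (L + 1)) \<le> \<kappa>" using \<tau>_le(4) LM by (simp add: pos_le_divide_eq)
  then have \<tau>L: "4 * L * \<tau> \<le> \<kappa>" using \<tau>0 by (simp add: algebra_simps)
  have "\<tau> * (8 * (\<kappa> * norm a)) \<le> r" using \<tau>_le(5) \<kappa>0 na by (simp add: pos_le_divide_eq)
  then have \<tau>r: "\<kappa> * norm a * \<tau> \<le> r/8" by (simp add: algebra_simps)
  have \<tau>\<eta>: "8 * N * (norm a)\<^sup>2 * \<tau>^3 < \<eta>"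
  proof -
    have "\<tau> * (16 * N * (norm a)\<^sup>2) \<le> \<eta>" using \<tau>_le(6) N na by (simp add: pos_le_divide_eq)
    then have "2 * (8 * N * (norm a)\<^sup>2 * \<tau>) \<le> \<eta>" by (simp add: algebra_simps)
    moreover have "\<tau>^3 \<le> \<tau>^1" using \<tau>0 \<tau>_le(1) by (intro power_decreasing) auto
    then have "8 * N * (norm a)\<^sup>2 * \<tau>^3 \<le> 8 * N * (norm a)\<^sup>2 * \<tau>" using N by (intro mult_left_mono) auto
    ultimately show ?thesis using \<eta> by linarith
  qed
  \<comment> \<open>Closeness in position has to force a small velocity: by energy, and since
    \<open>f\<close> vanishes at \<open>q0\<close>,
    \<open>m * (norm ?v)\<^sup>2 \<le> f \<le> C * \<rho>\<close>; this \<open>\<rho>\<close> then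
    gives \<open>norm ?v \<le> \<kappa> * norm a * \<tau>\<close>.\<close>
  define \<rho> where "\<rho> = min (r/8) (m * (\<kappa> * norm a * \<tau>)\<^sup>2 / (C + 1))"
  have \<rho>: "0 < \<rho>" "\<rho> \<le> r/8" "C * \<rho> \<le> m * (\<kappa> * norm a * \<tau>)\<^sup>2"
  proof -
    show \<rho>0: "0 < \<rho>" unfolding \<rho>_def using r2(1) m \<kappa>0 na \<tau>0 C by (simp add: add_nonneg_pos)
    have "\<rho> \<le> m * (\<kappa> * norm a * \<tau>)\<^sup>2 / (C + 1)" unfolding \<rho>_def by simp
    then have "\<rho> * (C + 1) \<le> m * (\<kappa> * norm a * \<tau>)\<^sup>2" using C by (simp add: pos_le_divide_eq)
    then show "C * \<rho> \<le> m * (\<kappa> * norm a * \<tau>)\<^sup>2" using \<rho>0 by (simp add: algebra_simps)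
    show "\<rho> \<le> r/8" unfolding \<rho>_def by (rule min.cobounded1)
  qed
  define W' where "W' = cdom c \<inter> coord c -` ball y0 \<rho>"
  have W': "open W'" "q0 \<in> W'"
    using continuous_on_open_vimage[OF chartD(1)[OF c0(1)], of "coord c"] chartD(6)[OF c0(1)] c0(2) \<rho>(1)
    by (auto simp: W'_def y0_def Int_commute)
  define U' where "U' = W' \<inter> hill_region V E"
  have "W' \<subseteq> W"
  proof
    fix q assume q: "q \<in> W'"
    then have "coord c q \<in> cball y0 r" using \<rho> r2(1) by (auto simp: W'_def)
    from Wr[OF this] show "q \<in> W" using chartD(3)[OF c0(1), of q] q by (auto simp: W'_def)
  qed
  then have "U' \<subseteq> U" using W(3) by (auto simp: U'_def)
  moreover have "hill_nhd V E q0 U'" using W' by (auto simp: hill_nhd_def U'_def)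
  moreover have "(\<exists>t1\<in>I. \<exists>t2\<in>I. \<gamma> t1 \<noteq> \<gamma> t2 \<and> conjugate_along A g V E \<gamma> t1 t2 \<and>
            \<gamma> ` {t1..t2} \<subseteq> U \<and> jm_length A g V E \<gamma> t1 t2 < ennreal \<eta>) \<and>
         fails_to_minimize A g V E I \<gamma>"
    if geo: "jm_geodesic A g V E I \<gamma>" and meets: "\<gamma> ` I \<inter> U' \<noteq> {}" for I \<gamma>
  proof -
    obtain t0 where t0: "t0 \<in> I" "\<gamma> t0 \<in> U'" using meets by blast
    let ?x = "coord c (\<gamma> t0)" and ?v = "velocity c \<gamma> t0"
    have d: "\<gamma> t0 \<in> cdom c" and x: "dist y0 ?x < \<rho>" using t0(2) by (auto simp: U'_def W'_def)
    have xr: "?x \<in> cball y0 r" using x \<rho> r2(1) by auto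
    have "m * (norm ?v)\<^sup>2 \<le> g c ?x ?v ?v" by (rule metric_lower[OF xr])
    also have "\<dots> = ?f (\<gamma> t0)" using jm_geodesic_energy(2)[OF geo t0(1) c0(1) d] by simp
    also have "\<dots> \<le> \<bar>?f (cinv c ?x) - ?f (cinv c y0)\<bar>"
      using chartD(3)[OF c0(1) d] y0(2) f0 by simp
    also have "\<dots> \<le> C * norm (?x - y0)" using xr r2(1) by (intro factor_lipschitz) auto
    also have "\<dots> \<le> C * \<rho>" using x C by (intro mult_left_mono) (auto simp: dist_norm norm_minus_commute)
    also have "\<dots> \<le> m * (\<kappa> * norm a * \<tau>)\<^sup>2" by (rule \<rho>(3))
    finally have "(norm ?v)\<^sup>2 \<le> (\<kappa> * norm a * \<tau>)\<^sup>2" using m by simp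
    then have v: "norm ?v \<le> \<kappa> * norm a * \<tau>"
      by (rule power2_le_imp_le) (use \<kappa>0 \<tau>0 in simp)
    have "dist (y0, 0) (state \<gamma> t0) \<le> dist y0 ?x + norm ?v"
      unfolding state_def dist_Pair_Pair using sqrt_sum_squares_le_sum[of "dist y0 ?x" "norm ?v"] by simp
    then have s: "state \<gamma> t0 \<in> cball (y0, 0) (r/4)" using x v \<tau>r \<rho>(2) unfolding mem_cball by linarith
    interpret geodesic_near_boundary A g V c F' y0 r M L T E m N C \<kappa> a I \<gamma> t0 \<tau>
      by unfold_locales (rule geo t0(1) d s v \<tau>0 \<tau>T \<tau>M \<tau>L)+
    have "cinv c x \<in> U" if "x \<in> ball y0 r" "cinv c x \<in> hill_region V E" for x
      using Wr[of x] that W(3) by auto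
    then show ?thesis using contains_conjugate_points[OF \<tau>\<eta>] not_minimizing by blast
  qed
  ultimately show ?thesis by blast
qed

end

theorem theorem1:
  fixes A :: "('m::{t2_space, second_countable_topology}, 'a::euclidean_space) chart set"
    and g :: "('m, 'a) tensor2" and V :: "'m \<Rightarrow> real" and E :: real and q0 :: 'm
  assumes "riemannian_manifold A g"
    and "smooth_scalar A V"
    and "regular_hill_boundary_point A V E q0"
  shows "\<forall>U \<eta>::real. hill_nhd V E q0 U \<and> \<eta> > 0 \<longrightarrow>
    (\<exists>U'\<subseteq>U. hill_nhd V E q0 U' \<and>
      (\<forall>I \<gamma>. jm_geodesic A g V E I \<gamma> \<and> \<gamma> ` I \<inter> U' \<noteq> {} \<longrightarrow>
         (\<exists>t1\<in>I. \<exists>t2\<in>I. \<gamma> t1 \<noteq> \<gamma> t2 \<and> conjugate_along A g V E \<gamma> t1 t2 \<and>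
            \<gamma> ` {t1..t2} \<subseteq> U \<and> jm_length A g V E \<gamma> t1 t2 < ennreal \<eta>) \<and>
         fails_to_minimize A g V E I \<gamma>))"
proof -
  interpret mechanics A g V using assms(1,2) by unfold_locales
  show ?thesis using jm_geodesic_conjugate_near_boundary[OF assms(3)] by blast
qed

end
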